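(* Let $k>2$. There is a constant $C=C(k)>0$ such that the semigroup $e^{t\mathcal L_0}$ on $L^1_k$ satisfies $$\|e^{t\mathcal L_0}h_0\|_{L^1_k}\le C e^{-\frac12 t}\|h_0\|_{L^1_k}\qquad\text{for all }t\ge0$$ for all $h_0\in L^1_k$ with $\int_0^\infty xh_0(x)\,dx=0$. In particular, $$\|\mathcal L_0h\|_{L^1_k}\ge\frac{1}{2C}\|h\|_{L^1_k}$$ for all $h$ in the domain of $\mathcal L_0$ with $\int_0^\infty xh(x)\,dx=0$.
   Context: $L^1_k=L^1((0,\infty),(1+x)^k\,dx)$ with norm $\|h\|_{L^1_k}=\int_0^\infty|h(x)|(1+x)^k\,dx$. For $h\in C_c^\infty(0,\infty)$ define $$\mathcal L_0[h](x)=xh'(x)+2\int_0^xe^{-(x-y)}h(y)\,dy-2e^{-x}\int_0^\infty h(y)\,dy,$$ the linearisation around $G_0(x)=e^{-x}$ of the self-similar Smoluchowski operator $f\mapsto 2f+xf'+\int_0^x f(x-y)f(y)\,dy-2f\int_0^\infty f$ (constant kernel $K=2$). On $L^1_k$, $\mathcal L_0$ denotes the closure of this operator from $C_c^\infty(0,\infty)$; it is the generator of a strongly continuous semigroup $(e^{t\mathcal L_0})_{t\ge0}$ on $L^1_k$, which preserves the subspace $\{\int_0^\infty xh(x)\,dx=0\}$. *)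

theory Defs
  imports "HOL-Analysis.Analysis"
begin

text \<open>
  Elements of \<open>L\<^sup>1\<^sub>k = L\<^sup>1((0,\<infinity>), (1+x)\<^sup>k dx)\<close> are represented by functions
  \<open>real \<Rightarrow> real\<close>; values outside \<open>(0,\<infinity>)\<close> are irrelevant, and two
  representatives stand for the same element iff they satisfy \<open>L1_eq\<close>.
\<close>

definition L1 :: "real \<Rightarrow> (real \<Rightarrow> real) set" where
  "L1 k = {h. set_integrable lborel {0<..} (\<lambda>x. h x * (1 + x) powr k)}"

definition L1_norm :: "real \<Rightarrow> (real \<Rightarrow> real) \<Rightarrow> real" where
  "L1_norm k h = (LBINT x:{0<..}. \<bar>h x\<bar> * (1 + x) powr k)"

definition L1_eq :: "(real \<Rightarrow> real) \<Rightarrow> (real \<Rightarrow> real) \<Rightarrow> bool" where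
  "L1_eq h g \<longleftrightarrow> (AE x in lborel. 0 < x \<longrightarrow> h x = g x)"

text \<open>\<open>C\<^sub>c\<^sup>\<infinity>(0,\<infinity>)\<close>, its elements being extended by \<open>0\<close> to the whole line.\<close>

definition test_functions :: "(real \<Rightarrow> real) set" where
  "test_functions = {h. (\<forall>n x. (deriv ^^ n) h field_differentiable at x) \<and>
     compact (closure {x. h x \<noteq> 0}) \<and> closure {x. h x \<noteq> 0} \<subseteq> {0<..}}"

definition lin_op :: "(real \<Rightarrow> real) \<Rightarrow> real \<Rightarrow> real" where
  "lin_op h x = x * deriv h x + 2 * (LBINT y:{0<..<x}. exp (- (x - y)) * h y)
                - 2 * exp (- x) * (LBINT y:{0<..}. h y)"

text \<open>
  Operators on \<open>L\<^sup>1\<^sub>k\<close> that need not be everywhere defined are given by their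
  graphs on representatives: \<open>(h, g)\<close> belongs to \<open>L0_graph k\<close> iff \<open>h\<close> lies in
  the domain of \<open>\<L>\<^sub>0\<close> and \<open>\<L>\<^sub>0 h = g\<close> almost everywhere on \<open>(0,\<infinity>)\<close>.
  The membership conditions on \<open>\<phi> n\<close> and \<open>lin_op (\<phi> n)\<close> hold for all test functions;
  they are stated because \<open>L1_norm\<close> has the default value \<open>0\<close> where its integral diverges.
\<close>

definition L0_graph :: "real \<Rightarrow> ((real \<Rightarrow> real) \<times> (real \<Rightarrow> real)) set" where
  "L0_graph k = {(h, g). h \<in> L1 k \<and> g \<in> L1 k \<and>
     (\<exists>\<phi> :: nat \<Rightarrow> real \<Rightarrow> real.
        (\<forall>n. \<phi> n \<in> test_functions \<and> \<phi> n \<in> L1 k \<and> lin_op (\<phi> n) \<in> L1 k) \<and>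
        (\<lambda>n. L1_norm k (\<lambda>x. \<phi> n x - h x)) \<longlonglongrightarrow> 0 \<and>
        (\<lambda>n. L1_norm k (\<lambda>x. lin_op (\<phi> n) x - g x)) \<longlonglongrightarrow> 0)}"

text \<open>
  Linearity and boundedness together make every \<open>T t\<close> respect \<open>L1_eq\<close>, so that it
  is a bounded operator on the space of equivalence classes.
\<close>

definition C0_semigroup :: "real \<Rightarrow> (real \<Rightarrow> (real \<Rightarrow> real) \<Rightarrow> (real \<Rightarrow> real)) \<Rightarrow> bool" where
  "C0_semigroup k T \<longleftrightarrow>
     (\<forall>t\<ge>0. \<forall>h\<in>L1 k. T t h \<in> L1 k) \<and>
     (\<forall>t\<ge>0. \<forall>h\<in>L1 k. \<forall>g\<in>L1 k. \<forall>a b.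
        L1_eq (T t (\<lambda>x. a * h x + b * g x)) (\<lambda>x. a * T t h x + b * T t g x)) \<and>
     (\<forall>t\<ge>0. \<exists>M. \<forall>h\<in>L1 k. L1_norm k (T t h) \<le> M * L1_norm k h) \<and>
     (\<forall>h\<in>L1 k. L1_eq (T 0 h) h) \<and>
     (\<forall>s\<ge>0. \<forall>t\<ge>0. \<forall>h\<in>L1 k. L1_eq (T (s + t) h) (T s (T t h))) \<and>
     (\<forall>h\<in>L1 k. ((\<lambda>t. L1_norm k (\<lambda>x. T t h x - h x)) \<longlongrightarrow> 0) (at_right 0))"

definition generator_graph ::
  "real \<Rightarrow> (real \<Rightarrow> (real \<Rightarrow> real) \<Rightarrow> (real \<Rightarrow> real)) \<Rightarrow> ((real \<Rightarrow> real) \<times> (real \<Rightarrow> real)) set" where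
  "generator_graph k T = {(h, g). h \<in> L1 k \<and> g \<in> L1 k \<and>
     ((\<lambda>t. L1_norm k (\<lambda>x. (T t h x - h x) / t - g x)) \<longlongrightarrow> 0) (at_right 0)}"

text \<open>\<open>T t = e\<^bsup>t\<L>\<^sub>0\<^esup>\<close>; since a strongly continuous semigroup is determined by its
  generator, this fixes \<open>T\<close> up to \<open>L1_eq\<close>.\<close>

definition L0_semigroup :: "real \<Rightarrow> (real \<Rightarrow> (real \<Rightarrow> real) \<Rightarrow> (real \<Rightarrow> real)) \<Rightarrow> bool" where
  "L0_semigroup k T \<longleftrightarrow> C0_semigroup k T \<and> generator_graph k T = L0_graph k"

definition first_moment :: "(real \<Rightarrow> real) \<Rightarrow> real" where
  "first_moment h = (LBINT x:{0<..}. x * h x)"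

end

theory Submission
  imports Defs "HOL-Real_Asymp.Real_Asymp"
begin

text \<open>
  The equation \<open>\<partial>\<^sub>t h = \<L>\<^sub>0 h\<close> can be solved in closed form. In terms of
  \<open>H(t,z) = \<integral> (e\<^bsup>-zx\<^esup> - 1) h(t,x) dx\<close> it is the transport equation
  \<open>\<partial>\<^sub>t H = - z \<partial>\<^sub>z H + (1 - z) / (1 + z) H\<close>, so that with \<open>\<lambda> = e\<^bsup>-t\<^esup>\<close>
  \<open>H(t,z) = e\<^bsup>t\<^esup> ((1 + \<lambda>z) / (1 + z))\<^sup>2 H(0,\<lambda>z)\<close>. Inverting the transform, the solution is
  \<open>h(x/\<lambda>)\<close> plus convolutions of the rescaled datum with \<open>e\<^bsup>-x\<^esup>\<close> and \<open>x e\<^bsup>-x\<^esup>\<close>, the second one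
  with a coefficient of order \<open>e\<^bsup>t\<^esup>\<close>. The integral of \<open>h\<close> enters in such a way that these
  convolutions become first differences of the two kernels, over a distance proportional
  to \<open>\<lambda>\<close>. If also the first moment of \<open>h\<close> vanishes, the linear Taylor term of the second
  kernel may be subtracted; the remainder is of order \<open>\<lambda>\<^sup>2\<close>, which beats the factor \<open>e\<^bsup>t\<^esup>\<close>
  and leaves decay like \<open>\<lambda> = e\<^bsup>-t\<^esup>\<close>. Controlling the quadratic remainder is what requires a
  weight of order \<open>k \<ge> 2\<close>.

  The first moment is conserved and carried by the stationary state \<open>(x - 1) e\<^bsup>-x\<^esup>\<close>. The
  operators \<open>evol r\<close> below are the explicit solution operators minus
  \<open>first_moment h\<close> times this state; then \<open>evol_bound\<close> gives \<open>\<parallel>evol r h\<parallel> \<le> C e\<^bsup>-r\<^esup> \<parallel>h\<parallel>\<close> on all of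
  \<open>L\<^sup>1\<^sub>k\<close>, and \<open>evol 0 h = h\<close> where the first moment vanishes. The link with \<open>\<L>\<^sub>0\<close> is \<open>evol_DERIV\<close>:
  on test functions, \<open>evol r \<phi>\<close> has the pointwise derivative \<open>evol r (\<L>\<^sub>0 \<phi>)\<close> in \<open>r\<close>.

  Integrating this derivative against \<open>e\<^bsup>-s/d\<^esup>\<close> expresses \<open>evol r \<phi>\<close> as an average of
  \<open>evol (r + s) (\<phi> - d \<L>\<^sub>0 \<phi>)\<close>. In the norm \<open>decay_norm h = sup\<^sub>r e\<^bsup>r\<^esup> \<parallel>evol r h\<parallel>\<close> this says that
  \<open>(1 + d) decay_norm h \<le> decay_norm (h - d \<L>\<^sub>0 h)\<close>, and the inequality passes to the
  closure (\<open>graph_dissipative\<close>). For \<open>d = 1\<close> it contains the lower bound for \<open>\<L>\<^sub>0\<close>.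

  For the semigroup the inequality is used as in the backward Euler scheme: \<open>T\<^sub>s h - d T\<^sub>s \<L>\<^sub>0 h\<close>
  differs from \<open>T\<^bsub>s-d\<^esub> h\<close> by \<open>o(d)\<close>, uniformly for \<open>s\<close> in a bounded interval. Hence
  \<open>decay_norm (T\<^sub>s h) \<le> (decay_norm (T\<^bsub>s-d\<^esub> h) + o(d)) / (1 + d)\<close>, and \<open>n\<close> steps of length \<open>t/n\<close>
  give \<open>decay_norm (T\<^sub>t h) \<le> e\<^bsup>-t\<^esup> decay_norm h\<close> in the limit. The uniformity rests on a uniform
  boundedness principle in \<open>L\<^sup>1\<^sub>k\<close>, and the step from the domain to all of \<open>L\<^sup>1\<^sub>k\<close> on the density
  of the test functions. The semigroup thus decays at the rate
  \<open>e\<^bsup>-t\<^esup>\<close>, which is at most the asserted \<open>e\<^bsup>-t/2\<^esup>\<close>.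
\<close>

section \<open>The weighted norm\<close>

text \<open>
  Values on \<open>(-\<infinity>,0]\<close> are arbitrary for a representative, which need not be measurable there.
\<close>

definition ext0 :: "(real \<Rightarrow> real) \<Rightarrow> real \<Rightarrow> real" where
  "ext0 h x = indicator {0<..} x * h x"

text \<open>
  A version of \<open>L1_norm\<close> with values in \<open>[0,\<infinity>]\<close>: it separates divergence from the value \<open>0\<close>, and
  Tonelli's theorem applies to it without integrability premises.
\<close>

definition wnorm :: "real \<Rightarrow> (real \<Rightarrow> real) \<Rightarrow> ennreal" where
  "wnorm k h = (\<integral>\<^sup>+x. ennreal (indicator {0<..} x * (\<bar>h x\<bar> * (1 + x) powr k)) \<partial>lborel)"

lemma weight_measurable [measurable]: "(\<lambda>x::real. (1 + x) powr k) \<in> borel_measurable borel"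
  by simp

lemma wnorm_ext0: "wnorm k h = (\<integral>\<^sup>+x. ennreal (\<bar>ext0 h x\<bar> * (1 + x) powr k) \<partial>lborel)"
  unfolding wnorm_def ext0_def by (intro nn_integral_cong) (auto simp: indicator_def)

lemma L1_iff: "h \<in> L1 k \<longleftrightarrow> ext0 h \<in> borel_measurable borel \<and> wnorm k h < \<infinity>"
proof -
  have eq: "(\<lambda>x. indicator {0<..} x *\<^sub>R (h x * (1 + x) powr k)) = (\<lambda>x. ext0 h x * (1 + x) powr k)"
    by (auto simp: ext0_def)
  have meas: "ext0 h \<in> borel_measurable borel"
    if "(\<lambda>x. ext0 h x * (1 + x) powr k) \<in> borel_measurable borel"
  proof -
    have "(\<lambda>x. (ext0 h x * (1 + x) powr k) * (1 + x) powr (- k)) \<in> borel_measurable borel"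
      using that by measurable
    also have "(\<lambda>x. (ext0 h x * (1 + x) powr k) * (1 + x) powr (- k)) = ext0 h"
      by (auto simp: ext0_def indicator_def powr_minus fun_eq_iff)
    finally show ?thesis .
  qed
  have nrm: "(\<integral>\<^sup>+x. ennreal (norm (ext0 h x * (1 + x) powr k)) \<partial>lborel) = wnorm k h"
    unfolding wnorm_ext0 by (simp add: abs_mult)
  have "h \<in> L1 k \<longleftrightarrow> integrable lborel (\<lambda>x. ext0 h x * (1 + x) powr k)"
    unfolding L1_def mem_Collect_eq set_integrable_def eq ..
  also have "\<dots> \<longleftrightarrow> (\<lambda>x. ext0 h x * (1 + x) powr k) \<in> borel_measurable borel \<and> wnorm k h < \<infinity>"
    unfolding integrable_iff_bounded nrm by simp
  also have "\<dots> \<longleftrightarrow> ext0 h \<in> borel_measurable borel \<and> wnorm k h < \<infinity>"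
    using meas borel_measurable_times[OF _ weight_measurable] by metis
  finally show ?thesis .
qed

lemma L1_measurable: "h \<in> L1 k \<Longrightarrow> ext0 h \<in> borel_measurable borel"
  by (simp add: L1_iff)

lemma wnorm_eq:
  assumes "h \<in> L1 k"
  shows "wnorm k h = ennreal (L1_norm k h)"
proof -
  have "set_integrable lborel {0<..} (\<lambda>x. \<bar>h x\<bar> * (1 + x) powr k)"
    using set_integrable_abs[of lborel "{0<..}" "\<lambda>x. h x * (1 + x) powr k"] assms
    by (simp add: L1_def abs_mult)
  then show ?thesis
    unfolding wnorm_def L1_norm_def set_lebesgue_integral_def set_integrable_def
    by (subst nn_integral_eq_integral[symmetric]) (auto simp: indicator_def)
qed

lemma L1_norm_nonneg: "0 \<le> L1_norm k h"
  unfolding L1_norm_def set_lebesgue_integral_def by (intro Bochner_Integration.integral_nonneg) auto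

lemma L1_normI: "h \<in> L1 k \<Longrightarrow> wnorm k h \<le> ennreal c \<Longrightarrow> 0 \<le> c \<Longrightarrow> L1_norm k h \<le> c"
  by (simp add: wnorm_eq)

lemma ext0_lin: "ext0 (\<lambda>x. a * h x + b * g x) = (\<lambda>x. a * ext0 h x + b * ext0 g x)"
  by (auto simp: ext0_def algebra_simps)

lemma wnorm_lin:
  assumes "ext0 h \<in> borel_measurable borel" "ext0 g \<in> borel_measurable borel"
  shows "wnorm k (\<lambda>x. a * h x + b * g x) \<le> ennreal \<bar>a\<bar> * wnorm k h + ennreal \<bar>b\<bar> * wnorm k g"
proof -
  note [measurable] = assms
  have "wnorm k (\<lambda>x. a * h x + b * g x) \<le> (\<integral>\<^sup>+x. ennreal \<bar>a\<bar> * ennreal (\<bar>ext0 h x\<bar> * (1 + x) powr k)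
     + ennreal \<bar>b\<bar> * ennreal (\<bar>ext0 g x\<bar> * (1 + x) powr k) \<partial>lborel)"
    unfolding wnorm_ext0 ext0_lin
  proof (intro nn_integral_mono)
    fix x
    have "\<bar>a * ext0 h x + b * ext0 g x\<bar> * (1 + x) powr k
        \<le> (\<bar>a\<bar> * \<bar>ext0 h x\<bar> + \<bar>b\<bar> * \<bar>ext0 g x\<bar>) * (1 + x) powr k"
      by (intro mult_right_mono) (auto simp flip: abs_mult)
    then show "ennreal (\<bar>a * ext0 h x + b * ext0 g x\<bar> * (1 + x) powr k)
        \<le> ennreal \<bar>a\<bar> * ennreal (\<bar>ext0 h x\<bar> * (1 + x) powr k)
          + ennreal \<bar>b\<bar> * ennreal (\<bar>ext0 g x\<bar> * (1 + x) powr k)"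
      by (simp add: ennreal_mult'[symmetric] ennreal_plus[symmetric] algebra_simps del: ennreal_plus)
  qed
  also have "\<dots> = ennreal \<bar>a\<bar> * wnorm k h + ennreal \<bar>b\<bar> * wnorm k g"
    unfolding wnorm_ext0 by (subst nn_integral_add) (auto simp: nn_integral_cmult)
  finally show ?thesis .
qed

lemma L1_lin:
  assumes "h \<in> L1 k" "g \<in> L1 k"
  shows "(\<lambda>x. a * h x + b * g x) \<in> L1 k"
    and "L1_norm k (\<lambda>x. a * h x + b * g x) \<le> \<bar>a\<bar> * L1_norm k h + \<bar>b\<bar> * L1_norm k g"
proof -
  note [measurable] = assms[THEN L1_measurable]
  have *: "wnorm k (\<lambda>x. a * h x + b * g x) \<le> ennreal (\<bar>a\<bar> * L1_norm k h + \<bar>b\<bar> * L1_norm k g)"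
    using wnorm_lin[of h g k a b] assms
    by (simp add: L1_measurable wnorm_eq L1_norm_nonneg ennreal_mult)
  then show **: "(\<lambda>x. a * h x + b * g x) \<in> L1 k"
    by (auto simp: L1_iff ext0_lin intro: le_less_trans)
  show "L1_norm k (\<lambda>x. a * h x + b * g x) \<le> \<bar>a\<bar> * L1_norm k h + \<bar>b\<bar> * L1_norm k g"
    by (rule L1_normI[OF ** *]) (auto simp: L1_norm_nonneg)
qed

lemma L1_add:
  assumes "h \<in> L1 k" "g \<in> L1 k"
  shows "(\<lambda>x. h x + g x) \<in> L1 k" "L1_norm k (\<lambda>x. h x + g x) \<le> L1_norm k h + L1_norm k g"
  using L1_lin[OF assms, of 1 1] by simp_all

lemma L1_diff:
  assumes "h \<in> L1 k" "g \<in> L1 k"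
  shows "(\<lambda>x. h x - g x) \<in> L1 k" "L1_norm k (\<lambda>x. h x - g x) \<le> L1_norm k h + L1_norm k g"
  using L1_lin[OF assms, of 1 "-1"] by simp_all

lemma L1_norm_cmult: "L1_norm k (\<lambda>x. c * h x) = \<bar>c\<bar> * L1_norm k h"
  unfolding L1_norm_def by (simp add: abs_mult mult.assoc)

lemma L1_cmult: "h \<in> L1 k \<Longrightarrow> (\<lambda>x. c * h x) \<in> L1 k"
  using L1_lin(1)[of h k h c 0] by simp

lemma L1_norm_minus: "L1_norm k (\<lambda>x. - h x) = L1_norm k h"
  using L1_norm_cmult[of k "-1" h] by simp

lemma L1_norm_commute: "L1_norm k (\<lambda>x. h x - g x) = L1_norm k (\<lambda>x. g x - h x)"
  using L1_norm_minus[of k "\<lambda>x. h x - g x"] by simp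

lemma L1_norm_triangle:
  assumes "h \<in> L1 k" "f \<in> L1 k" "g \<in> L1 k"
  shows "L1_norm k (\<lambda>x. h x - g x) \<le> L1_norm k (\<lambda>x. h x - f x) + L1_norm k (\<lambda>x. f x - g x)"
  using L1_add(2)[of "\<lambda>x. h x - f x" k "\<lambda>x. f x - g x"] assms by (simp add: L1_diff)

lemma L1_norm_le_diff:
  assumes "h \<in> L1 k" "g \<in> L1 k"
  shows "L1_norm k h \<le> L1_norm k g + L1_norm k (\<lambda>x. h x - g x)"
  using L1_add(2)[of g k "\<lambda>x. h x - g x"] assms by (simp add: L1_diff)

lemma L1_zero: "(\<lambda>x. 0) \<in> L1 k"
  by (simp add: L1_def set_integrable_def)

lemma L1_eq_norm_0: "L1_eq h g \<Longrightarrow> L1_norm k (\<lambda>x. h x - g x) = 0"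
  unfolding L1_norm_def set_lebesgue_integral_def L1_eq_def
  by (rule integral_eq_zero_AE) (auto elim: eventually_mono simp: indicator_def)

lemma L1_dominated:
  assumes "g \<in> L1 k" "ext0 h \<in> borel_measurable borel" "\<And>x. x > 0 \<Longrightarrow> \<bar>h x\<bar> \<le> \<bar>g x\<bar>"
  shows "h \<in> L1 k"
proof -
  have "wnorm k h \<le> wnorm k g"
    unfolding wnorm_def
    by (intro nn_integral_mono ennreal_leI) (auto simp: indicator_def assms intro!: mult_right_mono)
  then show ?thesis using assms by (auto simp: L1_iff intro: le_less_trans)
qed

lemma L1_norm_dominated_convergence:
  assumes g: "g \<in> L1 k" and hn: "\<And>n. ext0 (hn n) \<in> borel_measurable borel"
    and h: "ext0 h \<in> borel_measurable borel"
    and bnd: "\<And>n x. x > 0 \<Longrightarrow> \<bar>hn n x\<bar> \<le> \<bar>g x\<bar>"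
    and lim: "\<And>x. x > 0 \<Longrightarrow> (\<lambda>n. hn n x) \<longlonglongrightarrow> h x"
  shows "h \<in> L1 k" "(\<lambda>n. L1_norm k (\<lambda>x. hn n x - h x)) \<longlonglongrightarrow> 0"
proof -
  have hb: "\<bar>h x\<bar> \<le> \<bar>g x\<bar>" if "x > 0" for x
    by (rule LIMSEQ_le_const2[OF tendsto_rabs[OF lim[OF that]]]) (auto simp: bnd that)
  show "h \<in> L1 k" by (rule L1_dominated[OF g h hb])
  let ?D = "\<lambda>n x. \<bar>ext0 (hn n) x - ext0 h x\<bar> * (1 + x) powr k"
  have *: "(\<lambda>n. LINT x|lborel. ?D n x)
      \<longlonglongrightarrow> (LINT x|(lborel :: real measure). 0)"
  proof (rule integral_dominated_convergence[where w = "\<lambda>x. 2 * \<bar>ext0 g x * (1 + x) powr k\<bar>"])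
    show "(\<lambda>x::real. 0::real) \<in> borel_measurable lborel" by simp
    show "(\<lambda>x. ?D n x) \<in> borel_measurable lborel" for n
      using hn[of n] h by simp
    show "integrable lborel (\<lambda>x. 2 * \<bar>ext0 g x * (1 + x) powr k\<bar>)"
      using g by (auto simp: L1_def set_integrable_def ext0_def mult.assoc)
    show "AE x in lborel. (\<lambda>n. ?D n x) \<longlonglongrightarrow> 0"
    proof (intro AE_I2)
      fix x :: real
      show "(\<lambda>n. ?D n x) \<longlonglongrightarrow> 0"
      proof (cases "x > 0")
        case True
        have "(\<lambda>n. \<bar>hn n x - h x\<bar> * (1 + x) powr k) \<longlonglongrightarrow> \<bar>h x - h x\<bar> * (1 + x) powr k"
          by (intro tendsto_intros lim True)
        then show ?thesis using True by (simp add: ext0_def)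
      qed (simp add: ext0_def)
    qed
    show "AE x in lborel. norm (?D n x) \<le> 2 * \<bar>ext0 g x * (1 + x) powr k\<bar>" for n
    proof (intro AE_I2)
      fix x :: real
      show "norm (?D n x) \<le> 2 * \<bar>ext0 g x * (1 + x) powr k\<bar>"
      proof (cases "x > 0")
        case True
        have "\<bar>hn n x - h x\<bar> * (1 + x) powr k \<le> (2 * \<bar>g x\<bar>) * (1 + x) powr k"
          using bnd[OF True, of n] hb[OF True] by (intro mult_right_mono) auto
        then show ?thesis using True by (simp add: ext0_def abs_mult)
      qed (simp add: ext0_def)
    qed
  qed
  have eq: "L1_norm k (\<lambda>x. hn n x - h x) = (LINT x|lborel. ?D n x)" for n
    unfolding L1_norm_def set_lebesgue_integral_def
    by (intro Bochner_Integration.integral_cong) (auto simp: ext0_def indicator_def)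
  show "(\<lambda>n. L1_norm k (\<lambda>x. hn n x - h x)) \<longlonglongrightarrow> 0"
    using * unfolding eq by simp
qed

text \<open>
  Functionals with a density of growth \<open>(1 + u)\<^sup>k\<close> are continuous; this is applied to the
  moments and to the kernel of the propagator.
\<close>

lemma L1_integrable_mult:
  assumes h: "h \<in> L1 k" and g [measurable]: "g \<in> borel_measurable borel"
    and bnd: "\<And>u. u > 0 \<Longrightarrow> \<bar>g u\<bar> \<le> c * (1 + u) powr k"
  shows "set_integrable lborel {0<..} (\<lambda>u. g u * h u)"
    and "\<bar>LBINT u:{0<..}. g u * h u\<bar> \<le> c * L1_norm k h"
proof -
  note [measurable] = L1_measurable[OF h]
  have i: "integrable lborel (\<lambda>x. c * (\<bar>ext0 h x\<bar> * (1 + x) powr k))"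
  proof -
    have "integrable lborel (\<lambda>x. c * \<bar>ext0 h x * (1 + x) powr k\<bar>)"
      using h by (auto simp: L1_def set_integrable_def ext0_def mult.assoc)
    then show ?thesis by (simp add: abs_mult)
  qed
  have eq: "(\<lambda>u. indicator {0<..} u *\<^sub>R (g u * h u)) = (\<lambda>u. g u * ext0 h u)"
    by (auto simp: ext0_def)
  have le: "\<bar>g x * ext0 h x\<bar> \<le> c * (\<bar>ext0 h x\<bar> * (1 + x) powr k)" for x
    using mult_left_mono[OF bnd[of x], of "\<bar>h x\<bar>"]
    by (auto simp: ext0_def indicator_def abs_mult mult_ac)
  show si: "set_integrable lborel {0<..} (\<lambda>u. g u * h u)"
    unfolding set_integrable_def eq
    by (rule Bochner_Integration.integrable_bound[OF i])
       (auto intro!: AE_I2 order_trans[OF le])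
  have "\<bar>LBINT u:{0<..}. g u * h u\<bar> \<le> (LINT u|lborel. \<bar>g u * ext0 h u\<bar>)"
    unfolding set_lebesgue_integral_def eq by (rule integral_abs_bound)
  also have "\<dots> \<le> (LINT u|lborel. c * (\<bar>ext0 h u\<bar> * (1 + u) powr k))"
    using si unfolding set_integrable_def eq
    by (intro integral_mono i le) auto
  also have "\<dots> = c * L1_norm k h"
    unfolding L1_norm_def set_lebesgue_integral_def
    by (simp, intro disjI2 Bochner_Integration.integral_cong) (auto simp: ext0_def indicator_def)
  finally show "\<bar>LBINT u:{0<..}. g u * h u\<bar> \<le> c * L1_norm k h" .
qed

section \<open>Density of the test functions\<close>

text \<open>
  The flat function \<open>e\<^bsup>-1/u\<^esup>\<close> together with its multiples by powers of \<open>1/u\<close>: the derivatives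
  of \<open>theta 0\<close> stay in the linear span of this family.
\<close>

definition theta :: "nat \<Rightarrow> real \<Rightarrow> real" where
  "theta j u = (if u > 0 then exp (- (1 / u)) / u ^ j else 0)"

lemma power_le_fact_exp:
  assumes "(x::real) \<ge> 0" shows "x ^ n \<le> fact n * exp x"
proof -
  have "(\<lambda>i. x ^ i /\<^sub>R fact i) sums exp x" by (rule exp_converges)
  then have "(\<Sum>i\<in>{n}. x ^ i /\<^sub>R fact i) \<le> exp x"
    by (subst sums_unique, assumption, intro sum_le_suminf) (use assms in \<open>auto simp: sums_iff\<close>)
  then show ?thesis by (simp add: field_simps)
qed

text \<open>
  The quadratic bound makes every member differentiable at \<open>0\<close> with derivative \<open>0\<close>.
\<close>

lemma theta_bound: "\<bar>theta j u\<bar> \<le> fact (j + 2) * u\<^sup>2"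
proof (cases "u > 0")
  case True
  have "(1 / u) ^ (j + 2) \<le> fact (j + 2) * exp (1 / u)"
    by (rule power_le_fact_exp) (use True in auto)
  then have "exp (- (1 / u)) * (1 / u) ^ (j + 2) \<le> exp (- (1 / u)) * (fact (j + 2) * exp (1 / u))"
    by (intro mult_left_mono) auto
  also have "\<dots> = fact (j + 2)"
    by (simp add: exp_minus del: fact_Suc)
  finally have "exp (- (1 / u)) * (1 / u) ^ (j + 2) \<le> fact (j + 2)" .
  then have "exp (- (1 / u)) / u ^ j * (1 / u\<^sup>2) \<le> fact (j + 2)"
    by (simp add: power_add power_divide del: fact_Suc add_2_eq_Suc')
  then have "exp (- (1 / u)) / u ^ j \<le> fact (j + 2) * u\<^sup>2"
    using True by (simp add: field_simps)
  then show ?thesis using True by (simp add: theta_def)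
qed (simp add: theta_def)

lemma theta_DERIV: "(theta j has_field_derivative theta (j + 2) u - real j * theta (j + 1) u) (at u)"
proof (cases u "0::real" rule: linorder_cases)
  case less
  have "((\<lambda>u. 0) has_field_derivative 0) (at u)" by simp
  then have "(theta j has_field_derivative 0) (at u)"
    by (rule has_field_derivative_transform_within_open[where S = "{..<0}"]) (use less in \<open>auto simp: theta_def\<close>)
  then show ?thesis using less by (simp add: theta_def)
next
  case equal
  have "((\<lambda>h. (theta j (0 + h) - theta j 0) / h) \<longlongrightarrow> 0) (at 0)"
  proof (rule Lim_null_comparison)
    show "\<forall>\<^sub>F h in at 0. norm ((theta j (0 + h) - theta j 0) / h) \<le> fact (j + 2) * \<bar>h\<bar>"
    proof (rule always_eventually, rule allI)
      fix h :: real
      show "norm ((theta j (0 + h) - theta j 0) / h) \<le> fact (j + 2) * \<bar>h\<bar>"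
        using theta_bound[of j h]
        by (cases "h = 0") (auto simp: theta_def[of j 0] divide_le_eq power2_eq_square abs_mult mult.assoc simp del: fact_Suc)
    qed
    have "((\<lambda>h::real. fact (j + 2) * \<bar>h\<bar>) \<longlongrightarrow> fact (j + 2) * \<bar>0\<bar>) (at 0)"
      by (intro tendsto_intros)
    then show "((\<lambda>h::real. fact (j + 2) * \<bar>h\<bar>) \<longlongrightarrow> 0) (at 0)" by simp
  qed
  then show ?thesis using equal by (simp add: DERIV_def theta_def)
next
  case greater
  have "((\<lambda>u. exp (- (1 / u)) / u ^ j) has_field_derivative theta (j + 2) u - real j * theta (j + 1) u) (at u)"
  proof (cases j)
    case 0
    then show ?thesis using greater
      by (auto intro!: derivative_eq_intros simp: theta_def power2_eq_square)
  next
    case (Suc i)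
    have "((\<lambda>u. exp (- (1 / u)) / u ^ Suc i) has_field_derivative
        (exp (- (1 / u)) * (1 / u\<^sup>2) * u ^ Suc i - exp (- (1 / u)) * (real (Suc i) * u ^ i)) / (u ^ Suc i * u ^ Suc i)) (at u)"
      using greater by (auto intro!: derivative_eq_intros simp: power2_eq_square simp del: of_nat_Suc power_Suc)
    moreover have "(exp (- (1 / u)) * (1 / u\<^sup>2) * u ^ Suc i - exp (- (1 / u)) * (real (Suc i) * u ^ i)) / (u ^ Suc i * u ^ Suc i)
        = theta (Suc i + 2) u - real (Suc i) * theta (Suc i + 1) u"
      using greater by (simp add: theta_def power2_eq_square divide_simps) (simp add: algebra_simps)
    ultimately show ?thesis unfolding Suc by (rule DERIV_cong)
  qed
  then show ?thesis
    by (rule has_field_derivative_transform_within_open[where S = "{0<..}"]) (use greater in \<open>auto simp: theta_def\<close>)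
qed

definition smooth :: "(real \<Rightarrow> real) \<Rightarrow> bool" where
  "smooth f \<longleftrightarrow> (\<forall>n x. (deriv ^^ n) f field_differentiable at x)"

text \<open>
  Smoothness without formulas for the higher derivatives: it suffices that the function
  belongs to a class which is closed under differentiation.
\<close>

lemma smooth_coinduct:
  assumes "f \<in> X" and X: "\<And>g. g \<in> X \<Longrightarrow> \<exists>g'\<in>X. \<forall>x. (g has_field_derivative g' x) (at x)"
  shows "smooth f"
proof -
  have "(deriv ^^ n) f \<in> X" for n
  proof (induction n)
    case (Suc n)
    from X[OF this] obtain g' where g': "g' \<in> X" "\<forall>x. ((deriv ^^ n) f has_field_derivative g' x) (at x)" by blast
    then have "deriv ((deriv ^^ n) f) = g'" by (auto intro!: ext DERIV_imp_deriv)
    then show ?case using g' by simp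
  qed (use assms in simp)
  then show ?thesis unfolding smooth_def field_differentiable_def using X by blast
qed

lemma smooth_deriv: "smooth f \<Longrightarrow> smooth (deriv f)"
  unfolding smooth_def
proof (intro allI)
  fix n x assume "\<forall>n x. (deriv ^^ n) f field_differentiable at x"
  then have "(deriv ^^ (Suc n)) f field_differentiable at x" by blast
  then show "(deriv ^^ n) (deriv f) field_differentiable at x" by (simp add: funpow_swap1)
qed

lemma smooth_DERIV: "smooth f \<Longrightarrow> (f has_field_derivative deriv f x) (at x)"
  unfolding smooth_def by (metis funpow_0 field_differentiable_derivI)

lemma smooth_continuous: "smooth f \<Longrightarrow> continuous_on A f"
  by (meson smooth_DERIV DERIV_isCont continuous_at_imp_continuous_on)

lemma smooth_lin:
  assumes "smooth f" "smooth g" shows "smooth (\<lambda>x. p * f x + q * g x)"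
proof (rule smooth_coinduct[where X = "{\<lambda>x. p * f x + q * g x |f g. smooth f \<and> smooth g}"])
  fix h assume "h \<in> {\<lambda>x. p * f x + q * g x |f g. smooth f \<and> smooth g}"
  then obtain f g where h: "h = (\<lambda>x. p * f x + q * g x)" "smooth f" "smooth g" by blast
  have "(h has_field_derivative (\<lambda>x. p * deriv f x + q * deriv g x) x) (at x)" for x
    unfolding h(1) by (auto intro!: derivative_eq_intros smooth_DERIV h)
  then show "\<exists>g'\<in>{\<lambda>x. p * f x + q * g x |f g. smooth f \<and> smooth g}. \<forall>x. (h has_field_derivative g' x) (at x)"
    using h(2,3)[THEN smooth_deriv] by (intro bexI[of _ "\<lambda>x. p * deriv f x + q * deriv g x"]) auto
qed (use assms in blast)

text \<open>
  Bounds on the support are easier to combine than closures of non-vanishing sets.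
\<close>

lemma test_functions_iff:
  "h \<in> test_functions \<longleftrightarrow> smooth h \<and> (\<exists>a b. 0 < a \<and> a < b \<and> (\<forall>x. x \<notin> {a..b} \<longrightarrow> h x = 0))"
proof
  assume h: "h \<in> test_functions"
  define S where "S = closure {x. h x \<noteq> 0}"
  have S: "compact S" "S \<subseteq> {0<..}" and sm: "smooth h"
    using h by (auto simp: test_functions_def S_def smooth_def)
  have out: "x \<in> S" if "h x \<noteq> 0" for x using that closure_subset[of "{x. h x \<noteq> 0}"] by (auto simp: S_def)
  have "\<exists>a b. 0 < a \<and> a < b \<and> (\<forall>x. x \<notin> {a..b} \<longrightarrow> h x = 0)"
  proof (cases "S = {}")
    case True
    then have "h x = 0" for x using out by blast
    then show ?thesis by (intro exI[of _ 1] exI[of _ 2]) auto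
  next
    case False
    obtain a where a: "a \<in> S" "\<forall>x\<in>S. a \<le> x" using compact_attains_inf[OF S(1) False] by blast
    obtain b where b: "b \<in> S" "\<forall>x\<in>S. x \<le> b" using compact_attains_sup[OF S(1) False] by blast
    show ?thesis
    proof (intro exI conjI allI impI)
      show "0 < a" using a S by auto
      show "a < b + 1" using a(1) b(2) by fastforce
      show "h x = 0" if "x \<notin> {a..b + 1}" for x
        using that bspec[OF a(2), of x] bspec[OF b(2), of x] out[of x] by (cases "h x = 0") auto
    qed
  qed
  with sm show "smooth h \<and> (\<exists>a b. 0 < a \<and> a < b \<and> (\<forall>x. x \<notin> {a..b} \<longrightarrow> h x = 0))" by blast
next
  assume "smooth h \<and> (\<exists>a b. 0 < a \<and> a < b \<and> (\<forall>x. x \<notin> {a..b} \<longrightarrow> h x = 0))"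
  then obtain a b where ab: "smooth h" "0 < a" "\<forall>x. x \<notin> {a..b} \<longrightarrow> h x = 0" by blast
  then have sub: "closure {x. h x \<noteq> 0} \<subseteq> {a..b}"
    by (intro closure_minimal) auto
  then have "compact (closure {x. h x \<noteq> 0})"
    by (meson bounded_closed_interval bounded_subset closed_closure compact_eq_bounded_closed)
  then show "h \<in> test_functions"
    using ab sub by (auto simp: test_functions_def smooth_def)
qed

lemma test_function_L1:
  assumes "h \<in> test_functions" shows "h \<in> L1 k"
proof -
  obtain a b where ab: "smooth h" "0 < a" "\<And>x. x \<notin> {a..b} \<Longrightarrow> h x = 0"
    using assms unfolding test_functions_iff by blast
  have "integrable lborel (\<lambda>x. indicator {a..b} x *\<^sub>R (h x * (1 + x) powr k))"
    using ab(2) by (intro borel_integrable_compact compact_Icc continuous_intros smooth_continuous ab) auto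
  also have "(\<lambda>x. indicator {a..b} x *\<^sub>R (h x * (1 + x) powr k)) = (\<lambda>x. indicator {0<..} x *\<^sub>R (h x * (1 + x) powr k))"
    using ab(2,3) by (fastforce simp: indicator_def fun_eq_iff)
  finally show ?thesis by (simp add: L1_def set_integrable_def)
qed

lemma test_function_lin:
  assumes "f \<in> test_functions" "g \<in> test_functions"
  shows "(\<lambda>x. p * f x + q * g x) \<in> test_functions"
proof -
  obtain a b where ab: "smooth f" "0 < a" "a < b" "\<And>x. x \<notin> {a..b} \<Longrightarrow> f x = 0"
    using assms unfolding test_functions_iff by blast
  obtain c d where cd: "smooth g" "0 < c" "c < d" "\<And>x. x \<notin> {c..d} \<Longrightarrow> g x = 0"
    using assms unfolding test_functions_iff by blast
  show ?thesis unfolding test_functions_iff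
  proof (intro conjI smooth_lin ab(1) cd(1) exI allI impI)
    show "0 < min a c" "min a c < max b d" using ab cd by auto
    show "p * f x + q * g x = 0" if "x \<notin> {min a c..max b d}" for x
      using ab(4)[of x] cd(4)[of x] that by (cases "x \<in> {a..b}"; cases "x \<in> {c..d}") auto
  qed
qed

inductive_set bumps :: "real \<Rightarrow> real \<Rightarrow> real \<Rightarrow> (real \<Rightarrow> real) set" for c a b where
  base: "(\<lambda>x. theta i (c * (x - a)) * theta j (c * (b - x))) \<in> bumps c a b"
| lin: "f \<in> bumps c a b \<Longrightarrow> g \<in> bumps c a b \<Longrightarrow> (\<lambda>x. p * f x + q * g x) \<in> bumps c a b"

lemma bumps_DERIV:
  "f \<in> bumps c a b \<Longrightarrow> \<exists>f'\<in>bumps c a b. \<forall>x. (f has_field_derivative f' x) (at x)"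
proof (induction rule: bumps.induct)
  case (base i j)
  let ?B = "\<lambda>i j x. theta i (c * (x - a)) * theta j (c * (b - x))"
  let ?f' = "\<lambda>x. 1 * (c * ?B (i + 2) j x + (- c * real i) * ?B (i + 1) j x)
      + 1 * ((- c) * ?B i (j + 2) x + (c * real j) * ?B i (j + 1) x)"
  have "(?B i j has_field_derivative ?f' x) (at x)" for x
    by (rule derivative_eq_intros DERIV_chain2[OF theta_DERIV] refl | simp add: algebra_simps)+
  moreover have "?f' \<in> bumps c a b" by (intro bumps.intros)
  ultimately show ?case by (intro bexI[of _ ?f']) auto
next
  case (lin f g p q)
  then obtain f' g' where *: "f' \<in> bumps c a b" "\<forall>x. (f has_field_derivative f' x) (at x)"
    "g' \<in> bumps c a b" "\<forall>x. (g has_field_derivative g' x) (at x)" by blast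
  then have "((\<lambda>x. p * f x + q * g x) has_field_derivative p * f' x + q * g' x) (at x)" for x
    by (auto intro!: derivative_eq_intros)
  then show ?case by (intro bexI[of _ "\<lambda>x. p * f' x + q * g' x"] bumps.lin *) auto
qed

definition bump :: "real \<Rightarrow> real \<Rightarrow> real \<Rightarrow> real \<Rightarrow> real" where
  "bump c a b x = theta 0 (c * (x - a)) * theta 0 (c * (b - x))"

lemma bump_test_function:
  assumes "0 < a" "a < b" "0 < c" shows "bump c a b \<in> test_functions"
  unfolding test_functions_iff
proof (intro conjI exI allI impI)
  show "smooth (bump c a b)"
    unfolding bump_def by (rule smooth_coinduct[OF bumps.base bumps_DERIV])
  show "bump c a b x = 0" if "x \<notin> {a..b}" for x
    using that assms by (auto simp: bump_def theta_def zero_less_mult_iff)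
qed (use assms in auto)

lemma bump_bound: "c > 0 \<Longrightarrow> \<bar>bump c a b x\<bar> \<le> indicator {a..b} x"
  by (auto simp: bump_def theta_def indicator_def mult_le_one zero_less_mult_iff)

lemma bump_tendsto: "(\<lambda>n. bump (real (Suc n)) a b x) \<longlonglongrightarrow> indicator {a<..<b} x"
proof (cases "x \<in> {a<..<b}")
  case True
  have "(\<lambda>n. theta 0 (real (Suc n) * y)) \<longlonglongrightarrow> 1" if "y > 0" for y
  proof -
    have "(\<lambda>n. exp (- (inverse (real (Suc n)) * inverse y))) \<longlonglongrightarrow> exp (- (0 * inverse y))"
      by (intro tendsto_intros LIMSEQ_inverse_real_of_nat)
    moreover have "theta 0 (real (Suc n) * y) = exp (- (inverse (real (Suc n)) * inverse y))" for n
    proof -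
      have "real (Suc n) * y > 0" using that by simp
      then show ?thesis unfolding theta_def by (simp add: inverse_eq_divide)
    qed
    ultimately show ?thesis by simp
  qed
  from tendsto_mult[OF this[of "x - a"] this[of "b - x"]] show ?thesis
    using True by (simp add: bump_def)
next
  case False
  then show ?thesis by (auto simp: bump_def theta_def indicator_def zero_less_mult_iff)
qed

definition test_closure :: "real \<Rightarrow> (real \<Rightarrow> real) set" where
  "test_closure k = {h \<in> L1 k. \<forall>e>0. \<exists>\<phi>\<in>test_functions. L1_norm k (\<lambda>x. \<phi> x - h x) < e}"

lemma test_closure_closed:
  assumes h: "h \<in> L1 k" and "\<And>e. e > 0 \<Longrightarrow> \<exists>g\<in>test_closure k. L1_norm k (\<lambda>x. g x - h x) < e"
  shows "h \<in> test_closure k"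
  unfolding test_closure_def
proof (intro CollectI conjI h allI impI)
  fix e :: real assume "e > 0"
  then obtain g where g: "g \<in> test_closure k" "L1_norm k (\<lambda>x. g x - h x) < e / 2"
    using assms(2)[of "e / 2"] by auto
  then obtain \<phi> where p: "\<phi> \<in> test_functions" "L1_norm k (\<lambda>x. \<phi> x - g x) < e / 2"
    using \<open>e > 0\<close> unfolding test_closure_def by (auto dest!: spec[of _ "e / 2"])
  have "g \<in> L1 k" using g by (simp add: test_closure_def)
  from L1_norm_triangle[OF test_function_L1[OF p(1)] this h] p g
  show "\<exists>\<phi>\<in>test_functions. L1_norm k (\<lambda>x. \<phi> x - h x) < e" by (intro bexI[of _ \<phi>]) auto
qed

lemma test_closure_limit:
  assumes "h \<in> L1 k" "\<And>n. g n \<in> test_closure k" "(\<lambda>n. L1_norm k (\<lambda>x. g n x - h x)) \<longlonglongrightarrow> 0"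
  shows "h \<in> test_closure k"
proof (rule test_closure_closed[OF assms(1)])
  fix e :: real assume "e > 0"
  then have "\<forall>\<^sub>F n in sequentially. L1_norm k (\<lambda>x. g n x - h x) < e"
    by (rule order_tendstoD(2)[OF assms(3)])
  then obtain n where "L1_norm k (\<lambda>x. g n x - h x) < e" by (auto simp: eventually_sequentially)
  then show "\<exists>g\<in>test_closure k. L1_norm k (\<lambda>x. g x - h x) < e" using assms(2) by blast
qed

lemma test_functions_closure: "h \<in> test_functions \<Longrightarrow> h \<in> test_closure k"
  by (auto simp: test_closure_def test_function_L1 L1_norm_def intro!: bexI[of _ h])

lemma test_closure_lin:
  assumes "f \<in> test_closure k" "g \<in> test_closure k"
  shows "(\<lambda>x. p * f x + q * g x) \<in> test_closure k"
proof -
  have fg: "f \<in> L1 k" "g \<in> L1 k" using assms by (auto simp: test_closure_def)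
  show ?thesis
    unfolding test_closure_def
  proof (intro CollectI conjI L1_lin fg allI impI)
    fix e :: real assume e: "e > 0"
    define d where "d = e / (\<bar>p\<bar> + \<bar>q\<bar> + 1)"
    have d: "d > 0" using e by (auto simp: d_def)
    have de: "(\<bar>p\<bar> + \<bar>q\<bar>) * d < e"
      using e by (auto simp: d_def field_simps)
    obtain \<phi> where \<phi>: "\<phi> \<in> test_functions" "L1_norm k (\<lambda>x. \<phi> x - f x) < d"
      using assms d unfolding test_closure_def by blast
    obtain \<psi> where \<psi>: "\<psi> \<in> test_functions" "L1_norm k (\<lambda>x. \<psi> x - g x) < d"
      using assms d unfolding test_closure_def by blast
    have "L1_norm k (\<lambda>x. p * (\<phi> x - f x) + q * (\<psi> x - g x))
        \<le> \<bar>p\<bar> * L1_norm k (\<lambda>x. \<phi> x - f x) + \<bar>q\<bar> * L1_norm k (\<lambda>x. \<psi> x - g x)"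
      by (intro L1_lin L1_diff test_function_L1 \<phi> \<psi> fg)
    also have "\<dots> \<le> \<bar>p\<bar> * d + \<bar>q\<bar> * d"
      using \<phi> \<psi> by (intro add_mono mult_left_mono) auto
    also have "\<dots> < e" using de by (simp add: algebra_simps)
    also have "(\<lambda>x. p * (\<phi> x - f x) + q * (\<psi> x - g x)) = (\<lambda>x. (p * \<phi> x + q * \<psi> x) - (p * f x + q * g x))"
      by (auto simp: algebra_simps)
    finally show "\<exists>\<phi>\<in>test_functions. L1_norm k (\<lambda>x. \<phi> x - (p * f x + q * g x)) < e"
      by (intro bexI[OF _ test_function_lin[OF \<phi>(1) \<psi>(1)]])
  qed
qed

lemma indicator_Icc_L1: "0 < a \<Longrightarrow> indicator {a..b} \<in> L1 k"
proof -
  assume a: "0 < a"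
  have "integrable lborel (\<lambda>x. indicator {a..b} x *\<^sub>R ((1 + x) powr k))"
    using a by (intro borel_integrable_compact compact_Icc continuous_intros) auto
  also have "(\<lambda>x. indicator {a..b} x *\<^sub>R ((1 + x) powr k)) = (\<lambda>x. indicator {0<..} x *\<^sub>R (indicator {a..b} x * (1 + x) powr k))"
    using a by (auto simp: indicator_def fun_eq_iff)
  finally show ?thesis by (simp add: L1_def set_integrable_def)
qed

lemma ext0_measurable: "f \<in> borel_measurable borel \<Longrightarrow> ext0 f \<in> borel_measurable borel"
  unfolding ext0_def[abs_def] by measurable

text \<open>
  As \<open>n \<rightarrow> \<infinity>\<close> the products \<open>e\<^bsup>-1/(n(x-a))\<^esup> e\<^bsup>-1/(n(b-x))\<^esup>\<close> increase to the indicator of \<open>(a,b)\<close>.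
\<close>

lemma open_interval_closure:
  assumes "0 < a" shows "indicator {a<..<b} \<in> test_closure k"
proof (cases "a < b")
  case True
  have m: "bump (real (Suc n)) a b \<in> borel_measurable borel" for n
    using bump_test_function[OF assms True, of "real (Suc n)"]
    by (auto simp: test_functions_iff intro!: borel_measurable_continuous_onI smooth_continuous)
  have *: "indicator {a<..<b} \<in> L1 k" "(\<lambda>n. L1_norm k (\<lambda>x. bump (real (Suc n)) a b x - indicator {a<..<b} x)) \<longlonglongrightarrow> 0"
    using L1_norm_dominated_convergence[OF indicator_Icc_L1[OF assms, of b k]
        ext0_measurable[OF m] ext0_measurable _ bump_tendsto] bump_bound by auto
  show ?thesis
    by (rule test_closure_limit[OF *(1) _ *(2)])
       (intro test_functions_closure bump_test_function assms True, simp)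
next
  case False
  then have "indicator {a<..<b} = (\<lambda>x. 0 :: real)" by auto
  moreover have "(\<lambda>x. 0 :: real) \<in> test_functions"
    unfolding test_functions_iff
    by (intro conjI exI[of _ 1] exI[of _ 2] smooth_coinduct[where X = "{\<lambda>x. 0}"]) auto
  ultimately show ?thesis using test_functions_closure by metis
qed

lemma indicator_limit:
  assumes G: "indicator G \<in> L1 k" and A: "\<And>n. A n \<in> sets borel" "B \<in> sets borel" "\<And>n. A n \<subseteq> G"
    and lim: "\<And>x. x > 0 \<Longrightarrow> (\<lambda>n. indicator (A n) x :: real) \<longlonglongrightarrow> indicator B x"
  shows "indicator B \<in> L1 k"
    and "(\<lambda>n. L1_norm k (\<lambda>x. indicator (A n) x - indicator B x)) \<longlonglongrightarrow> 0"
proof -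
  have m: "ext0 (indicator (A n)) \<in> borel_measurable borel" "ext0 (indicator B) \<in> borel_measurable borel" for n
    using A by (auto intro!: ext0_measurable borel_measurable_indicator)
  have bnd: "\<bar>indicator (A n) x :: real\<bar> \<le> \<bar>indicator G x\<bar>" for n x
    using A(3)[of n] by (auto simp: indicator_def)
  note * = L1_norm_dominated_convergence[OF G m bnd lim]
  show "indicator B \<in> L1 k" by (rule *(1))
  show "(\<lambda>n. L1_norm k (\<lambda>x. indicator (A n) x - indicator B x)) \<longlonglongrightarrow> 0" by (rule *(2))
qed

text \<open>
  Truncation to an interval bounded away from \<open>0\<close> makes complements and countable disjoint
  unions harmless for the norm, whatever \<open>k\<close> is; hence Dynkin's argument applies, with the
  half-lines as generator.
\<close>

lemma borel_truncated_closure: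
  assumes a: "0 < a" and A: "A \<in> sets borel"
  shows "indicator (A \<inter> {a<..<b}) \<in> test_closure k"
proof -
  have "{..<a} \<inter> {..<b} = {..<min a b}" for a b :: real by auto
  then have "Int_stable (range (\<lambda>c::real. {..<c}))" by (auto simp: Int_stable_def)
  moreover have "range (\<lambda>c::real. {..<c}) \<subseteq> Pow UNIV" by simp
  moreover have "A \<in> sigma_sets UNIV (range (\<lambda>c. {..<c}))"
    using A unfolding borel_Iio by simp
  ultimately show ?thesis
  proof (induct rule: sigma_sets_induct_disjoint)
    case (basic A)
    then obtain c where "A = {..<c}" by auto
    then have "A \<inter> {a<..<b} = {a<..<min b c}" by auto
    then show ?case using open_interval_closure[OF a] by simp
  next
    case empty
    have "{} \<inter> {a<..<b} = {a<..<a}" by simp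
    then show ?case using open_interval_closure[OF a, of a k] by (simp only:)
  next
    case (compl A)
    have "indicator ((UNIV - A) \<inter> {a<..<b}) = (\<lambda>x. 1 * indicator {a<..<b} x + (- 1) * indicator (A \<inter> {a<..<b}) x :: real)"
      by (auto simp: indicator_def fun_eq_iff)
    then show ?case using test_closure_lin[OF open_interval_closure[OF a] compl(2), of 1 b "-1"] by simp
  next
    case (union A)
    have Am: "A i \<in> sets borel" for i
      using union(2) unfolding borel_Iio by auto
    let ?S = "\<lambda>n x. indicator ((\<Union>i<n. A i) \<inter> {a<..<b}) x :: real"
    have step: "?S n \<in> test_closure k" for n
    proof (induction n)
      case 0
      have "(\<Union>i<0. A i) \<inter> {a<..<b} = {a<..<a}" by simp
      then show ?case using open_interval_closure[OF a, of a k] by (simp only:)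
    next
      case (Suc n)
      have "A n \<inter> A i = {}" if "i < n" for i
        using union(1) that by (intro disjoint_family_onD) auto
      then have "A n \<inter> (\<Union>i<n. A i) = {}" by blast
      then have "?S (Suc n) = (\<lambda>x. 1 * ?S n x + 1 * indicator (A n \<inter> {a<..<b}) x)"
        by (auto simp: indicator_def fun_eq_iff lessThan_Suc)
      then show ?case using test_closure_lin[OF Suc.IH union(3)[of n], of 1 1] by simp
    qed
    have lim: "(\<lambda>n. ?S n x) \<longlonglongrightarrow> indicator ((\<Union>i. A i) \<inter> {a<..<b}) x" for x
    proof (cases "x \<in> (\<Union>i. A i) \<inter> {a<..<b}")
      case True
      then obtain i where i: "x \<in> A i" by blast
      have "\<forall>\<^sub>F n in sequentially. ?S n x = indicator ((\<Union>i. A i) \<inter> {a<..<b}) x"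
        using eventually_gt_at_top[of i] by eventually_elim (use i True in \<open>auto simp: indicator_def\<close>)
      then show ?thesis by (rule tendsto_eventually)
    qed (auto simp: indicator_def intro!: tendsto_eventually)
    have *: "indicator ((\<Union>i. A i) \<inter> {a<..<b}) \<in> L1 k"
      "(\<lambda>n. L1_norm k (\<lambda>x. ?S n x - indicator ((\<Union>i. A i) \<inter> {a<..<b}) x)) \<longlonglongrightarrow> 0"
      by (rule indicator_limit[OF indicator_Icc_L1[OF a, of b k] _ _ _ lim]; use Am in auto)+
    show ?case by (rule test_closure_limit[OF *(1) step *(2)])
  qed
qed

lemma test_functions_dense:
  assumes h: "h \<in> L1 k" shows "h \<in> test_closure k"
proof -
  define M where "M = density lborel (\<lambda>x::real. ennreal (indicator {0<..} x * (1 + x) powr k))"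
  have int_M: "integrable M f \<longleftrightarrow> f \<in> L1 k" if [measurable]: "f \<in> borel_measurable borel" for f :: "real \<Rightarrow> real"
    unfolding M_def L1_def set_integrable_def
    by (subst integrable_density) (auto simp: mult_ac)
  have L1: "f \<in> L1 k" if "integrable M f" for f :: "real \<Rightarrow> real"
    using int_M[of f] that borel_measurable_integrable[OF that] by (simp add: M_def)
  have "integrable M (ext0 h)"
    unfolding int_M[OF L1_measurable[OF h]]
    by (rule L1_dominated[OF h]) (auto intro!: ext0_measurable L1_measurable[OF h] simp: ext0_def[of h])
  then have "ext0 h \<in> test_closure k"
  proof (induct rule: integrable_induct)
    case (base A c)
    have A: "A \<in> sets borel" using base by (simp add: M_def)
    have "indicator A \<in> L1 k" by (rule L1, rule integrable_real_indicator[OF base(1,2)])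
    let ?I = "\<lambda>n. {inverse (real (Suc n))<..<real n}"
    have lim: "(\<lambda>n. indicator (A \<inter> ?I n) x) \<longlonglongrightarrow> (indicator A x :: real)" if "x > 0" for x
    proof (rule tendsto_eventually)
      have "\<forall>\<^sub>F n in sequentially. inverse (real (Suc n)) < x"
        by (rule order_tendstoD(2)[OF LIMSEQ_inverse_real_of_nat that])
      moreover have "\<forall>\<^sub>F n in sequentially. x < real n"
        by (rule eventually_sequentiallyI[of "nat \<lfloor>x\<rfloor> + 1"]) linarith
      ultimately show "\<forall>\<^sub>F n in sequentially. indicator (A \<inter> ?I n) x = (indicator A x :: real)"
        by eventually_elim (auto simp: indicator_def)
    qed
    have *: "(\<lambda>n. L1_norm k (\<lambda>x. indicator (A \<inter> ?I n) x - indicator A x)) \<longlonglongrightarrow> 0"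
      by (rule indicator_limit(2)[OF \<open>indicator A \<in> L1 k\<close> _ _ _ lim]) (use A in auto)
    have "indicator A \<in> test_closure k"
      by (rule test_closure_limit[OF \<open>indicator A \<in> L1 k\<close> _ *])
         (intro borel_truncated_closure A, simp)
    from test_closure_lin[OF this this, of c 0] show ?case by (simp add: mult.commute)
  next
    case (add f g)
    then show ?case using test_closure_lin[of f k g 1 1] by simp
  next
    case (lim f s)
    have fm: "f \<in> borel_measurable borel" and sm: "s i \<in> borel_measurable borel" for i
      using borel_measurable_integrable[OF lim(1)] borel_measurable_integrable[OF lim(5)]
      by (simp_all add: M_def)
    have fL: "(\<lambda>x. 2 * f x) \<in> L1 k" by (intro L1_cmult L1 lim)
    have *: "(\<lambda>n. L1_norm k (\<lambda>x. s n x - f x)) \<longlonglongrightarrow> 0"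
    proof (rule L1_norm_dominated_convergence(2)[OF fL ext0_measurable[OF sm] ext0_measurable[OF fm]])
      show "\<bar>s n x\<bar> \<le> \<bar>2 * f x\<bar>" for n x using lim(4)[of x n] by (simp add: M_def abs_mult)
      show "(\<lambda>n. s n x) \<longlonglongrightarrow> f x" for x using lim(3)[of x] by (simp add: M_def)
    qed
    show ?case by (rule test_closure_limit[OF L1[OF lim(5)] lim(2) *])
  qed
  then have "h \<in> test_closure k" if "L1_norm k (\<lambda>x. ext0 h x - h x) = 0"
    by (intro test_closure_closed[OF h] bexI[of _ "ext0 h"]) (auto simp: that)
  then show ?thesis
    using L1_eq_norm_0[of "ext0 h" h k] by (simp add: L1_eq_def ext0_def)
qed

section \<open>The operator on test functions\<close>

text \<open>
  From \<open>1 + x \<le> a e\<^bsup>x/a\<^esup>\<close> with \<open>a = 2|k| + 1\<close>, raised to the power \<open>|k|\<close>.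
\<close>

definition growth_const :: "real \<Rightarrow> real" where
  "growth_const k = (2 * \<bar>k\<bar> + 1) powr \<bar>k\<bar>"

lemma weight_le_exp:
  assumes x: "x \<ge> 0"
  shows "(1 + x) powr k \<le> growth_const k * exp (x / 2)"
proof -
  define a where "a = 2 * \<bar>k\<bar> + 1"
  have a: "a \<ge> 1" by (simp add: a_def)
  have "1 + x \<le> a * (1 + x / a)" using a x by (simp add: field_simps)
  also have "\<dots> \<le> a * exp (x / a)" using a by (intro mult_left_mono exp_ge_add_one_self) auto
  finally have "(1 + x) powr \<bar>k\<bar> \<le> (a * exp (x / a)) powr \<bar>k\<bar>" using x by (intro powr_mono2) auto
  also have "\<dots> = a powr \<bar>k\<bar> * exp (\<bar>k\<bar> * x / a)"
    using a by (subst powr_mult) (auto simp: powr_def)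
  also have "\<dots> \<le> a powr \<bar>k\<bar> * exp (x / 2)"
    using x by (intro mult_left_mono) (auto simp: a_def field_simps)
  finally have "(1 + x) powr \<bar>k\<bar> \<le> growth_const k * exp (x / 2)" by (simp add: a_def growth_const_def)
  moreover have "(1 + x) powr k \<le> (1 + x) powr \<bar>k\<bar>" using x by (intro powr_mono) auto
  ultimately show ?thesis by linarith
qed

lemma weight_exp_bound:
  assumes "x \<ge> 0"
  shows "(1 + x) powr k * exp (- x) \<le> growth_const k"
proof -
  have "(1 + x) powr k * exp (- x) \<le> growth_const k * exp (x / 2) * exp (- x)"
    by (intro mult_right_mono weight_le_exp assms) auto
  also have "\<dots> = growth_const k * exp (- (x / 2))" by (simp add: mult_exp_exp)
  also have "\<dots> \<le> growth_const k * 1"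
    using assms by (intro mult_left_mono) (auto simp: growth_const_def)
  finally show ?thesis by simp
qed

lemma exp_neg_L1: "(\<lambda>x. exp (- x)) \<in> L1 k"
proof -
  have "set_integrable lborel {0<..} (\<lambda>x. growth_const k * exp (- (1 / 2) * x))"
  proof (intro set_integrable_mult_right)
    let ?F = "\<lambda>x::real. - 2 * exp (- (1 / 2) * x)"
    have "set_integrable lborel (einterval (ereal 0) \<infinity>) (\<lambda>x. exp (- (1 / 2) * x))"
    proof (rule interval_integral_FTC_nonneg(1))
      show "(?F has_real_derivative exp (- (1 / 2) * x)) (at x)" for x
        by (auto intro!: derivative_eq_intros)
      have "(?F \<longlongrightarrow> ?F 0) (at_right 0)" by (intro tendsto_intros)
      then show "((?F \<circ> real_of_ereal) \<longlongrightarrow> ?F 0) (at_right (ereal 0))"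
        unfolding ereal_tendsto_simps1 .
      have "(?F \<longlongrightarrow> 0) at_top" by real_asymp
      then show "((?F \<circ> real_of_ereal) \<longlongrightarrow> 0) (at_left \<infinity>)"
        unfolding ereal_tendsto_simps1 .
    qed auto
    then show "set_integrable lborel {0<..} (\<lambda>x::real. exp (- (1 / 2) * x))" by simp
  qed
  then have "set_integrable lborel {0<..} (\<lambda>x. exp (- x) * (1 + x) powr k)"
  proof (rule set_integrable_bound)
    show "AE x in lborel. x \<in> {0<..} \<longrightarrow> norm (exp (- x) * (1 + x) powr k) \<le> norm (growth_const k * exp (- (1 / 2) * x))"
    proof (intro AE_I2 impI)
      fix x :: real assume "x \<in> {0<..}"
      then have "exp (- x) * (1 + x) powr k \<le> exp (- x) * (growth_const k * exp (x / 2))"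
        by (intro mult_left_mono weight_le_exp) auto
      also have "\<dots> = growth_const k * exp (- (1 / 2) * x)" by (simp add: mult_exp_exp)
      finally show "norm (exp (- x) * (1 + x) powr k) \<le> norm (growth_const k * exp (- (1 / 2) * x))" by simp
    qed
  qed (simp add: set_borel_measurable_def)
  then show ?thesis by (simp add: L1_def)
qed

definition zeroth_moment :: "(real \<Rightarrow> real) \<Rightarrow> real" where
  "zeroth_moment h = (LBINT x:{0<..}. h x)"

text \<open>
  The convolution of \<open>h\<close> with \<open>e\<^bsup>-x\<^esup>\<close> is \<open>e\<^bsup>-x\<^esup> expint h x\<close>; in this form it can be differentiated
  by the fundamental theorem of calculus.
\<close>

definition expint :: "(real \<Rightarrow> real) \<Rightarrow> real \<Rightarrow> real" where
  "expint h x = integral {0..x} (\<lambda>y. exp y * h y)"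

lemma LBINT_eq_integral:
  fixes f :: "real \<Rightarrow> real"
  assumes "continuous_on {0..x} f"
  shows "(LBINT y:{0<..<x}. f y) = integral {0..x} f"
proof -
  have "set_integrable lborel {0..x} f"
    unfolding set_integrable_def by (intro borel_integrable_compact compact_Icc assms)
  then have "set_integrable lborel {0<..<x} f"
    by (rule set_integrable_subset) auto
  then show ?thesis
    by (simp add: set_borel_integral_eq_integral integral_open_interval_real)
qed

text \<open>
  Since \<open>f\<close> vanishes for \<open>x \<le> 0\<close>, the lower limit may be moved to a negative number, which makes
  the derivative two-sided also at \<open>t = 0\<close>.
\<close>

lemma test_integral_DERIV:
  assumes f: "continuous_on UNIV f" "\<And>x. x \<le> 0 \<Longrightarrow> f x = 0"
  shows "((\<lambda>t. integral {0..t} f) has_field_derivative f t) (at (t::real))"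
proof -
  define c where "c = min 0 t - 1"
  have c: "c < 0" "c < t" by (auto simp: c_def)
  have "((\<lambda>u. integral {c..u} f) has_vector_derivative f t) (at t within {c..t + 1})"
    by (rule integral_has_vector_derivative[OF continuous_on_subset[OF f(1)]]) (use c in auto)
  then have "((\<lambda>u. integral {c..u} f) has_field_derivative f t) (at t)"
    using c by (simp add: has_real_derivative_iff_has_vector_derivative at_within_Icc_at)
  then show ?thesis
  proof (rule has_field_derivative_transform_within_open[where S = "{c<..}"])
    fix u assume u: "u \<in> {c<..}"
    have z: "integral {c..v} f = 0" if "v \<le> 0" for v
      using integral_cong[of "{c..v}" f "\<lambda>x. 0"] f(2) that by simp
    show "integral {c..u} f = integral {0..u} f"
    proof (cases "u \<le> 0")
      case True
      then show ?thesis using z[OF True] by (cases "u = 0") auto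
    next
      case False
      have "integral {c..0} f + integral {0..u} f = integral {c..u} f"
        by (rule Henstock_Kurzweil_Integration.integral_combine) (use c False in \<open>auto intro!: integrable_continuous_real continuous_on_subset[OF f(1)]\<close>)
      then show ?thesis using z[of 0] by simp
    qed
  qed (use c in auto)
qed

lemma test_moment_eq:
  assumes h: "smooth h" "\<And>x. x \<notin> {a..b} \<Longrightarrow> h x = 0" and w: "continuous_on UNIV w" and X: "b < X"
  shows "(LBINT y:{0<..}. w y * h y) = integral {0..X} (\<lambda>y. w y * (h y::real))"
proof -
  have "(LBINT y:{0<..}. w y * h y) = (LBINT y:{0<..<X}. w y * h y)"
    unfolding set_lebesgue_integral_def
    by (intro Bochner_Integration.integral_cong) (use h(2) X in \<open>auto simp: indicator_def\<close>)
  also have "\<dots> = integral {0..X} (\<lambda>y. w y * h y)"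
    by (intro LBINT_eq_integral continuous_intros continuous_on_subset[OF w] smooth_continuous h) auto
  finally show ?thesis .
qed

locale test_function =
  fixes \<phi> :: "real \<Rightarrow> real" and a b :: real
  assumes smooth: "smooth \<phi>" and ab: "0 < a" "a < b" and supp: "\<And>x. x \<notin> {a..b} \<Longrightarrow> \<phi> x = 0"
begin

lemma test: "\<phi> \<in> test_functions"
  using smooth ab supp by (auto simp: test_functions_iff)

lemma cont [continuous_intros]: "continuous_on A \<phi>" "continuous_on A (deriv \<phi>)"
  by (intro smooth_continuous smooth smooth_deriv)+

lemma supp_deriv: "x \<notin> {a..b} \<Longrightarrow> deriv \<phi> x = 0"
proof -
  assume "x \<notin> {a..b}"
  moreover have "((\<lambda>x. 0) has_field_derivative 0) (at x)" by simp
  ultimately have "(\<phi> has_field_derivative 0) (at x)"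
    by (intro has_field_derivative_transform_within_open[of "\<lambda>x. 0" 0 x "- {a..b}" \<phi>]) (auto simp: supp)
  then show ?thesis by (rule DERIV_imp_deriv)
qed

lemma int_DERIV:
  assumes "continuous_on UNIV w"
  shows "((\<lambda>t. integral {0..t} (\<lambda>y. w y * \<phi> y)) has_field_derivative w t * \<phi> t) (at t)"
  by (rule test_integral_DERIV) (use ab supp in \<open>auto intro!: continuous_intros assms\<close>)

lemma expint_DERIV: "(expint \<phi> has_field_derivative exp t * \<phi> t) (at t)"
  unfolding expint_def[abs_def] by (intro int_DERIV continuous_intros)

lemma expint_cont: "continuous_on A (expint \<phi>)"
  by (meson expint_DERIV DERIV_isCont continuous_at_imp_continuous_on)

lemma expint_const: "x \<ge> b \<Longrightarrow> expint \<phi> x = expint \<phi> b"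
proof (cases "x = b")
  case False
  assume "x \<ge> b"
  then have "b < x" using False by simp
  then obtain z where z: "b < z" "expint \<phi> x - expint \<phi> b = (x - b) * (exp z * \<phi> z)"
    using MVT2[of b x "expint \<phi>" "\<lambda>t. exp t * \<phi> t"] expint_DERIV by blast
  then show ?thesis using supp[of z] by simp
qed simp

abbreviation "excess x \<equiv> expint \<phi> x - zeroth_moment \<phi>"

lemma lin_op_eq:
  assumes "x \<ge> 0"
  shows "lin_op \<phi> x = x * deriv \<phi> x + 2 * exp (- x) * excess x"
proof -
  have "(LBINT y:{0<..<x}. exp (- (x - y)) * \<phi> y) = integral {0..x} (\<lambda>y. exp (- (x - y)) * \<phi> y)"
    by (intro LBINT_eq_integral continuous_intros)
  also have "\<dots> = integral {0..x} (\<lambda>y. exp (- x) * (exp y * \<phi> y))"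
    by (intro integral_cong) (simp add: exp_diff exp_minus field_simps)
  also have "\<dots> = exp (- x) * expint \<phi> x"
    by (simp add: expint_def)
  finally show ?thesis by (simp add: lin_op_def zeroth_moment_def algebra_simps)
qed

lemma lin_op_cont: "continuous_on {0..} (lin_op \<phi>)"
proof -
  have "continuous_on {0..} (\<lambda>x. x * deriv \<phi> x + 2 * exp (- x) * excess x)"
    by (intro continuous_intros expint_cont)
  then show ?thesis by (rule continuous_on_eq) (auto simp: lin_op_eq)
qed

text \<open>
  Near infinity \<open>lin_op \<phi>\<close> is a multiple of \<open>e\<^bsup>-x\<^esup>\<close>, so it is no test function, but every weight
  is admissible.
\<close>

lemma lin_op_L1: "lin_op \<phi> \<in> L1 k"
proof -
  have "bounded (expint \<phi> ` {0..b})"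
    by (intro compact_imp_bounded compact_continuous_image expint_cont compact_Icc)
  then obtain B where "\<forall>x\<in>{0..b}. \<bar>expint \<phi> x\<bar> \<le> B"
    by (auto simp: bounded_iff)
  then have B: "\<bar>expint \<phi> x\<bar> \<le> B" if "x \<in> {0..b}" for x using that by blast
  have B': "\<bar>expint \<phi> x\<bar> \<le> B" if "x \<ge> 0" for x
    using B[of x] B[of b] expint_const[of x] that ab by (cases "x \<le> b") auto
  have d: "deriv \<phi> \<in> test_functions"
    unfolding test_functions_iff using smooth_deriv[OF smooth] supp_deriv ab by blast
  let ?g = "\<lambda>x. b * \<bar>deriv \<phi> x\<bar> + (2 * (B + \<bar>zeroth_moment \<phi>\<bar>)) * exp (- x)"
  have "?g \<in> L1 k"
  proof (intro L1_lin exp_neg_L1)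
    have "ext0 (\<lambda>x. \<bar>deriv \<phi> x\<bar>) \<in> borel_measurable borel"
      by (intro ext0_measurable borel_measurable_continuous_onI continuous_intros)
    then show "(\<lambda>x. \<bar>deriv \<phi> x\<bar>) \<in> L1 k"
      by (rule L1_dominated[OF test_function_L1[OF d]]) simp
  qed
  then show ?thesis
  proof (rule L1_dominated)
    have "(\<lambda>x. indicator {0<..} x *\<^sub>R lin_op \<phi> x) \<in> borel_measurable borel"
      by (intro borel_measurable_continuous_on_indicator continuous_on_subset[OF lin_op_cont]) auto
    then show "ext0 (lin_op \<phi>) \<in> borel_measurable borel" by (simp add: ext0_def[abs_def])
    fix x :: real assume x: "x > 0"
    have "\<bar>x * deriv \<phi> x\<bar> \<le> b * \<bar>deriv \<phi> x\<bar>"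
      using x supp_deriv[of x] by (cases "x \<in> {a..b}") (auto simp: abs_mult intro!: mult_right_mono)
    moreover have "\<bar>2 * exp (- x) * excess x\<bar> \<le> 2 * exp (- x) * (B + \<bar>zeroth_moment \<phi>\<bar>)"
      using B'[of x] x by (auto simp: abs_mult intro!: mult_left_mono)
    moreover have "0 \<le> B" using B[of b] ab by auto
    ultimately show "\<bar>lin_op \<phi> x\<bar> \<le> \<bar>?g x\<bar>"
      using x ab by (simp add: lin_op_eq algebra_simps)
  qed
qed

lemma lin_op_moment_aux:
  assumes c: "continuous_on {0..} F" "\<And>x. x > 0 \<Longrightarrow> (F has_field_derivative w x * lin_op \<phi> x) (at x)"
    and w: "continuous_on UNIV w" "set_integrable lborel {0<..} (\<lambda>x. w x * lin_op \<phi> x)"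
    and lim: "(F \<longlongrightarrow> B) at_top"
  shows "(LBINT x:{0<..}. w x * lin_op \<phi> x) = B - F 0"
proof -
  have "(LBINT x=ereal 0..\<infinity>. w x * lin_op \<phi> x) = B - F 0"
  proof (rule interval_integral_FTC_integrable)
    fix x assume "ereal 0 < ereal x"
    then have x: "x > 0" by simp
    show "(F has_vector_derivative w x * lin_op \<phi> x) (at x)"
      using c(2)[OF x] by (simp add: has_real_derivative_iff_has_vector_derivative)
    have "continuous_on {0<..} (\<lambda>x. w x * lin_op \<phi> x)"
      by (intro continuous_intros continuous_on_subset[OF w(1)] continuous_on_subset[OF lin_op_cont]) auto
    then show "isCont (\<lambda>x. w x * lin_op \<phi> x) x"
      using x by (simp add: continuous_on_eq_continuous_at)
  next
    show "set_integrable lborel (einterval (ereal 0) \<infinity>) (\<lambda>x. w x * lin_op \<phi> x)"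
      using w(2) by simp
    have "(F \<longlongrightarrow> F 0) (at 0 within {0..})"
      using c(1) by (auto simp: continuous_on_def)
    then have "(F \<longlongrightarrow> F 0) (at_right 0)"
      by (rule tendsto_within_subset) auto
    then show "((F \<circ> real_of_ereal) \<longlongrightarrow> F 0) (at_right (ereal 0))"
      unfolding ereal_tendsto_simps1 .
    show "((F \<circ> real_of_ereal) \<longlongrightarrow> B) (at_left \<infinity>)"
      using lim unfolding ereal_tendsto_simps1 .
  qed simp
  then show ?thesis by (simp add: interval_lebesgue_integral_def)
qed

lemma expint_decay:
  "((\<lambda>x. exp (- x) * excess x) \<longlongrightarrow> 0) at_top"
  "((\<lambda>x. x * exp (- x) * excess x) \<longlongrightarrow> 0) at_top"
proof -
  have ev: "\<forall>\<^sub>F x in at_top. expint \<phi> b - zeroth_moment \<phi> = expint \<phi> x - zeroth_moment \<phi>"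
    using eventually_ge_at_top[of b] by eventually_elim (metis expint_const)
  have l: "((\<lambda>x::real. exp (- x)) \<longlongrightarrow> 0) at_top" "((\<lambda>x::real. x * exp (- x)) \<longlongrightarrow> 0) at_top"
    by real_asymp+
  show "((\<lambda>x. exp (- x) * excess x) \<longlongrightarrow> 0) at_top"
    by (rule Lim_transform_eventually[where f = "\<lambda>x. exp (- x) * (expint \<phi> b - zeroth_moment \<phi>)"])
       (use ev tendsto_mult_left_zero[OF l(1)] in \<open>auto elim: eventually_mono\<close>)
  show "((\<lambda>x. x * exp (- x) * excess x) \<longlongrightarrow> 0) at_top"
    by (rule Lim_transform_eventually[where f = "\<lambda>x. x * exp (- x) * (expint \<phi> b - zeroth_moment \<phi>)"])
       (use ev tendsto_mult_left_zero[OF l(2)] in \<open>auto elim: eventually_mono\<close>)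
qed

lemma zeroth_moment_integral: "x > b \<Longrightarrow> integral {0..x} \<phi> = zeroth_moment \<phi>"
  using test_moment_eq[OF smooth supp, where w = "\<lambda>x. 1" and X = x] by (simp add: zeroth_moment_def)

lemma mass_DERIV: "((\<lambda>t. integral {0..t} \<phi>) has_field_derivative \<phi> t) (at t)"
  using int_DERIV[of "\<lambda>_. 1" t] by simp

text \<open>
  Integration by parts gives \<open>- zeroth_moment \<phi>\<close> from the drift \<open>x h'\<close>; the two nonlocal terms have
  equal integrals, as \<open>e\<^bsup>-x\<^esup>\<close> has mass one.
\<close>

lemma zeroth_moment_lin_op: "zeroth_moment (lin_op \<phi>) = - zeroth_moment \<phi>"
proof -
  let ?F = "\<lambda>x. x * \<phi> x + integral {0..x} \<phi> - 2 * (exp (- x) * excess x)"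
  have D: "(?F has_field_derivative 1 * lin_op \<phi> x) (at x)" if "x > 0" for x
  proof -
    have "(?F has_field_derivative x * deriv \<phi> x + 2 * exp (- x) * excess x) (at x)"
      by (rule derivative_eq_intros smooth_DERIV[OF smooth] mass_DERIV expint_DERIV refl | simp)+
         (insert exp_minus_inverse[of x], algebra)
    then show ?thesis using that by (simp add: lin_op_eq)
  qed
  have C: "continuous_on {0..} ?F"
    by (intro continuous_intros expint_cont continuous_at_imp_continuous_on ballI DERIV_isCont[OF mass_DERIV])
  have I: "set_integrable lborel {0<..} (\<lambda>x. 1 * lin_op \<phi> x)"
    using lin_op_L1[of 0] by (rule L1_integrable_mult(1)[where c = 1]) auto
  have "((\<lambda>x. zeroth_moment \<phi> - 2 * (exp (- x) * excess x)) \<longlongrightarrow> zeroth_moment \<phi> - 2 * 0) at_top"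
    by (intro tendsto_intros expint_decay)
  then have "(?F \<longlongrightarrow> zeroth_moment \<phi> - 2 * 0) at_top"
  proof (rule Lim_transform_eventually)
    show "\<forall>\<^sub>F x in at_top. zeroth_moment \<phi> - 2 * (exp (- x) * excess x) = ?F x"
      using eventually_gt_at_top[of b] by eventually_elim (simp add: zeroth_moment_integral supp)
  qed
  from lin_op_moment_aux[OF C D _ I this] show ?thesis
    by (simp add: zeroth_moment_def[of "lin_op \<phi>"] expint_def)
qed

text \<open>
  Conservation of the first moment: with \<open>m\<^sub>0, m\<^sub>1\<close> the moments of \<open>\<phi>\<close>, the three terms of the operator
  contribute \<open>- 2 m\<^sub>1\<close>, \<open>2 (m\<^sub>0 + m\<^sub>1)\<close> and \<open>- 2 m\<^sub>0\<close>.
\<close>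

lemma first_moment_lin_op: "first_moment (lin_op \<phi>) = 0"
proof -
  let ?e = "\<lambda>x. exp (- x) * excess x"
  let ?F = "\<lambda>x. x\<^sup>2 * \<phi> x - 2 * (x * exp (- x) * excess x) - 2 * ?e x + 2 * integral {0..x} \<phi>"
  have D: "(?F has_field_derivative x * lin_op \<phi> x) (at x)" if "x > 0" for x
  proof -
    have "(?F has_field_derivative x * (x * deriv \<phi> x + 2 * exp (- x) * excess x)) (at x)"
      by (rule derivative_eq_intros smooth_DERIV[OF smooth] mass_DERIV expint_DERIV refl | simp)+
         (insert exp_minus_inverse[of x], algebra)
    then show ?thesis using that by (simp add: lin_op_eq)
  qed
  have C: "continuous_on {0..} ?F"
    by (intro continuous_intros expint_cont continuous_at_imp_continuous_on ballI DERIV_isCont[OF mass_DERIV])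
  have I: "set_integrable lborel {0<..} (\<lambda>x. x * lin_op \<phi> x)"
    using lin_op_L1[of 1] by (rule L1_integrable_mult(1)[where c = 1]) auto
  have "((\<lambda>x. - 2 * (x * exp (- x) * excess x) - 2 * ?e x + 2 * zeroth_moment \<phi>)
     \<longlongrightarrow> - 2 * 0 - 2 * 0 + 2 * zeroth_moment \<phi>) at_top"
    by (intro tendsto_intros expint_decay)
  then have "(?F \<longlongrightarrow> - 2 * 0 - 2 * 0 + 2 * zeroth_moment \<phi>) at_top"
  proof (rule Lim_transform_eventually)
    show "\<forall>\<^sub>F x in at_top. - 2 * (x * exp (- x) * excess x) - 2 * ?e x + 2 * zeroth_moment \<phi> = ?F x"
      using eventually_gt_at_top[of b] by eventually_elim (simp add: zeroth_moment_integral supp)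
  qed
  from lin_op_moment_aux[OF C D _ I this] show ?thesis
    by (simp add: first_moment_def[of "lin_op \<phi>"] expint_def)
qed

end

section \<open>The explicit propagator\<close>

definition expd :: "real \<Rightarrow> real" where
  "expd s = (if s > 0 then exp (- s) else 0)"

text \<open>
  With \<open>\<lambda> = e\<^bsup>-r\<^esup>\<close>, \<open>E(s) = e\<^bsup>-s\<^esup>\<close> and \<open>f(s) = s e\<^bsup>-s\<^esup>\<close> for \<open>s > 0\<close> (zero otherwise), the factor
  \<open>((1 + \<lambda>z) / (1 + z))\<^sup>2 = (\<lambda> + (1 - \<lambda>) / (1 + z))\<^sup>2\<close> is the transform of
  \<open>\<lambda>\<^sup>2 \<delta> + 2 \<lambda> (1 - \<lambda>) E + (1 - \<lambda>)\<^sup>2 f\<close>. The first two summands are the regular part of the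
  solution operator; the last one subtracts the stationary state \<open>(x - 1) e\<^bsup>-x\<^esup>\<close>, with the first
  moment as its coefficient.
\<close>

definition kern :: "real \<Rightarrow> real \<Rightarrow> real \<Rightarrow> real" where
  "kern r x u = 2 * (1 - exp (- r)) * (expd (x - exp (- r) * u) - expd x)
     + (1 - exp (- r))\<^sup>2 * exp r * ((x - exp (- r) * u) * expd (x - exp (- r) * u) - x * expd x)
     + u * ((1 - x) * exp (- x))"

definition evol :: "real \<Rightarrow> (real \<Rightarrow> real) \<Rightarrow> real \<Rightarrow> real" where
  "evol r h x = h (exp r * x) + (LBINT u:{0<..}. kern r x u * h u)"

text \<open>
  The substitution \<open>u = e\<^bsup>r\<^esup> y\<close> moves the dependence on \<open>r\<close> from the domain of integration to
  the argument of \<open>h\<close>, where it can be differentiated.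
\<close>

lemma scaled_integral:
  fixes r x :: real and h w :: "real \<Rightarrow> real"
  assumes h: "continuous_on {0..} h" and w: "continuous_on UNIV w" and x: "x > 0"
  defines "f \<equiv> \<lambda>u. (if exp (- r) * u < x then w (exp (- r) * u) else 0) * h u"
  shows "set_integrable lborel {0<..} f"
    and "(LBINT u:{0<..}. f u) = exp r * integral {0..x} (\<lambda>y. w y * (h (exp r * y) :: real))"
proof -
  define X where "X = exp r * x"
  have lt: "exp (- r) * u < x \<longleftrightarrow> u < X" for u by (simp add: X_def exp_minus field_simps)
  have f: "(\<lambda>u. indicator {0<..} u *\<^sub>R f u) = (\<lambda>u. indicator {0<..<X} u *\<^sub>R (w (exp (- r) * u) * h u))"
    by (auto simp: f_def lt indicator_def fun_eq_iff)
  have c: "continuous_on {0..X} (\<lambda>u. w (exp (- r) * u) * h u)"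
    by (intro continuous_intros continuous_on_compose2[OF w] continuous_on_subset[OF h]) auto
  have "set_integrable lborel {0..X} (\<lambda>u. w (exp (- r) * u) * h u)"
    unfolding set_integrable_def by (intro borel_integrable_compact compact_Icc c)
  then have "set_integrable lborel {0<..<X} (\<lambda>u. w (exp (- r) * u) * h u)"
    by (rule set_integrable_subset) auto
  then show "set_integrable lborel {0<..} f" by (simp only: set_integrable_def f)
  have "(LBINT u:{0<..}. f u) = (LBINT u:{0<..<X}. w (exp (- r) * u) * h u)"
    by (simp only: set_lebesgue_integral_def f)
  also have "\<dots> = exp r * (LINT y|lborel. indicator {0<..<X} (0 + exp r * y) *\<^sub>R (w (exp (- r) * (0 + exp r * y)) * h (0 + exp r * y)))"
    unfolding set_lebesgue_integral_def by (subst lborel_integral_real_affine[where c = "exp r" and t = 0]) auto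
  also have "(LINT y|lborel. indicator {0<..<X} (0 + exp r * y) *\<^sub>R (w (exp (- r) * (0 + exp r * y)) * h (0 + exp r * y)))
     = (LBINT y:{0<..<x}. w y * h (exp r * y))"
    unfolding set_lebesgue_integral_def
    by (intro Bochner_Integration.integral_cong)
       (auto simp: indicator_def X_def zero_less_mult_iff exp_minus simp flip: mult.assoc)
  also have "\<dots> = integral {0..x} (\<lambda>y. w y * h (exp r * y))"
    by (intro LBINT_eq_integral continuous_intros continuous_on_subset[OF w] continuous_on_compose2[OF h]) auto
  finally show "(LBINT u:{0<..}. f u) = exp r * integral {0..x} (\<lambda>y. w y * h (exp r * y))" .
qed

lemma kern_split:
  fixes r x :: real
  assumes "x > 0"
  defines "j \<equiv> \<lambda>w u. if exp (- r) * u < x then w (exp (- r) * u) else (0::real)"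
  defines "A \<equiv> exp (- x) * (2 * (1 - exp (- r)) + (1 - exp (- r))\<^sup>2 * exp r * x)"
    and "B \<equiv> - (exp (- x) * ((1 - exp (- r))\<^sup>2 * exp r))"
  shows "kern r x u = A * j exp u + B * j (\<lambda>y. y * exp y) u - A + (1 - x) * exp (- x) * u"
proof -
  have "exp (- (x - exp (- r) * u)) = exp (- x) * exp (exp (- r) * u)"
    by (simp flip: exp_add)
  then show ?thesis using assms(1)
    by (simp add: kern_def expd_def j_def A_def B_def algebra_simps)
qed

lemma evol_explicit:
  fixes r x :: real
  assumes h: "continuous_on {0..} h" "h \<in> L1 1" and x: "x > 0"
  defines "A \<equiv> exp (- x) * (2 * (1 - exp (- r)) + (1 - exp (- r))\<^sup>2 * exp r * x)"
    and "B \<equiv> - (exp (- x) * ((1 - exp (- r))\<^sup>2 * exp r))"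
  shows "evol r h x = h (exp r * x)
    + A * (exp r * integral {0..x} (\<lambda>y. exp y * h (exp r * y)) - zeroth_moment h)
    + B * (exp r * integral {0..x} (\<lambda>y. y * exp y * h (exp r * y)))
    + (1 - x) * exp (- x) * first_moment h"
proof -
  let ?j = "\<lambda>w u. if exp (- r) * u < x then w (exp (- r) * u) else (0::real)"
  have i: "set_integrable lborel {0<..} (\<lambda>u. ?j exp u * h u)"
    "set_integrable lborel {0<..} (\<lambda>u. ?j (\<lambda>y. y * exp y) u * h u)"
    by (intro scaled_integral(1) h x continuous_intros)+
  have m: "set_integrable lborel {0<..} (\<lambda>u. 1 * h u)" "set_integrable lborel {0<..} (\<lambda>u. u * h u)"
    by (rule L1_integrable_mult(1)[OF h(2), where c = 1]; simp)+
  have "(LBINT u:{0<..}. kern r x u * h u)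
     = (LBINT u:{0<..}. (A * (?j exp u * h u) + B * (?j (\<lambda>y. y * exp y) u * h u))
        + ((- A) * (1 * h u) + (1 - x) * exp (- x) * (u * h u)))"
    unfolding kern_split[OF x] A_def[symmetric] B_def[symmetric]
    by (intro set_lebesgue_integral_cong) (auto simp: algebra_simps)
  also have "\<dots> = (A * (LBINT u:{0<..}. ?j exp u * h u) + B * (LBINT u:{0<..}. ?j (\<lambda>y. y * exp y) u * h u))
        + ((- A) * (LBINT u:{0<..}. 1 * h u) + (1 - x) * exp (- x) * (LBINT u:{0<..}. u * h u))"
    by (simp only: set_integral_add set_integrable_mult_right i m set_integral_mult_right)
  also have "(LBINT u:{0<..}. ?j exp u * h u) = exp r * integral {0..x} (\<lambda>y. exp y * h (exp r * y))"
    by (intro scaled_integral(2) h x continuous_intros)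
  also have "(LBINT u:{0<..}. ?j (\<lambda>y. y * exp y) u * h u) = exp r * integral {0..x} (\<lambda>y. y * exp y * h (exp r * y))"
    by (intro scaled_integral(2) h x continuous_intros)
  finally show ?thesis
    by (simp add: evol_def zeroth_moment_def first_moment_def algebra_simps)
qed

text \<open>
  The three premises are \<open>\<lambda> \<mu> = 1\<close> and two integrations by parts; after them the equality of
  \<open>\<partial>\<^sub>r evol r \<phi>\<close> and \<open>evol r (lin_op \<phi>)\<close> is a polynomial identity.
\<close>

lemma evol_algebra:
  fixes l m :: real
  assumes "l * m = 1" "Y + m0 = (1 - m) * v + m * p" "x * Y = (1 - m) * w + v + m * q"
  shows "d + (e * (2 * l + (2 * (1 - l) * l * m + (1 - l)^2 * m) * x)) * (m * p - m0)
      + (e * (2 * (1 - l) + (1 - l)^2 * m * x)) * (m * p + m * p1)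
      + (- (e * (2 * (1 - l) * l * m + (1 - l)^2 * m))) * (m * q)
      + (- (e * ((1 - l)^2 * m))) * (m * q + m * q1)
    = (d + 2 * (e * Y)) + (e * (2 * (1 - l) + (1 - l)^2 * m * x)) * (m * (p1 + 2 * v) - (- m0))
      + (- (e * ((1 - l)^2 * m))) * (m * (q1 + 2 * w))"
  using assms by algebra

context test_function
begin

lemma scaled_DERIV:
  assumes w: "continuous_on UNIV w" and x: "x > 0"
  shows "((\<lambda>r. integral {0..x} (\<lambda>y. w y * \<phi> (exp r * y))) has_field_derivative
     integral {0..x} (\<lambda>y. w y * (exp r * y * deriv \<phi> (exp r * y)))) (at r)"
proof -
  have "((\<lambda>r. integral (cbox 0 x) (\<lambda>y. w y * \<phi> (exp r * y))) has_field_derivative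
     integral (cbox 0 x) (\<lambda>y. w y * (exp r * y * deriv \<phi> (exp r * y)))) (at r within UNIV)"
  proof (rule leibniz_rule_field_derivative[where fx = "\<lambda>r y. w y * (exp r * y * deriv \<phi> (exp r * y))"])
    fix r y :: real
    show "((\<lambda>r. w y * \<phi> (exp r * y)) has_real_derivative w y * (exp r * y * deriv \<phi> (exp r * y))) (at r within UNIV)"
      by (rule derivative_eq_intros DERIV_chain2[OF smooth_DERIV[OF smooth]] refl | simp)+
  next
    show "(\<lambda>y. w y * \<phi> (exp r * y)) integrable_on cbox 0 x" for r
      by (intro integrable_continuous continuous_intros continuous_on_subset[OF w]
          continuous_on_compose2[OF cont(1)[of UNIV]]) auto
    have "continuous_on (UNIV \<times> cbox 0 x) (\<lambda>z. w (snd z) * (exp (fst z) * snd z * deriv \<phi> (exp (fst z) * snd z)))"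
      by (intro continuous_intros continuous_on_compose2[OF w] continuous_on_compose2[OF cont(2)[of UNIV]]) auto
    then show "continuous_on (UNIV \<times> cbox 0 x) (\<lambda>(r, y). w y * (exp r * y * deriv \<phi> (exp r * y)))"
      by (simp add: case_prod_unfold)
  qed auto
  then show ?thesis by simp
qed

text \<open>
  Both sides contain the same integrals \<open>p1\<close>, \<open>q1\<close> of \<open>\<phi>'\<close>. On the right the nonlocal part of the
  operator adds the double integrals \<open>v\<close> and \<open>w\<close>; integrating \<open>V'\<close> and \<open>(y V)'\<close> over \<open>[0,x]\<close> expresses
  their multiples by \<open>1 - e\<^bsup>r\<^esup>\<close> through single integrals, and they occur with such factors only.
\<close>

lemma evol_DERIV:
  assumes x: "x > 0"
  shows "((\<lambda>r. evol r \<phi> x) has_field_derivative evol r (lin_op \<phi>) x) (at r)"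
proof -
  define l m where "l = exp (- r)" and "m = exp r"
  define m0 where "m0 = zeroth_moment \<phi>"
  define p q where "p = integral {0..x} (\<lambda>y. exp y * \<phi> (m * y))"
    and "q = integral {0..x} (\<lambda>y. y * exp y * \<phi> (m * y))"
  define p1 q1 where "p1 = integral {0..x} (\<lambda>y. exp y * (m * y * deriv \<phi> (m * y)))"
    and "q1 = integral {0..x} (\<lambda>y. y * exp y * (m * y * deriv \<phi> (m * y)))"
  define V where "V = (\<lambda>y. exp (y - m * y) * (expint \<phi> (m * y) - m0))"
  define v w where "v = integral {0..x} V" and "w = integral {0..x} (\<lambda>y. y * V y)"
  have lm: "l * m = 1" by (simp add: l_def m_def exp_minus)
  have m: "m > 0" by (simp add: m_def)
  note [continuous_intros] = continuous_on_compose2[OF cont(1)[of UNIV]]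
    continuous_on_compose2[OF cont(2)[of UNIV]] continuous_on_compose2[OF expint_cont[of UNIV]]
  have Vc: "continuous_on S V" for S
    unfolding V_def by (intro continuous_intros) auto
  note int = integrable_continuous_real
  let ?b = "(- (exp (- x) * ((1 - l)^2 * m)))"
  let ?dB = "(- (exp (- x) * (2 * (1 - l) * l * m + (1 - l)^2 * m)))"
  let ?a = "(exp (- x) * (2 * (1 - l) + (1 - l)^2 * m * x))"
  let ?dA = "(exp (- x) * (2 * l + (2 * (1 - l) * l * m + (1 - l)^2 * m) * x))"
  have VD: "(V has_field_derivative (1 - m) * V y + m * (exp y * \<phi> (m * y))) (at y)" for y
  proof -
    have "(V has_field_derivative (1 - m) * V y + exp (y - m * y) * (exp (m * y) * \<phi> (m * y) * m)) (at y)"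
      unfolding V_def
      by (rule derivative_eq_intros DERIV_chain2[OF expint_DERIV] refl | simp)+
    moreover have "exp (y - m * y) * (exp (m * y) * \<phi> (m * y) * m) = m * (exp y * \<phi> (m * y))"
      by (simp add: exp_diff)
    ultimately show ?thesis by simp
  qed
  have V0: "V 0 = - m0" by (simp add: V_def expint_def)
  have "((\<lambda>y. (1 - m) * V y + m * (exp y * \<phi> (m * y))) has_integral V x - V 0) {0..x}"
    using x VD by (intro fundamental_theorem_of_calculus)
      (auto simp: has_real_derivative_iff_has_vector_derivative[symmetric] intro: DERIV_subset)
  then have 1: "V x + m0 = (1 - m) * v + m * p"
    unfolding v_def p_def V0
    by (subst integral_mult_right[symmetric], subst integral_mult_right[symmetric], subst integral_add[symmetric])
       (auto intro!: int continuous_intros Vc simp: integral_unique)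
  have "((\<lambda>y. y * V y) has_field_derivative ((1 - m) * (y * V y) + V y) + m * (y * exp y * \<phi> (m * y))) (at y)" for y
    by (rule derivative_eq_intros VD refl | simp)+ (simp add: algebra_simps)
  then have "((\<lambda>y. ((1 - m) * (y * V y) + V y) + m * (y * exp y * \<phi> (m * y))) has_integral x * V x - 0 * V 0) {0..x}"
    using x by (intro fundamental_theorem_of_calculus)
      (auto simp: has_real_derivative_iff_has_vector_derivative[symmetric] intro: DERIV_subset)
  then have 2: "x * V x = (1 - m) * w + v + m * q"
    unfolding v_def q_def w_def
    by (subst integral_mult_right[symmetric], subst integral_mult_right[symmetric],
        subst integral_add[symmetric], (intro int continuous_intros Vc; simp), (intro int continuous_intros Vc; simp),
        subst integral_add[symmetric], (intro int continuous_intros Vc; simp), (intro int continuous_intros Vc; simp))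
       (simp add: integral_unique)
  have g: "lin_op \<phi> (m * y) = m * y * deriv \<phi> (m * y) + 2 * (exp (- (m * y)) * (expint \<phi> (m * y) - m0))" if "y \<ge> 0" for y
    using that m by (simp add: lin_op_eq m0_def)
  have ev: "exp y * (2 * (exp (- (m * y)) * (expint \<phi> (m * y) - m0))) = 2 * V y" for y
    by (simp add: V_def exp_diff exp_minus field_simps)
  have pg: "integral {0..x} (\<lambda>y. exp y * lin_op \<phi> (m * y)) = p1 + 2 * v"
  proof -
    have "integral {0..x} (\<lambda>y. exp y * lin_op \<phi> (m * y))
        = integral {0..x} (\<lambda>y. exp y * (m * y * deriv \<phi> (m * y)) + 2 * V y)"
      by (intro integral_cong) (auto simp: g distrib_left ev)
    also have "\<dots> = p1 + 2 * v"
      unfolding p1_def v_def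
      by (subst integral_add) (auto intro!: int continuous_intros Vc)
    finally show ?thesis .
  qed
  have qg: "integral {0..x} (\<lambda>y. y * exp y * lin_op \<phi> (m * y)) = q1 + 2 * w"
  proof -
    have "integral {0..x} (\<lambda>y. y * exp y * lin_op \<phi> (m * y))
        = integral {0..x} (\<lambda>y. y * exp y * (m * y * deriv \<phi> (m * y)) + 2 * (y * V y))"
      by (intro integral_cong) (auto simp: g distrib_left ev mult.assoc)
    also have "\<dots> = q1 + 2 * w"
      unfolding q1_def w_def
      by (subst integral_add) (auto intro!: int continuous_intros Vc)
    finally show ?thesis .
  qed
  have Vx: "exp (- (m * x)) * (expint \<phi> (m * x) - m0) = exp (- x) * V x"
    by (simp add: V_def exp_diff exp_minus field_simps)
  let ?A = "\<lambda>r. exp (- x) * (2 * (1 - exp (- r)) + (1 - exp (- r))\<^sup>2 * exp r * x)"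
  let ?B = "\<lambda>r. - (exp (- x) * ((1 - exp (- r))\<^sup>2 * exp r))"
  let ?p = "\<lambda>r. integral {0..x} (\<lambda>y. exp y * \<phi> (exp r * y))"
  let ?q = "\<lambda>r. integral {0..x} (\<lambda>y. y * exp y * \<phi> (exp r * y))"
  have "((\<lambda>r. \<phi> (exp r * x) + ?A r * (exp r * ?p r - m0) + ?B r * (exp r * ?q r)
      + (1 - x) * exp (- x) * first_moment \<phi>) has_field_derivative
      m * x * deriv \<phi> (m * x) + ?dA * (m * p - m0)
      + ?a * (m * p + m * p1)
      + ?dB * (m * q)
      + ?b * (m * q + m * q1)) (at r)"
  proof -
    have dp: "(?p has_field_derivative p1) (at r)" and dq: "(?q has_field_derivative q1) (at r)"
      unfolding p1_def q1_def m_def by (intro scaled_DERIV continuous_intros x)+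
    have dA: "(?A has_field_derivative ?dA) (at r)"
      unfolding l_def m_def by (auto intro!: derivative_eq_intros simp: algebra_simps power2_eq_square)
    have dB: "(?B has_field_derivative ?dB) (at r)"
      unfolding l_def m_def by (auto intro!: derivative_eq_intros simp: algebra_simps power2_eq_square)
    have dphi: "((\<lambda>r. \<phi> (exp r * x)) has_field_derivative m * x * deriv \<phi> (m * x)) (at r)"
    proof -
      have "((\<lambda>r. exp r * x) has_field_derivative m * x) (at r)"
        unfolding m_def by (auto intro!: derivative_eq_intros)
      from DERIV_chain2[OF smooth_DERIV[OF smooth] this] show ?thesis by (simp add: m_def mult_ac)
    qed
    show ?thesis
      by (rule derivative_eq_intros dphi dA dB dp dq refl)+
         (simp add: p_def q_def l_def m_def algebra_simps)
  qed
  also have "m * x * deriv \<phi> (m * x) + ?dA * (m * p - m0)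
      + ?a * (m * p + m * p1)
      + ?dB * (m * q)
      + ?b * (m * q + m * q1)
    = (m * x * deriv \<phi> (m * x) + 2 * (exp (- x) * V x))
      + ?a * (m * (p1 + 2 * v) - (- m0))
      + ?b * (m * (q1 + 2 * w))"
    by (rule evol_algebra[OF lm 1 2])
  also have "\<dots> = evol r (lin_op \<phi>) x"
    using evol_explicit[OF lin_op_cont lin_op_L1 x, of r] g[of x] x
    by (simp add: m_def[symmetric] l_def[symmetric] pg qg Vx[unfolded m0_def] zeroth_moment_lin_op first_moment_lin_op m0_def)
  also have "(\<lambda>r. \<phi> (exp r * x) + ?A r * (exp r * ?p r - m0) + ?B r * (exp r * ?q r)
      + (1 - x) * exp (- x) * first_moment \<phi>) = (\<lambda>r. evol r \<phi> x)"
    by (simp add: evol_explicit[OF cont(1) test_function_L1[OF test] x] m0_def)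
  finally show ?thesis .
qed

end

section \<open>Exponential decay of the propagator\<close>

lemma expd_measurable [measurable]: "expd \<in> borel_measurable borel"
  unfolding expd_def[abs_def] by measurable

lemma expd_nonneg: "0 \<le> expd s" and expd_le_1: "expd s \<le> 1"
  by (auto simp: expd_def)

lemma abs_mult_expd_le: "\<bar>s * expd s\<bar> \<le> 1"
proof (cases "s > 0")
  case True
  have "s \<le> exp s" using exp_ge_add_one_self[of s] by linarith
  then show ?thesis using True by (simp add: expd_def exp_minus field_simps)
qed (simp add: expd_def)

lemma kern_measurable [measurable]:
  assumes [measurable]: "f \<in> borel_measurable M" "g \<in> borel_measurable M" "h \<in> borel_measurable M"
  shows "(\<lambda>z. kern (f z) (g z) (h z)) \<in> borel_measurable M"
  unfolding kern_def by measurable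

lemma kern_linear_growth:
  "\<exists>c\<ge>0. \<forall>u>0. \<bar>kern r x u\<bar> \<le> c * (1 + u)"
proof -
  define A B D where "A = 2 * (1 - exp (- r))" and "B = (1 - exp (- r))\<^sup>2 * exp r" and "D = (1 - x) * exp (- x)"
  have "\<bar>kern r x u\<bar> \<le> (2 * \<bar>A\<bar> + 2 * \<bar>B\<bar> + \<bar>D\<bar>) * (1 + u)" if u: "u > 0" for u
  proof -
    have 1: "\<bar>expd (x - exp (- r) * u) - expd x\<bar> \<le> 2"
      using expd_nonneg expd_le_1 by (smt (verit))
    have 2: "\<bar>(x - exp (- r) * u) * expd (x - exp (- r) * u) - x * expd x\<bar> \<le> 2"
      using abs_mult_expd_le[of "x - exp (- r) * u"] abs_mult_expd_le[of x] by linarith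
    have 3: "\<bar>A * (expd (x - exp (- r) * u) - expd x)\<bar> \<le> \<bar>A\<bar> * 2"
      unfolding abs_mult by (intro mult_left_mono 1) auto
    have 4: "\<bar>B * ((x - exp (- r) * u) * expd (x - exp (- r) * u) - x * expd x)\<bar> \<le> \<bar>B\<bar> * 2"
      unfolding abs_mult[of B] by (intro mult_left_mono 2) auto
    have 5: "\<bar>u * D\<bar> = u * \<bar>D\<bar>" using u by (simp add: abs_mult)
    have "\<bar>kern r x u\<bar> \<le> \<bar>A\<bar> * 2 + \<bar>B\<bar> * 2 + u * \<bar>D\<bar>"
      unfolding kern_def A_def[symmetric] B_def[symmetric] D_def[symmetric]
      using 3 4 5 by linarith
    also have "\<dots> \<le> (2 * \<bar>A\<bar> + 2 * \<bar>B\<bar> + \<bar>D\<bar>) * (1 + u)"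
      using u by (simp add: algebra_simps)
    finally show ?thesis .
  qed
  then show ?thesis by (intro exI[of _ "2 * \<bar>A\<bar> + 2 * \<bar>B\<bar> + \<bar>D\<bar>"]) auto
qed

lemma kern_integrable:
  assumes "h \<in> L1 k" "k \<ge> 1"
  shows "set_integrable lborel {0<..} (\<lambda>u. kern r x u * h u)"
proof -
  obtain c where c: "c \<ge> 0" "\<And>u. u > 0 \<Longrightarrow> \<bar>kern r x u\<bar> \<le> c * (1 + u)"
    using kern_linear_growth by blast
  show ?thesis
  proof (rule L1_integrable_mult(1)[OF assms(1)])
    fix u :: real assume u: "u > 0"
    have "1 + u \<le> (1 + u) powr k"
      using powr_mono[of 1 k "1 + u"] assms(2) u by simp
    then show "\<bar>kern r x u\<bar> \<le> c * (1 + u) powr k"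
      using c(2)[OF u] mult_left_mono[OF _ c(1)] order_trans by blast
  qed measurable
qed

lemma evol_lin:
  assumes "h \<in> L1 k" "g \<in> L1 k" "k \<ge> 1"
  shows "evol r (\<lambda>x. a * h x + b * g x) x = a * evol r h x + b * evol r g x"
proof -
  have "(LBINT u:{0<..}. kern r x u * (a * h u + b * g u))
     = (LBINT u:{0<..}. a * (kern r x u * h u) + b * (kern r x u * g u))"
    by (simp add: algebra_simps)
  also have "\<dots> = a * (LBINT u:{0<..}. kern r x u * h u) + b * (LBINT u:{0<..}. kern r x u * g u)"
    by (subst set_integral_add) (auto intro!: set_integrable_mult_right kern_integrable assms)
  finally show ?thesis by (simp add: evol_def algebra_simps)
qed

lemma evol_ext0:
  assumes "x > 0"
  shows "evol r h x = ext0 h (exp r * x) + (LINT u|lborel. kern r x u * ext0 h u)"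
  using assms unfolding evol_def set_lebesgue_integral_def
  by (auto simp: ext0_def zero_less_mult_iff mult_ac intro!: Bochner_Integration.integral_cong)

lemma evol_measurable_pair:
  assumes [measurable]: "ext0 h \<in> borel_measurable borel"
  shows "(\<lambda>z. ext0 (evol (r + fst z) h) (snd z)) \<in> borel_measurable (borel \<Otimes>\<^sub>M borel)"
proof -
  have eq: "(\<lambda>z. ext0 (evol (r + fst z) h) (snd z)) = (\<lambda>z. indicator {0<..} (snd z) *
     (ext0 h (exp (r + fst z) * snd z) + (LINT u|lborel. kern (r + fst z) (snd z) u * ext0 h u)))"
    by (auto simp: fun_eq_iff indicator_def evol_ext0 ext0_def[of "evol _ _"])
  have [measurable]: "(\<lambda>z. LINT u|lborel. kern (r + fst z) (snd z) u * ext0 h u) \<in> borel_measurable (borel \<Otimes>\<^sub>M borel)"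
    by (rule lborel.borel_measurable_lebesgue_integral) measurable
  show ?thesis unfolding eq by measurable
qed

lemma evol_measurable:
  assumes "ext0 h \<in> borel_measurable borel"
  shows "ext0 (evol r h) \<in> borel_measurable borel"
proof -
  have "(\<lambda>x. (0, x)) \<in> borel \<rightarrow>\<^sub>M (borel \<Otimes>\<^sub>M borel :: (real \<times> real) measure)" by measurable
  from measurable_compose[OF this evol_measurable_pair[OF assms, of r]]
  show ?thesis by simp
qed

lemma evol_0: "evol 0 h x = h x + (1 - x) * exp (- x) * first_moment h"
proof -
  have "(LBINT u:{0<..}. kern 0 x u * h u) = (LBINT u:{0<..}. ((1 - x) * exp (- x)) * (u * h u))"
    by (simp add: kern_def algebra_simps)
  also have "\<dots> = (1 - x) * exp (- x) * first_moment h"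
    unfolding first_moment_def by (rule set_integral_mult_right)
  finally show ?thesis by (simp add: evol_def)
qed

text \<open>
  For \<open>l u \<le> 1\<close> the power is the small factor, for \<open>l u > 1\<close> the weight itself scales like
  \<open>l\<^sup>k u\<^sup>k \<le> l\<^sup>j u\<^sup>k\<close>. This is where the order of the weight limits the order of the
  Taylor expansion.
\<close>

lemma min_power_weight:
  fixes u l :: real
  assumes "u > 0" "0 < l" "l \<le> 1" "real j \<le> k"
  shows "min 1 ((l * u) ^ j) * (1 + l * u) powr k \<le> 2 powr k * l ^ j * (1 + u) powr k"
proof (cases "l * u \<le> 1")
  case True
  have "u ^ j \<le> (1 + u) powr k"
  proof -
    have "u ^ j \<le> (1 + u) ^ j" using assms by (intro power_mono) auto
    also have "\<dots> = (1 + u) powr (real j)" using assms by (simp add: powr_realpow)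
    also have "\<dots> \<le> (1 + u) powr k" using assms by (intro powr_mono) auto
    finally show ?thesis .
  qed
  then have "(l * u) ^ j \<le> l ^ j * (1 + u) powr k"
    using assms by (simp add: power_mult_distrib)
  moreover have "(1 + l * u) powr k \<le> 2 powr k" using True assms by (intro powr_mono2) auto
  ultimately have "min 1 ((l * u) ^ j) * (1 + l * u) powr k \<le> (l ^ j * (1 + u) powr k) * 2 powr k"
    using assms by (intro mult_mono) auto
  then show ?thesis by (simp add: mult_ac)
next
  case False
  have "(1 + l * u) powr k \<le> (2 * (l * u)) powr k" using False assms by (intro powr_mono2) auto
  also have "\<dots> = 2 powr k * (l powr k * u powr k)" using assms by (simp add: powr_mult)
  also have "\<dots> \<le> 2 powr k * (l powr (real j) * (1 + u) powr k)"
    using assms by (intro mult_left_mono mult_mono powr_mono' powr_mono2) auto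
  also have "l powr (real j) = l ^ j" using assms by (simp add: powr_realpow)
  finally have *: "(1 + l * u) powr k \<le> 2 powr k * (l ^ j * (1 + u) powr k)" .
  have "min 1 ((l * u) ^ j) * (1 + l * u) powr k \<le> 1 * (1 + l * u) powr k"
    by (intro mult_right_mono) auto
  with * show ?thesis by (simp add: mult_ac)
qed

text \<open>
  The first difference of \<open>e\<^bsup>-x\<^esup>\<close> and the second-order Taylor remainder of \<open>x e\<^bsup>-x\<^esup>\<close>. Behind the jump of
  \<open>E\<close> and the kink of \<open>f\<close> at \<open>x = y\<close> they are of order \<open>y\<close> and \<open>y\<^sup>2\<close>; before it they are larger by a
  factor \<open>1/y\<close>, which is made up for by the length \<open>y\<close> of that interval.
\<close>

lemma kern_diff_bounds:
  fixes x y :: real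
  assumes x: "x > 0" and y: "y > 0"
  defines "a \<equiv> expd (x - y) - expd x"
    and "b \<equiv> (x - y) * expd (x - y) - x * expd x + y * ((1 - x) * exp (- x))"
  shows "x \<le> y \<Longrightarrow> \<bar>a\<bar> \<le> exp (- x)" "x \<le> y \<Longrightarrow> \<bar>b\<bar> \<le> y * ((1 + x) * exp (- x))"
    and "x > y \<Longrightarrow> \<bar>a\<bar> \<le> min 1 y * exp (- (x - y))"
    and "x > y \<Longrightarrow> \<bar>b\<bar> \<le> min 1 (y\<^sup>2) * ((1 + (x - y)) * exp (- (x - y)))"
proof -
  assume le: "x \<le> y"
  show "\<bar>a\<bar> \<le> exp (- x)" using le x by (simp add: a_def expd_def)
  have "b = (y - x - y * x) * exp (- x)" using le x by (simp add: b_def expd_def algebra_simps)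
  then have "\<bar>b\<bar> = \<bar>y - x - y * x\<bar> * exp (- x)" by (simp add: abs_mult)
  also have "\<dots> \<le> (y * (1 + x)) * exp (- x)"
    using x y le mult_pos_pos[OF y x] by (intro mult_right_mono) (auto simp: abs_le_iff algebra_simps)
  finally show "\<bar>b\<bar> \<le> y * ((1 + x) * exp (- x))" by (simp add: mult_ac)
next
  assume lt: "x > y"
  define s where "s = x - y"
  have s: "s > 0" "x = s + y" using lt by (auto simp: s_def)
  have ex: "exp (- x) = exp (- s) * exp (- y)" using s by (simp add: mult_exp_exp)
  have ey: "exp (- y) \<ge> 1 - y" "exp (- y) \<le> 1" using exp_ge_add_one_self[of "- y"] y by auto
  have "a = (1 - exp (- y)) * exp (- s)" using s x ex by (simp add: a_def expd_def algebra_simps)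
  then have "\<bar>a\<bar> = (1 - exp (- y)) * exp (- s)" using ey by (simp add: abs_mult)
  also have "\<dots> \<le> min 1 y * exp (- s)" using ey y by (intro mult_right_mono) auto
  finally show "\<bar>a\<bar> \<le> min 1 y * exp (- (x - y))" by (simp add: s_def)
  have y2: "y\<^sup>2 * exp (- y) \<le> min 1 (y\<^sup>2)"
  proof -
    have "y\<^sup>2 \<le> exp y"
    proof -
      have "1 + y / 2 + (y / 2)\<^sup>2 / 2 \<le> exp (y / 2)" using exp_lower_Taylor_quadratic[of "y / 2"] y by simp
      moreover have "y \<le> 1 + y / 2 + (y / 2)\<^sup>2 / 2"
        using zero_le_power2[of "y - 2"] by (simp add: power2_eq_square algebra_simps)
      ultimately have "y \<le> exp (y / 2)" by linarith
      then have "y\<^sup>2 \<le> (exp (y / 2))\<^sup>2" using y by (intro power_mono) auto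
      also have "\<dots> = exp y" by (simp flip: exp_double)
      finally show ?thesis .
    qed
    then have "y\<^sup>2 * exp (- y) \<le> 1" by (simp add: exp_minus field_simps)
    moreover have "y\<^sup>2 * exp (- y) \<le> y\<^sup>2 * 1" using ey by (intro mult_left_mono) auto
    ultimately show ?thesis by simp
  qed
  have y3: "\<bar>1 - (1 + y) * exp (- y)\<bar> \<le> min 1 (y\<^sup>2)"
  proof -
    have "(1 + y) * exp (- y) \<le> 1" using exp_ge_add_one_self[of y] by (simp add: exp_minus field_simps)
    moreover have "(1 + y) * (1 - y) \<le> (1 + y) * exp (- y)" using ey y by (intro mult_left_mono) auto
    then have "1 - (1 + y) * exp (- y) \<le> y\<^sup>2" by (simp add: algebra_simps power2_eq_square)
    moreover have "0 \<le> (1 + y) * exp (- y)" using y by simp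
    ultimately show ?thesis by simp
  qed
  have "b = (s * (1 - (1 + y) * exp (- y)) - y\<^sup>2 * exp (- y)) * exp (- s)"
    using s x ex by (simp add: b_def expd_def algebra_simps power2_eq_square)
  then have "\<bar>b\<bar> = \<bar>s * (1 - (1 + y) * exp (- y)) - y\<^sup>2 * exp (- y)\<bar> * exp (- s)" by (simp add: abs_mult)
  also have "\<dots> \<le> (s * min 1 (y\<^sup>2) + min 1 (y\<^sup>2)) * exp (- s)"
  proof (intro mult_right_mono order_trans[OF abs_triangle_ineq4] add_mono)
    show "\<bar>s * (1 - (1 + y) * exp (- y))\<bar> \<le> s * min 1 (y\<^sup>2)"
      using s y3 by (simp add: abs_mult)
    show "\<bar>y\<^sup>2 * exp (- y)\<bar> \<le> min 1 (y\<^sup>2)" using y2 by simp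
  qed auto
  finally show "\<bar>b\<bar> \<le> min 1 (y\<^sup>2) * ((1 + (x - y)) * exp (- (x - y)))"
    by (simp add: s_def algebra_simps)
qed

lemma weight_submult:
  assumes "s > 0" "y > 0" "k \<ge> 0"
  shows "(1 + (s + y)) powr k \<le> (1 + y) powr k * (1 + s) powr (k::real)"
proof -
  have "(1 + (s + y)) powr k \<le> ((1 + y) * (1 + s)) powr k"
    using assms by (intro powr_mono2) (auto simp: algebra_simps)
  then show ?thesis using assms by (simp add: powr_mult)
qed

text \<open>
  Adds the linear Taylor term \<open>y d\<close> to the second kernel and takes it away from the stationary
  part, whose coefficient is then \<open>2l - l\<^sup>2\<close>, small with \<open>l\<close>.
\<close>

lemma kern_regroup:
  fixes m y u l a b d :: real
  assumes "m * y = u"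
  shows "2 * (1 - l) * a + (1 - l)\<^sup>2 * m * b + u * d
    = 2 * (1 - l) * a + (1 - l)\<^sup>2 * m * (b + y * d) + (2 * l - l\<^sup>2) * u * d"
  unfolding assms[symmetric] by (simp add: power2_eq_square algebra_simps)

lemma kern_weighted_bound:
  fixes x u r k :: real
  assumes x: "x > 0" and u: "u > 0" and r: "r \<ge> 0" and k: "k \<ge> 2"
  defines "l \<equiv> exp (- r)" and "K \<equiv> growth_const (k + 1)"
  defines "\<psi> \<equiv> \<lambda>s. (1 + s) powr (k + 1) * exp (- s)"
  shows "\<bar>kern r x u\<bar> * (1 + x) powr k \<le>
     indicator {0..l * u} x * (2 * K + u * K)
     + indicator {0<..} (x - l * u) * ((2 * min 1 (l * u) + exp r * min 1 ((l * u)\<^sup>2)) * (1 + l * u) powr k * \<psi> (x - l * u))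
     + 2 * l * u * \<psi> x"
proof -
  define y where "y = l * u"
  have l: "0 < l" "l \<le> 1" using r by (auto simp: l_def)
  have le: "exp r * l = 1" by (simp add: l_def exp_minus)
  have y: "y > 0" using u l by (simp add: y_def)
  define a where "a = expd (x - y) - expd x"
  define b where "b = (x - y) * expd (x - y) - x * expd x + y * ((1 - x) * exp (- x))"
  note ab = kern_diff_bounds[OF x y, folded a_def b_def]
  have w1: "(1 + x) * (1 + x) powr k = (1 + x) powr (k + 1)" using x by (simp add: powr_add)
  have "kern r x u = 2 * (1 - l) * a + (1 - l)\<^sup>2 * exp r * b + (2 * l - l\<^sup>2) * u * ((1 - x) * exp (- x))"
  proof -
    have "exp r * y = u" using le by (simp add: y_def flip: mult.assoc)
    then show ?thesis
      unfolding kern_def a_def b_def l_def[symmetric] y_def[symmetric] by (rule kern_regroup)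
  qed
  also have "\<bar>\<dots>\<bar> \<le> 2 * \<bar>a\<bar> + exp r * \<bar>b\<bar> + 2 * l * u * ((1 + x) * exp (- x))"
  proof (intro order_trans[OF abs_triangle_ineq] add_mono)
    show "\<bar>2 * (1 - l) * a\<bar> \<le> 2 * \<bar>a\<bar>" using l mult_right_mono[of "2 * (1 - l)" 2 "\<bar>a\<bar>"] by (simp add: abs_mult)
    have "(1 - l)\<^sup>2 \<le> 1" using l by (simp add: power_le_one)
    then show "\<bar>(1 - l)\<^sup>2 * exp r * b\<bar> \<le> exp r * \<bar>b\<bar>"
      by (simp add: abs_mult mult.assoc mult_left_le_one_le)
    have "2 * l - l\<^sup>2 = l * (2 - l)" by (simp add: power2_eq_square algebra_simps)
    then have "0 \<le> 2 * l - l\<^sup>2" "2 * l - l\<^sup>2 \<le> 2 * l" using l by simp_all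
    then have "\<bar>(2 * l - l\<^sup>2) * u * ((1 - x) * exp (- x))\<bar> = (2 * l - l\<^sup>2) * u * (\<bar>1 - x\<bar> * exp (- x))"
      using u by (simp add: abs_mult)
    also have "\<dots> \<le> (2 * l) * u * ((1 + x) * exp (- x))"
      using u x l \<open>2 * l - l\<^sup>2 \<le> 2 * l\<close> \<open>0 \<le> 2 * l - l\<^sup>2\<close> by (intro mult_mono mult_nonneg_nonneg) auto
    finally show "\<bar>(2 * l - l\<^sup>2) * u * ((1 - x) * exp (- x))\<bar> \<le> 2 * l * u * ((1 + x) * exp (- x))" .
  qed
  finally have "\<bar>kern r x u\<bar> * (1 + x) powr k \<le> (2 * \<bar>a\<bar> + exp r * \<bar>b\<bar> + 2 * l * u * ((1 + x) * exp (- x))) * (1 + x) powr k"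
    by (rule mult_right_mono) simp
  also have "\<dots> = (2 * \<bar>a\<bar> + exp r * \<bar>b\<bar>) * (1 + x) powr k + 2 * l * u * \<psi> x"
    by (simp only: \<psi>_def w1[symmetric]) (simp only: algebra_simps)
  finally have main: "\<bar>kern r x u\<bar> * (1 + x) powr k \<le> (2 * \<bar>a\<bar> + exp r * \<bar>b\<bar>) * (1 + x) powr k + 2 * l * u * \<psi> x" .
  show ?thesis
  proof (cases "x \<le> y")
    case True
    have e1: "exp (- x) * (1 + x) powr k \<le> K"
    proof -
      have "exp (- x) * (1 + x) powr k \<le> exp (- x) * (1 + x) powr (k + 1)"
        using x by (intro mult_left_mono powr_mono) auto
      also have "\<dots> \<le> K" using weight_exp_bound[of x "k + 1"] x by (simp only: K_def mult.commute[of "exp (- x)"])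
      finally show ?thesis .
    qed
    have e2: "(1 + x) * exp (- x) * (1 + x) powr k \<le> K"
    proof -
      have "(1 + x) * exp (- x) * (1 + x) powr k = (1 + x) powr (k + 1) * exp (- x)"
        unfolding w1[symmetric] by (simp only: mult_ac)
      then show ?thesis using weight_exp_bound[of x "k + 1"] x by (simp only: K_def)
    qed
    have "(2 * \<bar>a\<bar> + exp r * \<bar>b\<bar>) * (1 + x) powr k
        \<le> (2 * exp (- x) + exp r * (y * ((1 + x) * exp (- x)))) * (1 + x) powr k"
      using ab(1,2)[OF True] by (intro mult_right_mono add_mono mult_left_mono) auto
    also have "exp r * (y * ((1 + x) * exp (- x))) = u * ((1 + x) * exp (- x))"
      using le by (simp add: y_def flip: mult.assoc)
    also have "(2 * exp (- x) + u * ((1 + x) * exp (- x))) * (1 + x) powr k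
        = 2 * (exp (- x) * (1 + x) powr k) + u * ((1 + x) * exp (- x) * (1 + x) powr k)"
      by (simp add: algebra_simps)
    also have "\<dots> \<le> 2 * K + u * K" using e1 e2 u by (intro add_mono mult_left_mono) auto
    finally show ?thesis using main True x by (simp add: y_def[symmetric])
  next
    case False
    define s where "s = x - y"
    have s: "s > 0" "x = s + y" using False by (auto simp: s_def)
    have "(2 * \<bar>a\<bar> + exp r * \<bar>b\<bar>) * (1 + x) powr k
       \<le> (2 * (min 1 y * ((1 + s) * exp (- s))) + exp r * (min 1 (y\<^sup>2) * ((1 + s) * exp (- s)))) * ((1 + y) powr k * (1 + s) powr k)"
    proof (intro mult_mono add_mono mult_left_mono)
      have "\<bar>a\<bar> \<le> min 1 y * exp (- s)" using ab(3) False by (simp add: s_def)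
      also have "\<dots> \<le> min 1 y * ((1 + s) * exp (- s))" using s y by (intro mult_left_mono) auto
      finally show "\<bar>a\<bar> \<le> min 1 y * ((1 + s) * exp (- s))" .
      show "\<bar>b\<bar> \<le> min 1 (y\<^sup>2) * ((1 + s) * exp (- s))" using ab(4) False by (simp add: s_def)
      show "(1 + x) powr k \<le> (1 + y) powr k * (1 + s) powr k"
        using weight_submult[OF s(1) y, of k] k s(2) by simp
    qed (use s y in auto)
    also have "\<dots> = (2 * min 1 y + exp r * min 1 (y\<^sup>2)) * (1 + y) powr k * \<psi> s"
      using s(1) by (simp add: \<psi>_def powr_add algebra_simps)
    finally show ?thesis using main False s by (simp add: y_def[symmetric] s_def[symmetric])
  qed
qed

lemma ennreal_sum3:
  assumes "a \<ge> 0" "i \<ge> 0" "c \<ge> 0" "p \<ge> 0" "d \<ge> 0" "q \<ge> 0"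
  shows "ennreal (a * i + c * p + d * q) = ennreal a * ennreal i + ennreal c * ennreal p + ennreal d * ennreal q"
  using assms by (simp add: ennreal_mult)

text \<open>
  The gain \<open>l = e\<^bsup>-r\<^esup>\<close> appears here: the first differences are of order \<open>l\<close>, the Taylor remainders
  of order \<open>l\<^sup>2\<close> with a coefficient \<open>e\<^bsup>r\<^esup>\<close>.
\<close>

lemma kern_column_bound:
  assumes k: "k \<ge> 2"
  shows "\<exists>C\<ge>0. \<forall>r\<ge>0. \<forall>u>0. (\<integral>\<^sup>+x. ennreal (indicator {0<..} x * (\<bar>kern r x u\<bar> * (1 + x) powr k)) \<partial>lborel)
     \<le> ennreal (C * exp (- r) * (1 + u) powr k)"
proof -
  define I where "I = L1_norm (k + 1) (\<lambda>x. exp (- x))"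
  define K where "K = growth_const (k + 1)"
  have I: "I \<ge> 0" and K: "K \<ge> 0" by (auto simp: I_def K_def growth_const_def L1_norm_nonneg)
  define \<psi> where "\<psi> s = (1 + s) powr (k + 1) * exp (- s)" for s :: real
  have [measurable]: "\<psi> \<in> borel_measurable borel" unfolding \<psi>_def[abs_def] by measurable
  have int_psi: "(\<integral>\<^sup>+s. ennreal (indicator {0<..} s * \<psi> s) \<partial>lborel) = ennreal I"
    using wnorm_eq[OF exp_neg_L1, of "k + 1"] by (simp add: wnorm_def I_def \<psi>_def mult_ac)
  have "(\<integral>\<^sup>+x. ennreal (indicator {0<..} x * (\<bar>kern r x u\<bar> * (1 + x) powr k)) \<partial>lborel)
     \<le> ennreal ((3 * K + 3 * 2 powr k * I + 2 * I) * exp (- r) * (1 + u) powr k)" if r: "r \<ge> 0" and u: "u > 0" for r u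
  proof -
    define l where "l = exp (- r)"
    have l: "0 < l" "l \<le> 1" using r by (auto simp: l_def)
    define c where "c = (2 * min 1 (l * u) + exp r * min 1 ((l * u)\<^sup>2)) * (1 + l * u) powr k"
    have c: "c \<ge> 0" unfolding c_def using l u by (intro mult_nonneg_nonneg add_nonneg_nonneg) auto
    have psi: "\<psi> s \<ge> 0" for s by (simp add: \<psi>_def)
    have "(\<integral>\<^sup>+x. ennreal (indicator {0<..} x * (\<bar>kern r x u\<bar> * (1 + x) powr k)) \<partial>lborel)
      \<le> (\<integral>\<^sup>+x. ennreal (2 * K + u * K) * indicator {0..l * u} x
           + ennreal c * ennreal (indicator {0<..} (- (l * u) + 1 * x) * \<psi> (- (l * u) + 1 * x))
           + ennreal (2 * l * u) * ennreal (indicator {0<..} x * \<psi> x) \<partial>lborel)"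
    proof (rule nn_integral_mono)
      fix x :: real
      show "ennreal (indicator {0<..} x * (\<bar>kern r x u\<bar> * (1 + x) powr k))
        \<le> ennreal (2 * K + u * K) * indicator {0..l * u} x
           + ennreal c * ennreal (indicator {0<..} (- (l * u) + 1 * x) * \<psi> (- (l * u) + 1 * x))
           + ennreal (2 * l * u) * ennreal (indicator {0<..} x * \<psi> x)"
      proof (cases "x > 0")
        case True
        have eqs: "indicator {0<..} x = (1::real)" "- (l * u) + x = x - l * u" using True by auto
        have "ennreal (\<bar>kern r x u\<bar> * (1 + x) powr k)
          \<le> ennreal ((2 * K + u * K) * indicator {0..l * u} x + c * (indicator {0<..} (x - l * u) * \<psi> (x - l * u)) + 2 * l * u * \<psi> x)"
          using kern_weighted_bound[OF True u r k]
          by (intro ennreal_leI) (simp add: l_def[symmetric] K_def[symmetric] \<psi>_def c_def mult_ac)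
        also have "\<dots> = ennreal (2 * K + u * K) * ennreal (indicator {0..l * u} x)
           + ennreal c * ennreal (indicator {0<..} (x - l * u) * \<psi> (x - l * u)) + ennreal (2 * l * u) * ennreal (\<psi> x)"
          using K u l c psi by (intro ennreal_sum3) auto
        finally show ?thesis unfolding mult_1 eqs ennreal_indicator[symmetric] .
      qed simp
    qed
    also have "\<dots> = ennreal (2 * K + u * K) * ennreal (l * u) + ennreal c * ennreal I + ennreal (2 * l * u) * ennreal I"
    proof -
      have "(\<integral>\<^sup>+s. ennreal (indicator {0<..} (- (l * u) + 1 * s) * \<psi> (- (l * u) + 1 * s)) \<partial>lborel) = ennreal I"
        using nn_integral_real_affine[of "\<lambda>s. ennreal (indicator {0<..} s * \<psi> s)" 1 "- (l * u)"] int_psi by simp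
      then show ?thesis
        using l u by (simp add: nn_integral_add nn_integral_cmult int_psi)
    qed
    also have "\<dots> = ennreal ((2 * K + u * K) * (l * u) + c * I + 2 * l * u * I)"
      using K I u l c by (intro ennreal_sum3[symmetric]) auto
    also have "\<dots> \<le> ennreal ((3 * K + 3 * 2 powr k * I + 2 * I) * l * (1 + u) powr k)"
    proof (rule ennreal_leI)
      have w2: "u\<^sup>2 \<le> (1 + u) powr k" "u \<le> (1 + u) powr k"
      proof -
        have "u\<^sup>2 \<le> (1 + u) ^ 2" using u by (intro power_mono) auto
        also have "\<dots> = (1 + u) powr 2" using u by (simp add: powr_numeral)
        also have "\<dots> \<le> (1 + u) powr k" using u k by (intro powr_mono) auto
        finally show "u\<^sup>2 \<le> (1 + u) powr k" .
        have "1 + u \<le> (1 + u) powr k" using powr_mono[of 1 k "1 + u"] u k by simp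
        then show "u \<le> (1 + u) powr k" by simp
      qed
      have ml: "exp r * l\<^sup>2 = l" by (simp add: l_def exp_minus power2_eq_square)
      have "c = 2 * (min 1 ((l * u) ^ 1) * (1 + l * u) powr k) + exp r * (min 1 ((l * u) ^ 2) * (1 + l * u) powr k)"
        by (simp add: c_def algebra_simps)
      also have "\<dots> \<le> 2 * (2 powr k * l ^ 1 * (1 + u) powr k) + exp r * (2 powr k * l ^ 2 * (1 + u) powr k)"
        using u l k by (intro add_mono mult_left_mono min_power_weight) auto
      also have "\<dots> = 2 * (2 powr k * l * (1 + u) powr k) + (exp r * l\<^sup>2) * (2 powr k * (1 + u) powr k)"
        by (simp add: algebra_simps)
      also have "\<dots> = 3 * 2 powr k * l * (1 + u) powr k"
        unfolding ml by (simp add: algebra_simps)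
      finally have "c * I \<le> 3 * 2 powr k * l * (1 + u) powr k * I" using I by (intro mult_right_mono)
      moreover have "(2 * K * l) * u \<le> (2 * K * l) * (1 + u) powr k" "(K * l) * u\<^sup>2 \<le> (K * l) * (1 + u) powr k"
        "(2 * l * I) * u \<le> (2 * l * I) * (1 + u) powr k"
        using K l I w2 by (intro mult_left_mono; simp)+
      ultimately show "(2 * K + u * K) * (l * u) + c * I + 2 * l * u * I \<le> (3 * K + 3 * 2 powr k * I + 2 * I) * l * (1 + u) powr k"
        by (simp add: algebra_simps power2_eq_square)
    qed
    finally show ?thesis by (simp add: l_def)
  qed
  then show ?thesis using K I by (intro exI[of _ "3 * K + 3 * 2 powr k * I + 2 * I"]) auto
qed

lemma evol_bound:
  assumes k: "k \<ge> 2"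
  shows "\<exists>C>0. \<forall>r\<ge>0. \<forall>h\<in>L1 k. evol r h \<in> L1 k \<and> L1_norm k (evol r h) \<le> C * exp (- r) * L1_norm k h"
proof -
  obtain C where C: "C \<ge> 0" "\<And>r u. r \<ge> 0 \<Longrightarrow> u > 0 \<Longrightarrow>
     (\<integral>\<^sup>+x. ennreal (indicator {0<..} x * (\<bar>kern r x u\<bar> * (1 + x) powr k)) \<partial>lborel) \<le> ennreal (C * exp (- r) * (1 + u) powr k)"
    using kern_column_bound[OF k] by blast
  have "evol r h \<in> L1 k \<and> L1_norm k (evol r h) \<le> (1 + C) * exp (- r) * L1_norm k h" if r: "r \<ge> 0" and h: "h \<in> L1 k" for r h
  proof -
    note [measurable] = L1_measurable[OF h]
    note em = evol_measurable[OF L1_measurable[OF h], of r]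
    let ?w = "\<lambda>x::real. (1 + x) powr k"
    let ?D = "\<lambda>x. ennreal (\<bar>ext0 h (0 + exp r * x)\<bar> * ?w (0 + exp r * x))"
    let ?J = "\<lambda>x u. ennreal (indicator {0<..} x * (\<bar>kern r x u\<bar> * ?w x)) * ennreal \<bar>ext0 h u\<bar>"
    have "wnorm k (evol r h) \<le> (\<integral>\<^sup>+x. ?D x
        + (\<integral>\<^sup>+u. ?J x u \<partial>lborel) \<partial>lborel)"
      unfolding wnorm_ext0
    proof (rule nn_integral_mono)
      fix x :: real
      show "ennreal (\<bar>ext0 (evol r h) x\<bar> * ?w x) \<le> ?D x
        + (\<integral>\<^sup>+u. ?J x u \<partial>lborel)"
      proof (cases "x > 0")
        case True
        have ki: "integrable lborel (\<lambda>u. kern r x u * ext0 h u)"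
          using kern_integrable[OF h, of r x] k by (simp add: set_integrable_def ext0_def mult_ac)
        have "x \<le> exp r * x" using True r by simp
        then have "\<bar>ext0 h (exp r * x)\<bar> * ?w x \<le> \<bar>ext0 h (exp r * x)\<bar> * ?w (exp r * x)"
          using True k by (intro mult_left_mono powr_mono2) auto
        moreover have "\<bar>evol r h x\<bar> * ?w x \<le> \<bar>ext0 h (exp r * x)\<bar> * ?w x + ?w x * \<bar>LINT u|lborel. kern r x u * ext0 h u\<bar>"
        proof -
          have "\<bar>evol r h x\<bar> * ?w x \<le> (\<bar>ext0 h (exp r * x)\<bar> + \<bar>LINT u|lborel. kern r x u * ext0 h u\<bar>) * ?w x"
            unfolding evol_ext0[OF True] by (intro mult_right_mono abs_triangle_ineq) auto
          then show ?thesis by (simp add: algebra_simps)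
        qed
        ultimately have "ennreal (\<bar>evol r h x\<bar> * ?w x) \<le> ennreal (\<bar>ext0 h (exp r * x)\<bar> * ?w (exp r * x) + ?w x * \<bar>LINT u|lborel. kern r x u * ext0 h u\<bar>)"
          by (intro ennreal_leI) linarith
        also have "\<dots> = ennreal (\<bar>ext0 h (exp r * x)\<bar> * ?w (exp r * x)) + ennreal (?w x) * ennreal \<bar>LINT u|lborel. kern r x u * ext0 h u\<bar>"
          by (simp add: ennreal_plus ennreal_mult)
        also have "ennreal \<bar>LINT u|lborel. kern r x u * ext0 h u\<bar> \<le> (\<integral>\<^sup>+u. ennreal \<bar>kern r x u * ext0 h u\<bar> \<partial>lborel)"
          using integral_norm_bound_ennreal[OF ki] by simp
        also have "ennreal (?w x) * (\<integral>\<^sup>+u. ennreal \<bar>kern r x u * ext0 h u\<bar> \<partial>lborel)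
            = (\<integral>\<^sup>+u. ennreal (?w x) * ennreal \<bar>kern r x u * ext0 h u\<bar> \<partial>lborel)"
          by (rule nn_integral_cmult[symmetric]) measurable
        also have "\<dots> = (\<integral>\<^sup>+u. ?J x u \<partial>lborel)"
          using True by (intro nn_integral_cong) (simp add: abs_mult ennreal_mult mult_ac)
        finally show ?thesis using True by (simp add: ext0_def[of "evol r h"] add_left_mono mult_left_mono)
      qed (simp add: ext0_def)
    qed
    also have "\<dots> = (\<integral>\<^sup>+x. ?D x \<partial>lborel)
        + (\<integral>\<^sup>+x. \<integral>\<^sup>+u. ?J x u \<partial>lborel \<partial>lborel)"
      by (rule nn_integral_add) measurable
    also have "(\<integral>\<^sup>+x. ?D x \<partial>lborel) = ennreal (exp (- r)) * wnorm k h"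
    proof -
      have "wnorm k h = ennreal (exp r) * (\<integral>\<^sup>+x. ?D x \<partial>lborel)"
        unfolding wnorm_ext0 by (subst nn_integral_real_affine[where c = "exp r" and t = 0]) auto
      then have "ennreal (exp (- r)) * wnorm k h = ennreal (exp (- r) * exp r) * (\<integral>\<^sup>+x. ?D x \<partial>lborel)"
        by (simp add: ennreal_mult mult.assoc)
      then show ?thesis by (simp flip: exp_add)
    qed
    also have "(\<integral>\<^sup>+x. \<integral>\<^sup>+u. ?J x u \<partial>lborel \<partial>lborel)
       = (\<integral>\<^sup>+u. \<integral>\<^sup>+x. ?J x u \<partial>lborel \<partial>lborel)"
      by (rule lborel_pair.Fubini'[symmetric]) measurable
    also have "\<dots> \<le> (\<integral>\<^sup>+u. ennreal (C * exp (- r)) * ennreal (\<bar>ext0 h u\<bar> * ?w u) \<partial>lborel)"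
    proof (rule nn_integral_mono)
      fix u :: real
      have "(\<integral>\<^sup>+x. ?J x u \<partial>lborel)
          = (\<integral>\<^sup>+x. ennreal (indicator {0<..} x * (\<bar>kern r x u\<bar> * ?w x)) \<partial>lborel) * ennreal \<bar>ext0 h u\<bar>"
        by (rule nn_integral_multc) measurable
      also have "\<dots> \<le> ennreal (C * exp (- r) * ?w u) * ennreal \<bar>ext0 h u\<bar>"
        using C(2)[OF r, of u] by (cases "u > 0") (auto simp: ext0_def intro: mult_right_mono)
      also have "\<dots> = ennreal (C * exp (- r)) * ennreal (\<bar>ext0 h u\<bar> * ?w u)"
        using C(1) by (simp add: mult_ac flip: ennreal_mult)
      finally show "(\<integral>\<^sup>+x. ?J x u \<partial>lborel)
          \<le> ennreal (C * exp (- r)) * ennreal (\<bar>ext0 h u\<bar> * ?w u)" .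
    qed
    also have "\<dots> = ennreal (C * exp (- r)) * wnorm k h"
      unfolding wnorm_ext0 by (rule nn_integral_cmult) measurable
    finally have "wnorm k (evol r h) \<le> ennreal (exp (- r)) * wnorm k h + ennreal (C * exp (- r)) * wnorm k h"
      by (simp add: add_left_mono)
    also have "\<dots> = ennreal ((1 + C) * exp (- r) * L1_norm k h)"
      using C(1) wnorm_eq[OF h] L1_norm_nonneg[of k h]
      by (simp add: distrib_right ennreal_plus flip: ennreal_mult)
    finally have *: "wnorm k (evol r h) \<le> ennreal ((1 + C) * exp (- r) * L1_norm k h)" .
    then have L: "evol r h \<in> L1 k" using em by (auto simp: L1_iff intro: le_less_trans)
    then show ?thesis using L1_normI[OF L *] C(1) L1_norm_nonneg[of k h] by simp
  qed
  then show ?thesis using C(1) by (intro exI[of _ "1 + C"]) auto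
qed

section \<open>Dissipativity in an equivalent norm\<close>

text \<open>
  If the right side is finite, \<open>F'\<close> is absolutely integrable and its gauge integral is a Lebesgue
  integral; thus measurability of \<open>F'\<close> is enough.
\<close>

lemma FTC_abs_le:
  fixes F F' :: "real \<Rightarrow> real"
  assumes ab: "a \<le> b" and F: "\<And>x. a \<le> x \<Longrightarrow> x \<le> b \<Longrightarrow> (F has_field_derivative F' x) (at x)"
    and [measurable]: "F' \<in> borel_measurable borel"
  shows "ennreal \<bar>F b - F a\<bar> \<le> (\<integral>\<^sup>+x. ennreal (indicator {a..b} x * \<bar>F' x\<bar>) \<partial>lborel)"
proof (cases "(\<integral>\<^sup>+x. ennreal (indicator {a..b} x * \<bar>F' x\<bar>) \<partial>lborel) = \<infinity>")
  case False
  have i: "integrable lborel (\<lambda>x. indicator {a..b} x * F' x)"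
    unfolding integrable_iff_bounded using False by (simp add: abs_mult less_top)
  then have s: "set_integrable lborel {a..b} F'" by (simp add: set_integrable_def)
  have "(F' has_integral F b - F a) {a..b}"
    using ab F by (intro fundamental_theorem_of_calculus)
      (auto simp: has_real_derivative_iff_has_vector_derivative[symmetric] intro: DERIV_subset)
  then have "F b - F a = (LINT x|lborel. indicator {a..b} x * F' x)"
    using set_borel_integral_eq_integral(2)[OF s] by (simp add: integral_unique set_lebesgue_integral_def)
  then show ?thesis using integral_norm_bound_ennreal[OF i] by (simp add: abs_mult)
qed simp

lemma le_mult_exp_neg: "exp z * a \<le> q \<Longrightarrow> a \<le> q * exp (- (z::real))"
  by (simp add: exp_minus field_simps)

text \<open>
  On functions of vanishing first moment this is equivalent to \<open>L1_norm k\<close>. The factor \<open>C\<close> in the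
  decay estimate disappears in it, which is what allows estimates to be iterated.
\<close>

definition decay_norm :: "real \<Rightarrow> (real \<Rightarrow> real) \<Rightarrow> real" where
  "decay_norm k h = (SUP r\<in>{0..}. exp r * L1_norm k (evol r h))"

lemma evol_L1: "k \<ge> 2 \<Longrightarrow> r \<ge> 0 \<Longrightarrow> h \<in> L1 k \<Longrightarrow> evol r h \<in> L1 k"
  using evol_bound by blast

lemma decay_norm_equiv:
  assumes k: "k \<ge> 2"
  shows "\<exists>C>0. \<forall>h\<in>L1 k. decay_norm k h \<le> C * L1_norm k h \<and> (\<forall>r\<ge>0. exp r * L1_norm k (evol r h) \<le> decay_norm k h)"
proof -
  obtain C where C: "C > 0" "\<And>r h. r \<ge> 0 \<Longrightarrow> h \<in> L1 k \<Longrightarrow> L1_norm k (evol r h) \<le> C * exp (- r) * L1_norm k h"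
    using evol_bound[OF k] by blast
  have le: "exp r * L1_norm k (evol r h) \<le> C * L1_norm k h" if "r \<ge> 0" "h \<in> L1 k" for r h
  proof -
    have "exp r * L1_norm k (evol r h) \<le> exp r * (C * exp (- r) * L1_norm k h)"
      by (rule mult_left_mono[OF C(2)[OF that]]) simp
    also have "\<dots> = C * L1_norm k h"
      using exp_minus_inverse[of r] by algebra
    finally show ?thesis .
  qed
  show ?thesis
  proof (intro exI conjI ballI allI impI)
    fix h r assume h: "h \<in> L1 k"
    show "decay_norm k h \<le> C * L1_norm k h"
      unfolding decay_norm_def by (rule cSUP_least) (use le h in auto)
    assume r: "(0::real) \<le> r"
    have "bdd_above ((\<lambda>r. exp r * L1_norm k (evol r h)) ` {0..})"
      using le[OF _ h] by (intro bdd_aboveI[of _ "C * L1_norm k h"]) auto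
    then show "exp r * L1_norm k (evol r h) \<le> decay_norm k h"
      unfolding decay_norm_def by (intro cSUP_upper) (use r in auto)
  qed (rule C)
qed

lemma decay_norm_upper:
  "k \<ge> 2 \<Longrightarrow> h \<in> L1 k \<Longrightarrow> r \<ge> 0 \<Longrightarrow> exp r * L1_norm k (evol r h) \<le> decay_norm k h"
  using decay_norm_equiv by blast

lemma decay_norm_least:
  "(\<And>r. r \<ge> 0 \<Longrightarrow> exp r * L1_norm k (evol r h) \<le> B) \<Longrightarrow> decay_norm k h \<le> B"
  unfolding decay_norm_def by (rule cSUP_least) auto

lemma decay_norm_nonneg:
  assumes "k \<ge> 2" "h \<in> L1 k" shows "0 \<le> decay_norm k h"
  using decay_norm_upper[OF assms, of 0] L1_norm_nonneg[of k "evol 0 h"] by simp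

lemma decay_norm_lin:
  assumes k: "k \<ge> 2" and hg: "h \<in> L1 k" "g \<in> L1 k"
  shows "decay_norm k (\<lambda>x. a * h x + b * g x) \<le> \<bar>a\<bar> * decay_norm k h + \<bar>b\<bar> * decay_norm k g"
proof (rule decay_norm_least)
  fix r :: real assume r: "r \<ge> 0"
  have "evol r (\<lambda>x. a * h x + b * g x) = (\<lambda>x. a * evol r h x + b * evol r g x)"
    using evol_lin[OF hg] k by (intro ext) simp
  then have "exp r * L1_norm k (evol r (\<lambda>x. a * h x + b * g x))
      \<le> exp r * (\<bar>a\<bar> * L1_norm k (evol r h) + \<bar>b\<bar> * L1_norm k (evol r g))"
    using L1_lin(2)[OF evol_L1[OF k r hg(1)] evol_L1[OF k r hg(2)]] by (intro mult_left_mono) auto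
  also have "\<dots> = \<bar>a\<bar> * (exp r * L1_norm k (evol r h)) + \<bar>b\<bar> * (exp r * L1_norm k (evol r g))"
    by (simp add: algebra_simps)
  also have "\<dots> \<le> \<bar>a\<bar> * decay_norm k h + \<bar>b\<bar> * decay_norm k g"
    using r by (intro add_mono mult_left_mono decay_norm_upper k hg) auto
  finally show "exp r * L1_norm k (evol r (\<lambda>x. a * h x + b * g x)) \<le> \<bar>a\<bar> * decay_norm k h + \<bar>b\<bar> * decay_norm k g" .
qed

lemma L1_norm_le_decay_norm:
  assumes k: "k \<ge> 2" and h: "h \<in> L1 k" "first_moment h = 0"
  shows "L1_norm k h \<le> decay_norm k h"
  using decay_norm_upper[OF k h(1), of 0] h(2) by (simp add: evol_0[abs_def])

context test_function
begin

text \<open>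
  Since \<open>s \<mapsto> e\<^bsup>-s/d\<^esup> evol (r + s) \<phi> x\<close> has the derivative \<open>- (1/d) e\<^bsup>-s/d\<^esup> evol (r + s) f x\<close> with
  \<open>f = \<phi> - d lin_op \<phi>\<close>, integration over \<open>[0,S]\<close> and Tonelli's theorem bound \<open>\<parallel>evol r \<phi>\<parallel>\<close> by
  \<open>\<integral> (1/d) e\<^bsup>-s/d\<^esup> e\<^bsup>-(r+s)\<^esup> decay_norm f ds = e\<^bsup>-r\<^esup> decay_norm f / (1 + d)\<close> as \<open>S \<rightarrow> \<infinity>\<close>.
\<close>

lemma decay_norm_resolvent:
  assumes k: "k \<ge> 2" and d: "d > 0"
  shows "(1 + d) * decay_norm k \<phi> \<le> decay_norm k (\<lambda>x. \<phi> x - d * lin_op \<phi> x)"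
proof -
  define f where "f = (\<lambda>x. \<phi> x - d * lin_op \<phi> x)"
  define q where "q = decay_norm k f"
  have pL: "\<phi> \<in> L1 k" by (rule test_function_L1[OF test])
  have f_alt: "f = (\<lambda>x. 1 * \<phi> x + (- d) * lin_op \<phi> x)" by (simp add: f_def)
  have fL: "f \<in> L1 k" unfolding f_alt by (intro L1_lin pL lin_op_L1)
  have evf: "evol r f x = evol r \<phi> x - d * evol r (lin_op \<phi>) x" for r x
    unfolding f_alt using evol_lin[OF pL lin_op_L1, of r 1 "- d" x] k by simp
  have q0: "q \<ge> 0" unfolding q_def by (rule decay_norm_nonneg[OF k fL])
  obtain C where C: "C > 0" "\<And>h r. h \<in> L1 k \<Longrightarrow> r \<ge> 0 \<Longrightarrow> exp r * L1_norm k (evol r h) \<le> C * L1_norm k h"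
    using decay_norm_equiv[OF k] by (meson order_trans)
  have key: "exp r * L1_norm k (evol r \<phi>) \<le> exp (- (S / d)) * (C * L1_norm k \<phi>) + q / (1 + d)"
    if r: "r \<ge> 0" and S: "S > 0" for r S
  proof -
    let ?w = "\<lambda>x::real. (1 + x) powr k"
    let ?E = "exp (- (S / d))"
    let ?c = "\<lambda>s. indicator {0..S} s * ((1 / d) * exp (- (s / d)))"
    let ?J = "\<lambda>x s. ennreal (?c s) * ennreal (\<bar>ext0 (evol (r + s) f) x\<bar> * ?w x)"
    have evm: "(\<lambda>z. ext0 (evol (r + snd z) f) (fst z)) \<in> borel_measurable (borel \<Otimes>\<^sub>M borel)"
    proof -
      have "(\<lambda>z::real \<times> real. (snd z, fst z)) \<in> (borel \<Otimes>\<^sub>M borel) \<rightarrow>\<^sub>M (borel \<Otimes>\<^sub>M borel)" by measurable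
      from measurable_compose[OF this evol_measurable_pair[OF L1_measurable[OF fL], of r]]
      show ?thesis by simp
    qed
    note em = evol_measurable[OF L1_measurable[OF pL], measurable]
    have "wnorm k (evol r \<phi>) \<le> (\<integral>\<^sup>+x. ennreal (?E) * ennreal (\<bar>ext0 (evol (r + S) \<phi>) x\<bar> * ?w x)
       + (\<integral>\<^sup>+s. ?J x s \<partial>lborel) \<partial>lborel)"
      unfolding wnorm_ext0
    proof (rule nn_integral_mono)
      fix x :: real
      show "ennreal (\<bar>ext0 (evol r \<phi>) x\<bar> * ?w x) \<le> ennreal (?E) * ennreal (\<bar>ext0 (evol (r + S) \<phi>) x\<bar> * ?w x)
       + (\<integral>\<^sup>+s. ?J x s \<partial>lborel)"
      proof (cases "x > 0")
        case True
        have mx: "(\<lambda>s. evol (r + s) f x) \<in> borel_measurable borel"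
        proof -
          have "(\<lambda>s. (s, x)) \<in> borel \<rightarrow>\<^sub>M (borel \<Otimes>\<^sub>M borel :: (real \<times> real) measure)" by measurable
          from measurable_compose[OF this evol_measurable_pair[OF L1_measurable[OF fL], of r]]
          show ?thesis using True by (simp add: ext0_def)
        qed
        define F where "F s = exp (- (s / d)) * evol (r + s) \<phi> x" for s
        define F' where "F' s = - ((1 / d) * exp (- (s / d)) * evol (r + s) f x)" for s
        have D: "(F has_field_derivative F' s) (at s)" for s
        proof -
          have "((\<lambda>s. evol (r + s) \<phi> x) has_field_derivative evol (r + s) (lin_op \<phi>) x) (at s)"
          proof -
            have "((\<lambda>s. r + s) has_field_derivative 1) (at s)" by (auto intro!: derivative_eq_intros)
            from DERIV_chain2[OF evol_DERIV[OF True] this] show ?thesis by simp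
          qed
          then have "(F has_field_derivative exp (- (s / d)) * (- (1 / d)) * evol (r + s) \<phi> x
              + evol (r + s) (lin_op \<phi>) x * exp (- (s / d))) (at s)"
            unfolding F_def[abs_def] using d by (auto intro!: derivative_eq_intros)
          moreover have "exp (- (s / d)) * (- (1 / d)) * evol (r + s) \<phi> x
              + evol (r + s) (lin_op \<phi>) x * exp (- (s / d)) = F' s"
            using d by (simp add: F'_def evf field_simps)
          ultimately show ?thesis by simp
        qed
        have F'm: "F' \<in> borel_measurable borel" unfolding F'_def[abs_def] using mx by measurable
        let ?I = "(\<integral>\<^sup>+s. ennreal (?c s) * ennreal \<bar>evol (r + s) f x\<bar> \<partial>lborel)"
        have "ennreal \<bar>F S - F 0\<bar> \<le> (\<integral>\<^sup>+s. ennreal (indicator {0..S} s * \<bar>F' s\<bar>) \<partial>lborel)"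
          by (rule FTC_abs_le[OF _ D F'm]) (use S in auto)
        also have "\<dots> = ?I"
          using d by (intro nn_integral_cong) (simp add: F'_def abs_mult mult_ac flip: ennreal_mult)
        finally have 1: "ennreal \<bar>F S - F 0\<bar> \<le> ?I" .
        have "\<bar>evol r \<phi> x\<bar> = \<bar>F 0\<bar>" by (simp add: F_def)
        also have "\<dots> \<le> ?E * \<bar>evol (r + S) \<phi> x\<bar> + \<bar>F S - F 0\<bar>"
        proof -
          have "\<bar>F S\<bar> = ?E * \<bar>evol (r + S) \<phi> x\<bar>" by (simp add: F_def abs_mult)
          then show ?thesis by linarith
        qed
        finally have "ennreal (\<bar>evol r \<phi> x\<bar> * ?w x) \<le> ennreal ((?E * \<bar>evol (r + S) \<phi> x\<bar> + \<bar>F S - F 0\<bar>) * ?w x)"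
          by (intro ennreal_leI mult_right_mono) auto
        also have "\<dots> = ennreal (?E) * ennreal (\<bar>evol (r + S) \<phi> x\<bar> * ?w x) + ennreal \<bar>F S - F 0\<bar> * ennreal (?w x)"
          by (simp add: distrib_right mult.assoc ennreal_mult)
        also have "\<dots> \<le> ennreal (?E) * ennreal (\<bar>evol (r + S) \<phi> x\<bar> * ?w x)
            + ?I * ennreal (?w x)"
          by (intro add_left_mono mult_right_mono 1) auto
        also have "?I * ennreal (?w x)
            = (\<integral>\<^sup>+s. ennreal (?c s) * ennreal \<bar>evol (r + s) f x\<bar> * ennreal (?w x) \<partial>lborel)"
          using mx by (intro nn_integral_multc[symmetric]) measurable
        also have "\<dots> = (\<integral>\<^sup>+s. ?J x s \<partial>lborel)"
          using True by (intro nn_integral_cong) (simp add: ext0_def ennreal_mult mult.assoc)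
        finally show ?thesis using True by (simp add: ext0_def)
      qed (simp add: ext0_def)
    qed
    also have "\<dots> = ennreal (?E) * wnorm k (evol (r + S) \<phi>)
       + (\<integral>\<^sup>+x. \<integral>\<^sup>+s. ?J x s \<partial>lborel \<partial>lborel)"
    proof -
      have "(\<lambda>x. \<integral>\<^sup>+s. ?J x s \<partial>lborel) \<in> borel_measurable lborel"
        using evm by (intro lborel.borel_measurable_nn_integral) (simp add: case_prod_unfold)
      then show ?thesis
        unfolding wnorm_ext0 by (subst nn_integral_add) (auto simp: nn_integral_cmult)
    qed
    also have "(\<integral>\<^sup>+x. \<integral>\<^sup>+s. ?J x s \<partial>lborel \<partial>lborel)
        = (\<integral>\<^sup>+s. \<integral>\<^sup>+x. ?J x s \<partial>lborel \<partial>lborel)"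
      using evm by (intro lborel_pair.Fubini'[symmetric]) (simp add: case_prod_unfold)
    also have "\<dots> = (\<integral>\<^sup>+s. ennreal (?c s) * wnorm k (evol (r + s) f) \<partial>lborel)"
    proof -
      note [measurable] = evol_measurable[OF L1_measurable[OF fL]]
      have "(\<lambda>x. ennreal (\<bar>ext0 (evol (r + s) f) x\<bar> * ?w x)) \<in> borel_measurable lborel" for s
        by simp
      then show ?thesis unfolding wnorm_ext0 by (intro nn_integral_cong nn_integral_cmult)
    qed
    also have "\<dots> \<le> (\<integral>\<^sup>+s. ennreal ((q * exp (- r) / d) * exp (- (s * (1 / d + 1)))) * indicator {0..S} s \<partial>lborel)"
    proof (rule nn_integral_mono)
      fix s :: real
      show "ennreal (?c s) * wnorm k (evol (r + s) f) \<le> ennreal ((q * exp (- r) / d) * exp (- (s * (1 / d + 1)))) * indicator {0..S} s"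
      proof (cases "s \<in> {0..S}")
        case True
        then have rs: "r + s \<ge> 0" using r by auto
        have "L1_norm k (evol (r + s) f) \<le> q * exp (- (r + s))"
          using decay_norm_upper[OF k fL rs] by (intro le_mult_exp_neg) (simp add: q_def)
        then have "(1 / d) * exp (- (s / d)) * L1_norm k (evol (r + s) f) \<le> (1 / d) * exp (- (s / d)) * (q * exp (- (r + s)))"
          using d by (intro mult_left_mono) auto
        then have "?c s * L1_norm k (evol (r + s) f) \<le> (1 / d) * exp (- (s / d)) * (q * exp (- (r + s)))"
          using True by simp
        also have "\<dots> = (q * exp (- r) / d) * (exp (- (s / d)) * exp (- s))"         proof -
          have "exp (- (r + s)) = exp (- r) * exp (- s)" by (simp add: mult_exp_exp)
          then show ?thesis by (simp only:) simp
        qed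
        also have "exp (- (s / d)) * exp (- s) = exp (- (s * (1 / d + 1)))" by (simp add: mult_exp_exp algebra_simps)
        finally have "?c s * L1_norm k (evol (r + s) f) \<le> (q * exp (- r) / d) * exp (- (s * (1 / d + 1)))" .
        then show ?thesis
          using True d L1_norm_nonneg[of k] by (simp add: wnorm_eq[OF evol_L1[OF k rs fL]] ennreal_leI flip: ennreal_mult)
      qed simp
    qed
    also have "\<dots> = ennreal (- (q * exp (- r) / (1 + d)) * exp (- (S * (1 / d + 1))) - - (q * exp (- r) / (1 + d)) * exp (- (0 * (1 / d + 1))))"
    proof (rule nn_integral_FTC_Icc)
      fix s :: real
      define c K where "c = q * exp (- r) / (1 + d)" and "K = 1 / d + 1"
      have "K = (1 + d) / d" using d by (simp add: K_def field_simps)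
      then have cK: "c * K = q * exp (- r) / d" using d by (simp add: c_def)
      have "((\<lambda>s. - c * exp (- (s * K))) has_real_derivative (c * K) * exp (- (s * K))) (at s)"
        by (auto intro!: derivative_eq_intros)
      then show "((\<lambda>s. - (q * exp (- r) / (1 + d)) * exp (- (s * (1 / d + 1)))) has_real_derivative
          q * exp (- r) / d * exp (- (s * (1 / d + 1)))) (at s)"
        unfolding cK unfolding c_def K_def .
      show "0 \<le> q * exp (- r) / d * exp (- (s * (1 / d + 1)))" using q0 d by simp
    qed (use S in auto)
    also have "\<dots> \<le> ennreal (q * exp (- r) / (1 + d))"
      using q0 d by (intro ennreal_leI) simp
    finally have "wnorm k (evol r \<phi>) \<le> ennreal (?E) * wnorm k (evol (r + S) \<phi>) + ennreal (q * exp (- r) / (1 + d))"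
      by (simp add: add_left_mono)
    also have "\<dots> = ennreal (?E * L1_norm k (evol (r + S) \<phi>) + q * exp (- r) / (1 + d))"
      using r S q0 d L1_norm_nonneg[of k "evol (r + S) \<phi>"]
      by (simp add: wnorm_eq[OF evol_L1[OF k _ pL]] ennreal_mult)
    finally have "L1_norm k (evol r \<phi>) \<le> ?E * L1_norm k (evol (r + S) \<phi>) + q * exp (- r) / (1 + d)"
      using q0 d L1_norm_nonneg[of k "evol (r + S) \<phi>"] by (intro L1_normI[OF evol_L1[OF k r pL]]) auto
    then have "exp r * L1_norm k (evol r \<phi>) \<le> exp r * (?E * L1_norm k (evol (r + S) \<phi>) + q * exp (- r) / (1 + d))"
      by (rule mult_left_mono) simp
    also have "\<dots> = ?E * (exp r * L1_norm k (evol (r + S) \<phi>)) + q / (1 + d)"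
      by (simp add: distrib_left exp_minus)
    also have "?E * (exp r * L1_norm k (evol (r + S) \<phi>)) \<le> ?E * (exp (r + S) * L1_norm k (evol (r + S) \<phi>))"
      using S L1_norm_nonneg by (intro mult_left_mono mult_right_mono) auto
    also have "\<dots> \<le> ?E * (C * L1_norm k \<phi>)"
      using r S by (intro mult_left_mono C pL) auto
    finally show ?thesis by simp
  qed
  have "decay_norm k \<phi> \<le> q / (1 + d)"
  proof (rule decay_norm_least)
    fix r :: real assume r: "r \<ge> 0"
    have "((\<lambda>S. exp (- (S / d))) \<longlongrightarrow> 0) at_top" using d by real_asymp
    then have "((\<lambda>S. exp (- (S / d)) * (C * L1_norm k \<phi>) + q / (1 + d)) \<longlongrightarrow> 0 * (C * L1_norm k \<phi>) + q / (1 + d)) at_top"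
      by (intro tendsto_intros)
    then have "((\<lambda>S. exp (- (S / d)) * (C * L1_norm k \<phi>) + q / (1 + d)) \<longlongrightarrow> q / (1 + d)) at_top" by simp
    moreover have "\<forall>\<^sub>F S in at_top. exp r * L1_norm k (evol r \<phi>) \<le> exp (- (S / d)) * (C * L1_norm k \<phi>) + q / (1 + d)"
      using eventually_gt_at_top[of 0] by eventually_elim (rule key[OF r])
    ultimately show "exp r * L1_norm k (evol r \<phi>) \<le> q / (1 + d)"
      by (rule tendsto_lowerbound) simp
  qed
  then show ?thesis using d by (simp add: q_def f_def field_simps)
qed

end

lemma test_functionE:
  assumes "h \<in> test_functions" obtains a b where "test_function h a b"
  using assms unfolding test_functions_iff test_function_def by blast

lemma test_function_in_graph: "h \<in> test_functions \<Longrightarrow> (h, lin_op h) \<in> L0_graph k"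
proof -
  assume h: "h \<in> test_functions"
  then obtain a b where "test_function h a b" by (rule test_functionE)
  then have "lin_op h \<in> L1 k" by (rule test_function.lin_op_L1)
  then show ?thesis
    unfolding L0_graph_def using h test_function_L1[OF h, of k]
    by (auto simp: L1_norm_def intro!: exI[of _ "\<lambda>_. h"])
qed

lemma first_moment_le:
  assumes "h \<in> L1 k" "k \<ge> 1"
  shows "\<bar>first_moment h\<bar> \<le> L1_norm k h" "set_integrable lborel {0<..} (\<lambda>x. x * h x)"
proof -
  have "\<bar>x\<bar> \<le> 1 * (1 + x) powr k" if "x > 0" for x
    using powr_mono[of 1 k "1 + x"] assms(2) that by simp
  from L1_integrable_mult[OF assms(1) _ this]
  show "\<bar>first_moment h\<bar> \<le> L1_norm k h" "set_integrable lborel {0<..} (\<lambda>x. x * h x)"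
    by (simp_all add: first_moment_def)
qed

lemma first_moment_diff:
  assumes "h \<in> L1 k" "g \<in> L1 k" "k \<ge> 1"
  shows "first_moment (\<lambda>x. h x - g x) = first_moment h - first_moment g"
  unfolding first_moment_def
  using set_integral_diff(2)[OF first_moment_le(2)[OF assms(1,3)] first_moment_le(2)[OF assms(2,3)]]
  by (simp add: right_diff_distrib)

lemma decay_norm_diff_le:
  assumes k: "k \<ge> 2" and hg: "h \<in> L1 k" "g \<in> L1 k"
  shows "decay_norm k h \<le> decay_norm k g + decay_norm k (\<lambda>x. h x - g x)"
  using decay_norm_lin[OF k hg(2) L1_diff(1)[OF hg], of 1 1] by simp

lemma graph_first_moment:
  assumes k: "k \<ge> 1" and hg: "(h, g) \<in> L0_graph k"
  shows "first_moment g = 0"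
proof -
  obtain \<phi> where \<phi>: "\<And>n. \<phi> n \<in> test_functions" "\<And>n. lin_op (\<phi> n) \<in> L1 k"
    "(\<lambda>n. L1_norm k (\<lambda>x. lin_op (\<phi> n) x - g x)) \<longlonglongrightarrow> 0" and g: "g \<in> L1 k"
    using hg unfolding L0_graph_def by blast
  have "\<bar>first_moment g\<bar> \<le> L1_norm k (\<lambda>x. lin_op (\<phi> n) x - g x)" for n
  proof -
    obtain a b where "test_function (\<phi> n) a b" using \<phi>(1) by (rule test_functionE)
    then have "first_moment (lin_op (\<phi> n)) = 0" by (rule test_function.first_moment_lin_op)
    then show ?thesis
      using first_moment_le(1)[OF L1_diff(1)[OF \<phi>(2)[of n] g] k] first_moment_diff[OF \<phi>(2)[of n] g k] by simp
  qed
  then have "\<bar>first_moment g\<bar> \<le> 0" by (intro LIMSEQ_le_const[OF \<phi>(3)]) auto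
  then show ?thesis by simp
qed

lemma graph_dissipative:
  assumes k: "k \<ge> 2" and hg: "(h, g) \<in> L0_graph k" and d: "d > 0"
  shows "(1 + d) * decay_norm k h \<le> decay_norm k (\<lambda>x. h x - d * g x)"
proof -
  obtain \<phi> where \<phi>: "\<And>n. \<phi> n \<in> test_functions" "\<And>n. \<phi> n \<in> L1 k" "\<And>n. lin_op (\<phi> n) \<in> L1 k"
    and lim: "(\<lambda>n. L1_norm k (\<lambda>x. \<phi> n x - h x)) \<longlonglongrightarrow> 0"
    "(\<lambda>n. L1_norm k (\<lambda>x. lin_op (\<phi> n) x - g x)) \<longlonglongrightarrow> 0" and h: "h \<in> L1 k" and g: "g \<in> L1 k"
    using hg unfolding L0_graph_def by blast
  obtain C where C: "C > 0" "\<And>h. h \<in> L1 k \<Longrightarrow> decay_norm k h \<le> C * L1_norm k h"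
    using decay_norm_equiv[OF k] by blast
  let ?a = "\<lambda>n. L1_norm k (\<lambda>x. \<phi> n x - h x)" and ?b = "\<lambda>n. L1_norm k (\<lambda>x. lin_op (\<phi> n) x - g x)"
  have hd: "(\<lambda>x. h x - d * g x) \<in> L1 k" by (intro L1_diff L1_cmult h g)
  have "(1 + d) * decay_norm k h \<le> decay_norm k (\<lambda>x. h x - d * g x) + ((1 + d) * (C * ?a n) + C * (?a n + d * ?b n))" for n
  proof -
    have 1: "decay_norm k h \<le> decay_norm k (\<phi> n) + C * ?a n"
      using decay_norm_diff_le[OF k h \<phi>(2)[of n]] C(2)[OF L1_diff(1)[OF h \<phi>(2)[of n]]]
      by (simp add: L1_norm_commute[of k h])
    obtain a b where "test_function (\<phi> n) a b" using \<phi>(1) by (rule test_functionE)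
    then have 2: "(1 + d) * decay_norm k (\<phi> n) \<le> decay_norm k (\<lambda>x. \<phi> n x - d * lin_op (\<phi> n) x)"
      by (rule test_function.decay_norm_resolvent[OF _ k d])
    have pd: "(\<lambda>x. \<phi> n x - d * lin_op (\<phi> n) x) \<in> L1 k" by (intro L1_diff L1_cmult \<phi>)
    have "decay_norm k (\<lambda>x. (\<phi> n x - d * lin_op (\<phi> n) x) - (h x - d * g x))
        \<le> C * L1_norm k (\<lambda>x. (\<phi> n x - d * lin_op (\<phi> n) x) - (h x - d * g x))"
      by (intro C L1_diff pd hd)
    also have "(\<lambda>x. (\<phi> n x - d * lin_op (\<phi> n) x) - (h x - d * g x)) = (\<lambda>x. 1 * (\<phi> n x - h x) + (- d) * (lin_op (\<phi> n) x - g x))"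
      by (auto simp: algebra_simps)
    also have "L1_norm k \<dots> \<le> \<bar>1\<bar> * ?a n + \<bar>- d\<bar> * ?b n" by (intro L1_lin L1_diff \<phi> h g)
    finally have 3: "decay_norm k (\<lambda>x. (\<phi> n x - d * lin_op (\<phi> n) x) - (h x - d * g x)) \<le> C * (?a n + d * ?b n)"
      using C(1) d by (simp add: algebra_simps)
    have "(1 + d) * decay_norm k h \<le> (1 + d) * (decay_norm k (\<phi> n) + C * ?a n)"
      using 1 d by (intro mult_left_mono) auto
    then show ?thesis
      using 2 3 decay_norm_diff_le[OF k pd hd] by (simp add: algebra_simps)
  qed
  moreover have "(\<lambda>n. decay_norm k (\<lambda>x. h x - d * g x) + ((1 + d) * (C * ?a n) + C * (?a n + d * ?b n)))
     \<longlonglongrightarrow> decay_norm k (\<lambda>x. h x - d * g x) + ((1 + d) * (C * 0) + C * (0 + d * 0))"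
    by (intro tendsto_intros lim)
  ultimately show ?thesis
    using LIMSEQ_le_const[of _ "decay_norm k (\<lambda>x. h x - d * g x) + ((1 + d) * (C * 0) + C * (0 + d * 0))" "(1 + d) * decay_norm k h"]
    by simp
qed

section \<open>Uniform boundedness in the weighted space\<close>

lemma L1_sum: "(\<And>i. i < n \<Longrightarrow> f i \<in> L1 k) \<Longrightarrow> (\<lambda>x. \<Sum>i<n. f i x) \<in> L1 k" for n :: nat
proof (induction n)
  case (Suc n)
  then show ?case using L1_add(1)[of "\<lambda>x. \<Sum>i<n. f i x" k "f n"] by simp
qed (simp add: L1_zero)

text \<open>
  Completeness, in the form used below. The sum is defined pointwise; it converges almost
  everywhere because the series of absolute values has a finite integral.
\<close>

lemma L1_complete:
  assumes f: "\<And>i. f i \<in> L1 k" "\<And>i. L1_norm k (f i) \<le> c i" and c: "summable c"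
  shows "\<exists>h\<in>L1 k. \<forall>n. L1_norm k (\<lambda>x. h x - (\<Sum>i<n. f i x)) \<le> (\<Sum>i. c (i + n))"
proof -
  have c0: "c i \<ge> 0" for i using f(2)[of i] L1_norm_nonneg[of k "f i"] by linarith
  define h where "h x = (\<Sum>i. ext0 (f i) x)" for x
  let ?w = "\<lambda>x::real. (1 + x) powr k"
  have fm [measurable]: "ext0 (f i) \<in> borel_measurable borel" for i by (rule L1_measurable[OF f(1)])
  have hm [measurable]: "h \<in> borel_measurable borel" unfolding h_def[abs_def] by measurable
  have tail: "(\<integral>\<^sup>+x. (\<Sum>i. ennreal (\<bar>ext0 (f (i + n)) x\<bar> * ?w x)) \<partial>lborel) \<le> ennreal (\<Sum>i. c (i + n))" for n
  proof -
    have "(\<integral>\<^sup>+x. (\<Sum>i. ennreal (\<bar>ext0 (f (i + n)) x\<bar> * ?w x)) \<partial>lborel) = (\<Sum>i. wnorm k (f (i + n)))"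
      unfolding wnorm_ext0 by (rule nn_integral_suminf) measurable
    also have "\<dots> \<le> (\<Sum>i. ennreal (c (i + n)))"
      by (intro suminf_le summableI) (simp add: wnorm_eq[OF f(1)] f(2) ennreal_leI)
    also have "\<dots> = ennreal (\<Sum>i. c (i + n))"
      using c c0 by (intro suminf_ennreal2) (auto simp: summable_iff_shift)
    finally show ?thesis .
  qed
  have "AE x in lborel. (\<Sum>i. ennreal (\<bar>ext0 (f (i + 0)) x\<bar> * ?w x)) \<noteq> \<infinity>"
    by (rule nn_integral_PInf_AE) (use tail[of 0] in \<open>auto simp: top_unique\<close>)
  then have sums: "AE x in lborel. x > 0 \<longrightarrow> summable (\<lambda>i. \<bar>ext0 (f i) x\<bar>)"
  proof eventually_elim
    fix x :: real
    assume "(\<Sum>i. ennreal (\<bar>ext0 (f (i + 0)) x\<bar> * ?w x)) \<noteq> \<infinity>"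
    then have "summable (\<lambda>i. \<bar>ext0 (f i) x\<bar> * ?w x)"
      by (intro summable_suminf_not_top) auto
    then have "summable (\<lambda>i. \<bar>ext0 (f i) x\<bar> * ?w x * (1 / ?w x))" by (rule summable_mult2)
    then show "x > 0 \<longrightarrow> summable (\<lambda>i. \<bar>ext0 (f i) x\<bar>)" by auto
  qed
  have le: "wnorm k (\<lambda>x. h x - (\<Sum>i<n. f i x)) \<le> ennreal (\<Sum>i. c (i + n))" for n
  proof -
    have "wnorm k (\<lambda>x. h x - (\<Sum>i<n. f i x)) \<le> (\<integral>\<^sup>+x. (\<Sum>i. ennreal (\<bar>ext0 (f (i + n)) x\<bar> * ?w x)) \<partial>lborel)"
      unfolding wnorm_def
    proof (rule nn_integral_mono_AE, use sums in eventually_elim)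
      fix x :: real
      assume s: "x > 0 \<longrightarrow> summable (\<lambda>i. \<bar>ext0 (f i) x\<bar>)"
      show "ennreal (indicator {0<..} x * (\<bar>h x - (\<Sum>i<n. f i x)\<bar> * ?w x)) \<le> (\<Sum>i. ennreal (\<bar>ext0 (f (i + n)) x\<bar> * ?w x))"
      proof (cases "x > 0")
        case True
        have sa: "summable (\<lambda>i. \<bar>ext0 (f i) x\<bar>)" using s True by blast
        have san: "summable (\<lambda>i. \<bar>ext0 (f (i + n)) x\<bar>)"
          using summable_iff_shift[of "\<lambda>i. \<bar>ext0 (f i) x\<bar>" n] sa by simp
        have "h x - (\<Sum>i<n. f i x) = h x - (\<Sum>i<n. ext0 (f i) x)" using True by (simp add: ext0_def)
        also have "\<dots> = (\<Sum>i. ext0 (f (i + n)) x)"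
          unfolding h_def by (rule suminf_minus_initial_segment[symmetric, OF summable_rabs_cancel[OF sa]])
        also have "\<bar>\<dots>\<bar> \<le> (\<Sum>i. \<bar>ext0 (f (i + n)) x\<bar>)" by (rule summable_rabs[OF san])
        finally have "\<bar>h x - (\<Sum>i<n. f i x)\<bar> * ?w x \<le> (\<Sum>i. \<bar>ext0 (f (i + n)) x\<bar>) * ?w x"
          by (rule mult_right_mono) simp
        also have "\<dots> = (\<Sum>i. \<bar>ext0 (f (i + n)) x\<bar> * ?w x)" by (rule suminf_mult2[OF san])
        finally have "ennreal (\<bar>h x - (\<Sum>i<n. f i x)\<bar> * ?w x) \<le> ennreal (\<Sum>i. \<bar>ext0 (f (i + n)) x\<bar> * ?w x)"
          by (rule ennreal_leI)
        also have "\<dots> = (\<Sum>i. ennreal (\<bar>ext0 (f (i + n)) x\<bar> * ?w x))"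
          by (rule suminf_ennreal2[symmetric]) (auto intro: summable_mult2 san)
        finally show ?thesis using True by simp
      qed simp
    qed
    also have "\<dots> \<le> ennreal (\<Sum>i. c (i + n))" by (rule tail)
    finally show ?thesis .
  qed
  have "wnorm k h < \<infinity>" using le[of 0] by (auto intro: le_less_trans)
  then have hL: "h \<in> L1 k" by (simp add: L1_iff ext0_measurable hm)
  have "L1_norm k (\<lambda>x. h x - (\<Sum>i<n. f i x)) \<le> (\<Sum>i. c (i + n))" for n
  proof (rule L1_normI[OF _ le])
    show "(\<lambda>x. h x - (\<Sum>i<n. f i x)) \<in> L1 k" by (intro L1_diff hL L1_sum f)
    show "0 \<le> (\<Sum>i. c (i + n))" using c c0 by (intro suminf_nonneg) (auto simp: summable_iff_shift)
  qed
  then show ?thesis using hL by blast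
qed


definition bounded_op :: "real \<Rightarrow> ((real \<Rightarrow> real) \<Rightarrow> real \<Rightarrow> real) \<Rightarrow> bool" where
  "bounded_op k A \<longleftrightarrow> (\<forall>h\<in>L1 k. A h \<in> L1 k) \<and>
     (\<forall>h\<in>L1 k. \<forall>g\<in>L1 k. \<forall>a b. L1_eq (A (\<lambda>x. a * h x + b * g x)) (\<lambda>x. a * A h x + b * A g x)) \<and>
     (\<exists>M. \<forall>h\<in>L1 k. L1_norm k (A h) \<le> M * L1_norm k h)"

lemma L1_norm_cong:
  assumes "f \<in> L1 k" "g \<in> L1 k" "L1_eq f g" shows "L1_norm k f = L1_norm k g"
  using L1_norm_le_diff[OF assms(1,2)] L1_norm_le_diff[OF assms(2,1)] L1_eq_norm_0[OF assms(3), of k]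
    L1_norm_commute[of k f g] by simp

lemma bounded_op_L1: "bounded_op k A \<Longrightarrow> h \<in> L1 k \<Longrightarrow> A h \<in> L1 k"
  by (simp add: bounded_op_def)

lemma bounded_op_norm_lin:
  assumes A: "bounded_op k A" and hg: "h \<in> L1 k" "g \<in> L1 k"
  shows "L1_norm k (A (\<lambda>x. a * h x + b * g x)) = L1_norm k (\<lambda>x. a * A h x + b * A g x)"
  using A hg by (intro L1_norm_cong) (auto simp: bounded_op_def L1_lin)

text \<open>
  The operator norm as the least bound, so that smaller constants have counterexamples.
\<close>

lemma operator_norm_exists:
  assumes A: "bounded_op k A"
  obtains m where "m \<ge> 0" "\<And>h. h \<in> L1 k \<Longrightarrow> L1_norm k (A h) \<le> m * L1_norm k h"
    and "\<And>c. c < m \<Longrightarrow> c \<ge> 0 \<Longrightarrow> \<exists>h\<in>L1 k. L1_norm k (A h) > c * L1_norm k h"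
proof
  define S where "S = {M. M \<ge> 0 \<and> (\<forall>h\<in>L1 k. L1_norm k (A h) \<le> M * L1_norm k h)}"
  define m where "m = Inf S"
  obtain M where M: "\<forall>h\<in>L1 k. L1_norm k (A h) \<le> M * L1_norm k h" using A by (auto simp: bounded_op_def)
  have "max M 0 \<in> S"
  proof -
    have "L1_norm k (A h) \<le> max M 0 * L1_norm k h" if h: "h \<in> L1 k" for h
    proof -
      have "M * L1_norm k h \<le> max M 0 * L1_norm k h" by (intro mult_right_mono L1_norm_nonneg) simp
      then show ?thesis using M h by (meson order_trans)
    qed
    then show ?thesis by (simp add: S_def)
  qed
  then have ne: "S \<noteq> {}" by blast
  have bdd: "bdd_below S" unfolding S_def by (intro bdd_belowI[of _ 0]) auto
  show "m \<ge> 0" unfolding m_def using ne by (rule cInf_greatest) (simp add: S_def)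
  show "L1_norm k (A h) \<le> m * L1_norm k h" if h: "h \<in> L1 k" for h
  proof (cases "L1_norm k h = 0")
    case True
    then show ?thesis using M h by force
  next
    case False
    then have pos: "L1_norm k h > 0" using L1_norm_nonneg[of k h] by simp
    have "L1_norm k (A h) / L1_norm k h \<le> m"
      unfolding m_def by (rule cInf_greatest[OF ne]) (use h pos in \<open>auto simp: S_def field_simps\<close>)
    then show ?thesis using pos by (simp add: field_simps)
  qed
  show "\<exists>h\<in>L1 k. L1_norm k (A h) > c * L1_norm k h" if c: "c < m" "c \<ge> 0" for c
  proof (rule ccontr)
    assume "\<not> ?thesis"
    then have "c \<in> S" using c by (auto simp: S_def not_less)
    then have "m \<le> c" unfolding m_def using bdd by (rule cInf_lower)
    then show False using c by simp
  qed
qed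

text \<open>
  A gliding hump argument. If the operator norms are unbounded, a subsequence has norms \<open>m\<^sub>j \<ge> 4\<^sup>j\<close>. Add to
  the point \<open>X\<^sub>j\<close> a vector \<open>\<plusminus> g\<^sub>j\<close> of norm \<open>3\<^bsup>-j\<^esup>\<close> that nearly attains \<open>m\<^sub>j\<close>; for one of the signs the
  image has norm at least \<open>(3/4) m\<^sub>j 3\<^bsup>-j\<^esup>\<close>. All later corrections have total norm \<open>3\<^bsup>-j\<^esup>/2\<close> and
  cannot undo this, so the orbit of the limit is unbounded.
\<close>

lemma uniform_boundedness:
  assumes A: "\<And>n::nat. bounded_op k (A n)"
    and ptw: "\<And>h. h \<in> L1 k \<Longrightarrow> \<exists>B. \<forall>n. L1_norm k (A n h) \<le> B"
  shows "\<exists>M. \<forall>n. \<forall>h\<in>L1 k. L1_norm k (A n h) \<le> M * L1_norm k h"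
proof (rule ccontr)
  assume unb: "\<nexists>M. \<forall>n. \<forall>h\<in>L1 k. L1_norm k (A n h) \<le> M * L1_norm k h"
  let ?hump = "\<lambda>j n m g. m \<ge> 4 ^ j \<and> (\<forall>h\<in>L1 k. L1_norm k (A n h) \<le> m * L1_norm k h)
     \<and> g \<in> L1 k \<and> L1_norm k g = (1 / 3) ^ j \<and> L1_norm k (A n g) \<ge> 3 / 4 * m * (1 / 3) ^ j"
  have "\<forall>j::nat. \<exists>n m g. ?hump j n m g"
  proof
    fix j :: nat
    from unb obtain n h where nh: "h \<in> L1 k" "L1_norm k (A n h) > 4 ^ j * L1_norm k h"
      by (auto simp: not_le) (meson not_le)
    obtain m where m: "m \<ge> 0" "\<And>h. h \<in> L1 k \<Longrightarrow> L1_norm k (A n h) \<le> m * L1_norm k h"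
      "\<And>c. c < m \<Longrightarrow> c \<ge> 0 \<Longrightarrow> \<exists>h\<in>L1 k. L1_norm k (A n h) > c * L1_norm k h"
      using operator_norm_exists[OF A[of n]] by blast
    have "4 ^ j * L1_norm k h < m * L1_norm k h" using m(2)[OF nh(1)] nh(2) by linarith
    then have mj: "4 ^ j < m" using L1_norm_nonneg[of k h] by (simp add: mult_less_cancel_right)
    then have "m > 0" using zero_less_power[of "4::real" j] by linarith
    then obtain g where g: "g \<in> L1 k" "L1_norm k (A n g) > 3 / 4 * m * L1_norm k g"
      using m(3)[of "3 / 4 * m"] by auto
    have "L1_norm k g \<noteq> 0" using g m(2)[OF g(1)] by auto
    then have pos: "L1_norm k g > 0" using L1_norm_nonneg[of k g] by simp
    define a where "a = (1 / 3) ^ j / L1_norm k g"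
    have a: "a > 0" using pos by (simp add: a_def)
    have "3 / 4 * m * (1 / 3) ^ j = a * (3 / 4 * m * L1_norm k g)" using pos by (simp add: a_def)
    also have "\<dots> \<le> a * L1_norm k (A n g)" using g(2) a by (intro mult_left_mono) auto
    also have "\<dots> = L1_norm k (A n (\<lambda>x. a * g x))"
      using bounded_op_norm_lin[OF A g(1) g(1), of n a 0] a by (simp add: L1_norm_cmult)
    finally have lower: "3 / 4 * m * (1 / 3) ^ j \<le> L1_norm k (A n (\<lambda>x. a * g x))" .
    have "L1_norm k (\<lambda>x. a * g x) = (1 / 3) ^ j"
      unfolding L1_norm_cmult using pos by (simp add: a_def)
    then show "\<exists>n m g. ?hump j n m g"
      using mj m(2) L1_cmult[OF g(1), of a] lower
      by (intro exI[of _ n] exI[of _ m] exI[of _ "\<lambda>x. a * g x"] conjI ballI) (simp_all only: less_imp_le)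
  qed
  then obtain N m g where Nmg: "\<forall>j. ?hump j (N j) (m j) (g j)"
    unfolding choice_iff by blast
  have N: "\<And>j. m j \<ge> 4 ^ j" "\<And>j h. h \<in> L1 k \<Longrightarrow> L1_norm k (A (N j) h) \<le> m j * L1_norm k h"
    and g: "\<And>j. g j \<in> L1 k" "\<And>j. L1_norm k (g j) = (1 / 3) ^ j" "\<And>j. L1_norm k (A (N j) (g j)) \<ge> 3 / 4 * m j * (1 / 3) ^ j"
    using Nmg by blast+
  define good where "good j y \<longleftrightarrow> L1_norm k (A (N j) y) \<ge> L1_norm k (A (N j) (g j))" for j y
  define X where "X = rec_nat (\<lambda>x. 0) (\<lambda>j y. if good j (\<lambda>x. y x + g j x) then (\<lambda>x. y x + g j x) else (\<lambda>x. y x - g j x))"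
  define f where "f j = (if good j (\<lambda>x. X j x + g j x) then g j else (\<lambda>x. - g j x))" for j
  have X0: "X 0 = (\<lambda>x. 0)" and XSuc: "X (Suc j) = (\<lambda>x. X j x + f j x)" for j
    by (auto simp: X_def f_def)
  have fL: "f j \<in> L1 k" for j using g(1)[of j] L1_cmult[OF g(1)[of j], of "-1"] by (simp add: f_def)
  have fN: "L1_norm k (f j) = (1 / 3) ^ j" for j by (simp add: f_def g(2) L1_norm_minus)
  have Xsum: "X n = (\<lambda>x. \<Sum>i<n. f i x)" for n by (induction n) (auto simp: X0 XSuc)
  have XL: "X n \<in> L1 k" for n unfolding Xsum by (intro L1_sum fL)
  \<comment> \<open>Twice the image of \<open>g\<close> is the difference of the images of \<open>X \<plusminus> g\<close>, so one of these is large.\<close>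
  have XSg: "good j (X (Suc j))" for j
  proof (cases "good j (\<lambda>x. X j x + g j x)")
    case True
    then show ?thesis by (simp add: XSuc f_def)
  next
    case False
    let ?B = "A (N j)"
    let ?p = "\<lambda>x. X j x + g j x" and ?m = "\<lambda>x. X j x - g j x"
    have pm: "?p \<in> L1 k" "?m \<in> L1 k" by (intro L1_add L1_diff XL g)+
    have "(\<lambda>x. (1 / 2) * ?p x + (- (1 / 2)) * ?m x) = g j" by (auto simp: field_simps)
    then have "L1_norm k (?B (g j)) = L1_norm k (\<lambda>x. (1 / 2) * ?B ?p x + (- (1 / 2)) * ?B ?m x)"
      using bounded_op_norm_lin[OF A pm, of "N j" "1 / 2" "- (1 / 2)"] by simp
    also have "\<dots> \<le> \<bar>1 / 2\<bar> * L1_norm k (?B ?p) + \<bar>- (1 / 2)\<bar> * L1_norm k (?B ?m)"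
      by (intro L1_lin bounded_op_L1[OF A] pm)
    finally have "2 * L1_norm k (?B (g j)) \<le> L1_norm k (?B ?p) + L1_norm k (?B ?m)" by simp
    then have "good j ?m" using False by (simp add: good_def)
    then show ?thesis using False by (simp add: XSuc f_def)
  qed
  have geo: "summable (\<lambda>j. (1 / 3 :: real) ^ j)" by (rule summable_geometric) simp
  obtain h where h: "h \<in> L1 k" "\<And>n. L1_norm k (\<lambda>x. h x - (\<Sum>i<n. f i x)) \<le> (\<Sum>i. (1 / 3) ^ (i + n))"
    using L1_complete[OF fL eq_refl[OF fN] geo] by blast
  have tl: "(\<Sum>i. (1 / 3 :: real) ^ (i + Suc j)) = (1 / 3) ^ j / 2" for j
    using suminf_mult2[OF geo, of "(1 / 3) ^ Suc j"] suminf_geometric[of "1 / 3 :: real"]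
    by (simp add: power_add field_simps)
  obtain B where B: "\<And>n. L1_norm k (A n h) \<le> B" using ptw[OF h(1)] by blast
  have "(4 / 3) ^ j / 4 \<le> B" for j
  proof -
    let ?B = "A (N j)"
    have d: "(\<lambda>x. X (Suc j) x - h x) \<in> L1 k" by (intro L1_diff XL h)
    have "L1_norm k (\<lambda>x. X (Suc j) x - h x) \<le> (1 / 3) ^ j / 2"
      using h(2)[of "Suc j"] unfolding Xsum tl by (simp add: L1_norm_commute[of k h])
    moreover have "0 \<le> m j" using N(1)[of j] zero_le_power[of "4::real" j] by linarith
    ultimately have "m j * L1_norm k (\<lambda>x. X (Suc j) x - h x) \<le> m j * ((1 / 3) ^ j / 2)"
      by (rule mult_left_mono)
    then have "L1_norm k (?B (\<lambda>x. X (Suc j) x - h x)) \<le> m j * ((1 / 3) ^ j / 2)"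
      using N(2)[OF d, of j] by linarith
    moreover have "L1_norm k (?B (X (Suc j))) \<le> L1_norm k (?B h) + L1_norm k (?B (\<lambda>x. X (Suc j) x - h x))"
    proof -
      have "X (Suc j) = (\<lambda>x. 1 * h x + 1 * (X (Suc j) x - h x))" by auto
      then have "L1_norm k (?B (X (Suc j))) = L1_norm k (\<lambda>x. 1 * ?B h x + 1 * ?B (\<lambda>x. X (Suc j) x - h x) x)"
        using bounded_op_norm_lin[OF A h(1) d, of "N j" 1 1] by simp
      also have "\<dots> \<le> \<bar>1\<bar> * L1_norm k (?B h) + \<bar>1\<bar> * L1_norm k (?B (\<lambda>x. X (Suc j) x - h x))"
        by (intro L1_lin bounded_op_L1[OF A] h d)
      finally show ?thesis by simp
    qed
    moreover have "3 / 4 * m j * (1 / 3) ^ j \<le> L1_norm k (?B (X (Suc j)))"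
      using XSg[of j] g(3)[of j] by (simp add: good_def)
    ultimately have "m j * (1 / 3) ^ j / 4 \<le> L1_norm k (?B h)" by linarith
    moreover have "4 ^ j * (1 / 3) ^ j \<le> m j * (1 / 3) ^ j" using N(1) by (intro mult_right_mono) auto
    moreover have "(4 / 3 :: real) ^ j = 4 ^ j * (1 / 3) ^ j" by (simp flip: power_mult_distrib)
    ultimately show ?thesis using B[of "N j"] by linarith
  qed
  moreover obtain j where "4 * B < (4 / 3 :: real) ^ j" using real_arch_pow[of "4/3::real" "4 * B"] by auto
  ultimately show False by (metis (no_types) not_le pos_divide_le_eq zero_less_numeral mult.commute)
qed

section \<open>Semigroups generated by the closure\<close>

context
  fixes k T
  assumes T: "C0_semigroup k T"
begin

lemmas C0_unfolded = T[unfolded C0_semigroup_def]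

lemma C0_L1: "t \<ge> 0 \<Longrightarrow> h \<in> L1 k \<Longrightarrow> T t h \<in> L1 k"
  by (rule C0_unfolded[THEN conjunct1, rule_format])

lemma C0_lin:
  "t \<ge> 0 \<Longrightarrow> h \<in> L1 k \<Longrightarrow> g \<in> L1 k \<Longrightarrow>
    L1_eq (T t (\<lambda>x. a * h x + b * g x)) (\<lambda>x. a * T t h x + b * T t g x)"
  by (rule C0_unfolded[THEN conjunct2, THEN conjunct1, rule_format])

lemma C0_bounded: "t \<ge> 0 \<Longrightarrow> \<exists>M. \<forall>h\<in>L1 k. L1_norm k (T t h) \<le> M * L1_norm k h"
  by (rule C0_unfolded[THEN conjunct2, THEN conjunct2, THEN conjunct1, THEN spec, THEN mp])

lemma C0_zero: "h \<in> L1 k \<Longrightarrow> L1_eq (T 0 h) h"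
  by (rule C0_unfolded[THEN conjunct2, THEN conjunct2, THEN conjunct2, THEN conjunct1, rule_format])

lemma C0_add: "s \<ge> 0 \<Longrightarrow> t \<ge> 0 \<Longrightarrow> h \<in> L1 k \<Longrightarrow> L1_eq (T (s + t) h) (T s (T t h))"
  by (rule C0_unfolded[THEN conjunct2, THEN conjunct2, THEN conjunct2, THEN conjunct2, THEN conjunct1, rule_format])

lemma C0_tendsto: "h \<in> L1 k \<Longrightarrow> ((\<lambda>t. L1_norm k (\<lambda>x. T t h x - h x)) \<longlongrightarrow> 0) (at_right 0)"
  by (rule C0_unfolded[THEN conjunct2, THEN conjunct2, THEN conjunct2, THEN conjunct2, THEN conjunct2, rule_format])

lemma C0_bounded_op: "t \<ge> 0 \<Longrightarrow> bounded_op k (T t)"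
  unfolding bounded_op_def using C0_L1 C0_lin C0_bounded by (intro conjI ballI allI)

end

lemma C0_norm_add:
  assumes T: "C0_semigroup k T" and st: "s \<ge> 0" "t \<ge> 0" and h: "h \<in> L1 k"
  shows "L1_norm k (T (s + t) h) = L1_norm k (T s (T t h))"
  using st by (intro L1_norm_cong C0_add[OF T] C0_L1[OF T] h) auto

text \<open>
  Otherwise some \<open>s\<^sub>n \<rightarrow> 0\<close> would have \<open>\<parallel>T s\<^sub>n\<parallel> > n\<close>, although \<open>T s\<^sub>n h \<rightarrow> h\<close> for each \<open>h\<close>.
\<close>

lemma C0_local_bound:
  assumes T: "C0_semigroup k T"
  shows "\<exists>\<delta>>0. \<exists>M. \<forall>s. 0 \<le> s \<and> s \<le> \<delta> \<longrightarrow> (\<forall>h\<in>L1 k. L1_norm k (T s h) \<le> M * L1_norm k h)"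
proof (rule ccontr)
  define bounded_by where "bounded_by s c \<longleftrightarrow> (\<forall>h\<in>L1 k. L1_norm k (T s h) \<le> c * L1_norm k h)" for s c
  assume "\<not> ?thesis"
  then have neg: "\<not> (\<exists>\<delta>>0. \<exists>M. \<forall>s. 0 \<le> s \<and> s \<le> \<delta> \<longrightarrow> bounded_by s M)"
    unfolding bounded_by_def .
  have "\<exists>s. 0 \<le> s \<and> s \<le> inverse (real (Suc n)) \<and> \<not> bounded_by s (real n)" for n
  proof -
    have "inverse (real (Suc n)) > 0" by simp
    then show ?thesis using neg by blast
  qed
  then obtain s where s: "\<And>n. 0 \<le> s n" "\<And>n. s n \<le> inverse (real (Suc n))" "\<And>n. \<not> bounded_by (s n) (real n)"
    by metis
  have "\<exists>M. \<forall>n. \<forall>h\<in>L1 k. L1_norm k (T (s n) h) \<le> M * L1_norm k h"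
  proof (rule uniform_boundedness)
    show "bounded_op k (T (s n))" for n by (rule C0_bounded_op[OF T s(1)])
    fix h assume h: "h \<in> L1 k"
    have "\<forall>\<^sub>F t in at_right 0. L1_norm k (\<lambda>x. T t h x - h x) < 1"
      by (rule order_tendstoD(2)[OF C0_tendsto[OF T h]]) simp
    then obtain b where b: "b > 0" "\<And>t. 0 < t \<Longrightarrow> t < b \<Longrightarrow> L1_norm k (\<lambda>x. T t h x - h x) < 1"
      unfolding eventually_at_right_field by blast
    have small: "L1_norm k (T t h) \<le> L1_norm k h + 1" if "0 \<le> t" "t < b" for t
    proof (cases "t = 0")
      case True
      then show ?thesis using L1_norm_cong[OF C0_L1[OF T _ h] h C0_zero[OF T h]] by simp
    next
      case False
      then show ?thesis using L1_norm_le_diff[OF C0_L1[OF T that(1) h] h] b(2)[of t] that by simp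
    qed
    obtain n0 where n0: "inverse (real (Suc n0)) < b" using reals_Archimedean[OF b(1)] by blast
    have "L1_norm k (T (s n) h) \<le> L1_norm k h + 1 + (\<Sum>n<n0. L1_norm k (T (s n) h))" for n
    proof (cases "n < n0")
      case True
      then have "L1_norm k (T (s n) h) \<le> (\<Sum>n<n0. L1_norm k (T (s n) h))"
        by (intro member_le_sum) (auto simp: L1_norm_nonneg)
      then show ?thesis using L1_norm_nonneg[of k h] by simp
    next
      case False
      then have "inverse (real (Suc n)) \<le> inverse (real (Suc n0))" by (intro le_imp_inverse_le) auto
      then have "s n < b" using s(2)[of n] n0 by linarith
      then have "L1_norm k (T (s n) h) \<le> L1_norm k h + 1" by (intro small s)
      moreover have "0 \<le> (\<Sum>n<n0. L1_norm k (T (s n) h))" by (intro sum_nonneg L1_norm_nonneg)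
      ultimately show ?thesis by simp
    qed
    then show "\<exists>B. \<forall>n. L1_norm k (T (s n) h) \<le> B" by blast
  qed
  then obtain M where M: "\<And>n h. h \<in> L1 k \<Longrightarrow> L1_norm k (T (s n) h) \<le> M * L1_norm k h" by blast
  obtain n where n: "M < real n" using reals_Archimedean2 by blast
  have "L1_norm k (T (s n) h) \<le> real n * L1_norm k h" if "h \<in> L1 k" for h
    using M[OF that, of n] mult_right_mono[of M "real n" "L1_norm k h"] n L1_norm_nonneg[of k h] by simp
  then show False using s(3)[of n] by (simp add: bounded_by_def)
qed

lemma C0_bound:
  assumes T: "C0_semigroup k T" and t: "t \<ge> 0"
  shows "\<exists>M\<ge>0. \<forall>s. 0 \<le> s \<and> s \<le> t \<longrightarrow> (\<forall>h\<in>L1 k. L1_norm k (T s h) \<le> M * L1_norm k h)"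
proof -
  obtain \<delta> M0 where d: "\<delta> > 0" and M0: "\<And>s h. 0 \<le> s \<Longrightarrow> s \<le> \<delta> \<Longrightarrow> h \<in> L1 k \<Longrightarrow> L1_norm k (T s h) \<le> M0 * L1_norm k h"
    using C0_local_bound[OF T] by blast
  define M where "M = max M0 1"
  have M1: "M \<ge> 1" by (simp add: M_def)
  have M: "L1_norm k (T s h) \<le> M * L1_norm k h" if "0 \<le> s" "s \<le> \<delta>" "h \<in> L1 k" for s h
  proof -
    have "L1_norm k (T s h) \<le> M0 * L1_norm k h" by (rule M0[OF that])
    also have "\<dots> \<le> M * L1_norm k h" by (intro mult_right_mono L1_norm_nonneg) (simp add: M_def)
    finally show ?thesis .
  qed
  have step: "L1_norm k (T s h) \<le> M ^ Suc n * L1_norm k h"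
    if "0 \<le> s" "s \<le> real (Suc n) * \<delta>" "h \<in> L1 k" for n s h
    using that
  proof (induction n arbitrary: s)
    case 0
    then show ?case using M[of s h] by simp
  next
    case (Suc n)
    define s' where "s' = max 0 (s - \<delta>)"
    have s': "0 \<le> s'" "s' \<le> real (Suc n) * \<delta>" "0 \<le> s - s'" "s - s' \<le> \<delta>"
      using Suc.prems d by (auto simp: s'_def algebra_simps)
    have "L1_norm k (T s h) = L1_norm k (T (s - s') (T s' h))"
      using C0_norm_add[OF T s'(3,1) Suc.prems(3)] by simp
    also have "\<dots> \<le> M * L1_norm k (T s' h)" by (intro M s' C0_L1[OF T] Suc.prems)
    also have "\<dots> \<le> M * (M ^ Suc n * L1_norm k h)"
      using M1 by (intro mult_left_mono Suc.IH s' Suc.prems) auto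
    finally show ?case by simp
  qed
  obtain n where "t / \<delta> < real n" using reals_Archimedean2 by blast
  then have "t \<le> real (Suc n) * \<delta>" using d by (simp add: field_simps)
  then have "\<forall>s. 0 \<le> s \<and> s \<le> t \<longrightarrow> (\<forall>h\<in>L1 k. L1_norm k (T s h) \<le> M ^ Suc n * L1_norm k h)"
    using step[of _ n] by force
  moreover have "M ^ Suc n \<ge> 0" using M1 by simp
  ultimately show ?thesis by blast
qed

text \<open>
  Bounds \<open>\<parallel>(T\<^sub>\<tau> h - h) / \<tau> - T\<^sub>\<tau> g\<parallel>\<close>, the error of one backward difference quotient.
\<close>

definition generator_defect :: "real \<Rightarrow> (real \<Rightarrow> (real \<Rightarrow> real) \<Rightarrow> real \<Rightarrow> real) \<Rightarrow> (real \<Rightarrow> real) \<Rightarrow> (real \<Rightarrow> real) \<Rightarrow> real \<Rightarrow> real" where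
  "generator_defect k T h g \<tau> = L1_norm k (\<lambda>x. (T \<tau> h x - h x) / \<tau> - g x) + L1_norm k (\<lambda>x. T \<tau> g x - g x)"

lemma generator_defect_tendsto:
  assumes "C0_semigroup k T" "(h, g) \<in> generator_graph k T"
  shows "(generator_defect k T h g \<longlongrightarrow> 0) (at_right 0)"
proof -
  have "((\<lambda>\<tau>. L1_norm k (\<lambda>x. (T \<tau> h x - h x) / \<tau> - g x) + L1_norm k (\<lambda>x. T \<tau> g x - g x)) \<longlongrightarrow> 0 + 0) (at_right 0)"
    using assms C0_tendsto[OF assms(1), of g] by (intro tendsto_intros) (auto simp: generator_graph_def)
  then show ?thesis by (simp add: generator_defect_def[abs_def])
qed

text \<open>
  The left side is \<open>T\<^sub>\<sigma>\<close> applied to \<open>T\<^sub>\<tau> h - h - \<tau> T\<^sub>\<tau> g\<close>, so the error is uniform in \<open>\<sigma>\<close>.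
\<close>

lemma backward_step:
  assumes T: "C0_semigroup k T" and hg: "h \<in> L1 k" "g \<in> L1 k" and \<sigma>: "\<sigma> \<ge> 0" and \<tau>: "\<tau> > 0"
    and M: "\<And>f. f \<in> L1 k \<Longrightarrow> L1_norm k (T \<sigma> f) \<le> M * L1_norm k f" "M \<ge> 0"
  shows "L1_norm k (\<lambda>x. (T (\<sigma> + \<tau>) h x - \<tau> * T (\<sigma> + \<tau>) g x) - T \<sigma> h x) \<le> M * (\<tau> * generator_defect k T h g \<tau>)"
proof -
  note L = C0_L1[OF T]
  let ?Z = "(\<lambda>x. (T (\<sigma> + \<tau>) h x - \<tau> * T (\<sigma> + \<tau>) g x) - T \<sigma> h x)"
  define Y where "Y = (\<lambda>x. 1 * T \<tau> h x + (- \<tau>) * T \<tau> g x)"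
  define X where "X = (\<lambda>x. 1 * Y x + (- 1) * h x)"
  have YL: "Y \<in> L1 k" and XL: "X \<in> L1 k"
    unfolding X_def Y_def using \<tau> by (auto intro!: L1_lin L1_diff L1_add L1_cmult L hg)
  have "L1_eq ?Z (T \<sigma> X)"
  proof -
    have "L1_eq (T \<sigma> X) (\<lambda>x. 1 * T \<sigma> Y x + (- 1) * T \<sigma> h x)"
      unfolding X_def by (rule C0_lin[OF T \<sigma> YL hg(1)])
    moreover have "L1_eq (T \<sigma> Y) (\<lambda>x. 1 * T \<sigma> (T \<tau> h) x + (- \<tau>) * T \<sigma> (T \<tau> g) x)"
      unfolding Y_def using \<tau> by (intro C0_lin[OF T \<sigma>] L hg) auto
    moreover have "L1_eq (T (\<sigma> + \<tau>) h) (T \<sigma> (T \<tau> h))" "L1_eq (T (\<sigma> + \<tau>) g) (T \<sigma> (T \<tau> g))"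
      using \<sigma> \<tau> by (auto intro!: C0_add[OF T] hg)
    ultimately show ?thesis unfolding L1_eq_def by eventually_elim auto
  qed
  then have "L1_norm k ?Z = L1_norm k (T \<sigma> X)"
    using \<sigma> \<tau> by (intro L1_norm_cong L1_diff L1_cmult L hg XL) auto
  also have "\<dots> \<le> M * L1_norm k X" by (rule M(1)[OF XL])
  also have "L1_norm k X \<le> \<tau> * generator_defect k T h g \<tau>"
  proof -
    have q: "(\<lambda>x. (T \<tau> h x - h x) / \<tau> - g x) \<in> L1 k"
      using L1_diff(1)[OF L1_cmult[OF L1_diff(1)[OF L[of \<tau> h] hg(1)], of "1 / \<tau>"] hg(2)] \<tau> hg by simp
    have "X = (\<lambda>x. \<tau> * ((T \<tau> h x - h x) / \<tau> - g x) + (- \<tau>) * (T \<tau> g x - g x))"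
      using \<tau> by (auto simp: X_def Y_def field_simps)
    then have "L1_norm k X \<le> \<bar>\<tau>\<bar> * L1_norm k (\<lambda>x. (T \<tau> h x - h x) / \<tau> - g x) + \<bar>- \<tau>\<bar> * L1_norm k (\<lambda>x. T \<tau> g x - g x)"
      using \<tau> by (simp only:) (intro L1_lin q L1_diff L hg, simp)
    then show ?thesis using \<tau> by (simp add: generator_defect_def algebra_simps)
  qed
  finally show ?thesis using M(2) by (simp add: mult_left_mono)
qed

lemma generator_invariant:
  assumes T: "C0_semigroup k T" and gen: "(h, g) \<in> generator_graph k T" and s: "s \<ge> 0"
  shows "(T s h, T s g) \<in> generator_graph k T"
proof -
  note L = C0_L1[OF T]
  have hg: "h \<in> L1 k" "g \<in> L1 k" and lim: "((\<lambda>t. L1_norm k (\<lambda>x. (T t h x - h x) / t - g x)) \<longlongrightarrow> 0) (at_right 0)"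
    using gen by (auto simp: generator_graph_def)
  obtain M where M: "\<And>f. f \<in> L1 k \<Longrightarrow> L1_norm k (T s f) \<le> M * L1_norm k f"
    using C0_bounded[OF T s] by blast
  have "((\<lambda>t. L1_norm k (\<lambda>x. (T t (T s h) x - T s h x) / t - T s g x)) \<longlongrightarrow> 0) (at_right 0)"
  proof (rule Lim_null_comparison)
    show "\<forall>\<^sub>F t in at_right 0. norm (L1_norm k (\<lambda>x. (T t (T s h) x - T s h x) / t - T s g x))
        \<le> M * L1_norm k (\<lambda>x. (T t h x - h x) / t - g x)"
      using eventually_at_right_less[of 0]
    proof eventually_elim
      fix t :: real assume t: "0 < t"
      let ?Q = "(\<lambda>x. (1 / t) * T t (T s h) x + (- (1 / t)) * T s h x + (- 1) * T s g x)"
      define Y where "Y = (\<lambda>x. (1 / t) * T t h x + (- (1 / t)) * h x)"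
      define X where "X = (\<lambda>x. 1 * Y x + (- 1) * g x)"
      have YL: "Y \<in> L1 k" unfolding Y_def using t by (intro L1_lin L hg) auto
      have XL: "X \<in> L1 k" unfolding X_def by (intro L1_lin YL hg)
      have "L1_eq (T s X) (\<lambda>x. 1 * T s Y x + (- 1) * T s g x)"
        unfolding X_def by (rule C0_lin[OF T s YL hg(2)])
      moreover have "L1_eq (T s Y) (\<lambda>x. (1 / t) * T s (T t h) x + (- (1 / t)) * T s h x)"
        unfolding Y_def using t by (intro C0_lin[OF T s] L hg) auto
      moreover have "L1_eq (T (s + t) h) (T s (T t h))" "L1_eq (T (t + s) h) (T t (T s h))"
        using s t by (auto intro!: C0_add[OF T] hg)
      ultimately have "L1_eq ?Q (T s X)"
        unfolding L1_eq_def by eventually_elim (auto simp: add.commute)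
      moreover have "?Q \<in> L1 k"
        using s t L1_lin(1)[OF L1_lin(1)[of "T t (T s h)" k "T s h" "1 / t" "- (1 / t)"], of "T s g" 1 "- 1"] L hg by simp
      ultimately have "L1_norm k ?Q = L1_norm k (T s X)"
        by (intro L1_norm_cong L s XL) auto
      also have "\<dots> \<le> M * L1_norm k X" by (rule M[OF XL])
      also have "X = (\<lambda>x. (T t h x - h x) / t - g x)" by (auto simp: X_def Y_def diff_divide_distrib)
      finally show "norm (L1_norm k (\<lambda>x. (T t (T s h) x - T s h x) / t - T s g x))
          \<le> M * L1_norm k (\<lambda>x. (T t h x - h x) / t - g x)"
        by (simp add: L1_norm_nonneg diff_divide_distrib)
    qed
    show "((\<lambda>t. M * L1_norm k (\<lambda>x. (T t h x - h x) / t - g x)) \<longlongrightarrow> 0) (at_right 0)"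
      using tendsto_mult_right_zero[OF lim] .
  qed
  then show ?thesis using s by (simp add: generator_graph_def L hg)
qed

lemma implicit_recursion_bound:
  fixes a :: "nat \<Rightarrow> real"
  assumes "\<tau> > 0" "K \<ge> 0" "\<And>j. j < n \<Longrightarrow> (1 + \<tau>) * a (Suc j) \<le> a j + K"
  shows "j \<le> n \<Longrightarrow> a j \<le> a 0 / (1 + \<tau>) ^ j + real j * K"
proof (induction j)
  case (Suc j)
  have "a (Suc j) \<le> (a j + K) / (1 + \<tau>)"
    using assms(3)[of j] Suc.prems assms(1) by (simp add: field_simps)
  also have "\<dots> \<le> (a 0 / (1 + \<tau>) ^ j + real j * K + K) / (1 + \<tau>)"
    using Suc assms(1) by (intro divide_right_mono) auto
  also have "\<dots> = a 0 / (1 + \<tau>) ^ Suc j + (real j * K + K) / (1 + \<tau>)"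
    using assms(1) by (simp add: add_divide_distrib)
  also have "(real j * K + K) / (1 + \<tau>) \<le> (real j * K + K) / 1"
    using assms(1,2) by (intro divide_left_mono) auto
  finally show ?case by (simp add: algebra_simps)
qed simp

text \<open>
  Backward Euler with \<open>n + 1\<close> steps of length \<open>t / (n + 1)\<close>. Each step contracts \<open>decay_norm\<close> by
  \<open>1 / (1 + \<tau>)\<close> and, as elements of the range have first moment \<open>0\<close>, leaves the first moment fixed;
  the errors of all steps add up to a multiple of \<open>e n\<close>, which tends to \<open>0\<close>.
\<close>

lemma semigroup_domain_decay:
  assumes k: "k \<ge> 2" and T: "L0_semigroup k T" and gen: "(h, g) \<in> L0_graph k" and t: "t > 0"
  shows "decay_norm k (T t h) \<le> exp (- t) * decay_norm k h" "first_moment (T t h) = first_moment h"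
proof -
  have T0: "C0_semigroup k T" and GG: "generator_graph k T = L0_graph k" using T by (auto simp: L0_semigroup_def)
  note L = C0_L1[OF T0]
  have gen': "(h, g) \<in> generator_graph k T" using gen GG by simp
  have hg: "h \<in> L1 k" "g \<in> L1 k" using gen by (auto simp: L0_graph_def)
  have orbit: "(T s h, T s g) \<in> L0_graph k" if "s \<ge> 0" for s
    using generator_invariant[OF T0 gen' that] GG by simp
  obtain C where C: "C > 0" "\<And>h. h \<in> L1 k \<Longrightarrow> decay_norm k h \<le> C * L1_norm k h"
    using decay_norm_equiv[OF k] by blast
  obtain M where M: "M \<ge> 0" "\<And>s f. 0 \<le> s \<Longrightarrow> s \<le> t \<Longrightarrow> f \<in> L1 k \<Longrightarrow> L1_norm k (T s f) \<le> M * L1_norm k f"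
    using C0_bound[OF T0, of t] t by auto
  define \<tau> where "\<tau> n = t / real (Suc n)" for n
  define e where "e n = generator_defect k T h g (\<tau> n)" for n
  have \<tau>: "\<tau> n > 0" for n using t by (simp add: \<tau>_def)
  have Sn: "real (Suc n) * \<tau> n = t" for n by (simp add: \<tau>_def)
  have e0: "e n \<ge> 0" for n by (simp add: e_def generator_defect_def L1_norm_nonneg)
  have "(\<lambda>n. t * inverse (real (Suc n))) \<longlonglongrightarrow> t * 0"
    by (intro tendsto_intros LIMSEQ_inverse_real_of_nat)
  then have "filterlim \<tau> (at_right 0) sequentially"
    using \<tau> by (intro tendsto_imp_filterlim_at_right) (auto simp: \<tau>_def[abs_def] divide_inverse)
  from filterlim_compose[OF generator_defect_tendsto[OF T0 gen'] this]
  have elim: "e \<longlonglongrightarrow> 0" by (simp add: e_def[abs_def])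
  have step: "L1_norm k (\<lambda>x. (T (real (Suc j) * \<tau> n) h x - \<tau> n * T (real (Suc j) * \<tau> n) g x) - T (real j * \<tau> n) h x)
      \<le> M * (\<tau> n * e n)" if "j < Suc n" for j n
  proof -
    have "real j * \<tau> n \<le> real (Suc n) * \<tau> n" using that \<tau>[of n] by (intro mult_right_mono) auto
    then have "real j * \<tau> n \<le> t" by (simp only: Sn)
    moreover have "0 \<le> real j * \<tau> n" using \<tau>[of n] by simp
    moreover have "real (Suc j) * \<tau> n = real j * \<tau> n + \<tau> n" by (simp add: algebra_simps)
    ultimately show ?thesis
      unfolding e_def using backward_step[OF T0 hg, of "real j * \<tau> n" "\<tau> n" M] M \<tau>[of n] by (simp only:)
  qed
  have jt: "0 \<le> real j * \<tau> n" for j n using \<tau>[of n] by simp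
  have q0: "decay_norm k (T 0 h) \<le> decay_norm k h"
    using decay_norm_diff_le[OF k L[of 0 h] hg(1)] C(2)[OF L1_diff(1)[OF L[of 0 h] hg(1)]] L1_eq_norm_0[OF C0_zero[OF T0 hg(1)], of k] hg
    by simp
  have "decay_norm k (T t h) \<le> decay_norm k h / (1 + t / real (Suc n)) ^ Suc n + C * M * t * e n" for n
  proof -
    define a where "a j = decay_norm k (T (real j * \<tau> n) h)" for j
    have "(1 + \<tau> n) * a (Suc j) \<le> a j + C * (M * (\<tau> n * e n))" if j: "j < Suc n" for j
    proof -
      let ?z = "\<lambda>x. T (real (Suc j) * \<tau> n) h x - \<tau> n * T (real (Suc j) * \<tau> n) g x"
      have zL: "?z \<in> L1 k" by (intro L1_diff L1_cmult L hg jt)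
      have TL: "T (real j * \<tau> n) h \<in> L1 k" by (intro L hg jt)
      have "(1 + \<tau> n) * a (Suc j) \<le> decay_norm k ?z"
        unfolding a_def by (rule graph_dissipative[OF k orbit[OF jt] \<tau>])
      also have "\<dots> \<le> a j + decay_norm k (\<lambda>x. ?z x - T (real j * \<tau> n) h x)"
        unfolding a_def by (rule decay_norm_diff_le[OF k zL TL])
      also have "decay_norm k (\<lambda>x. ?z x - T (real j * \<tau> n) h x) \<le> C * L1_norm k (\<lambda>x. ?z x - T (real j * \<tau> n) h x)"
        by (intro C L1_diff zL TL)
      also have "\<dots> \<le> C * (M * (\<tau> n * e n))" using step[OF j] C(1) by (intro mult_left_mono) auto
      finally show ?thesis by simp
    qed
    then have "a (Suc n) \<le> a 0 / (1 + \<tau> n) ^ Suc n + real (Suc n) * (C * (M * (\<tau> n * e n)))"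
      using \<tau>[of n] C(1) M(1) e0[of n] by (intro implicit_recursion_bound[where n = "Suc n"]) auto
    moreover have "real (Suc n) * (C * (M * (\<tau> n * e n))) = C * M * t * e n"
      unfolding Sn[of n, symmetric] by (simp only: mult_ac)
    moreover have "a 0 / (1 + \<tau> n) ^ Suc n \<le> decay_norm k h / (1 + \<tau> n) ^ Suc n"
      using q0 \<tau>[of n] by (intro divide_right_mono) (auto simp: a_def)
    moreover have "a (Suc n) = decay_norm k (T t h)" unfolding a_def Sn ..
    ultimately show ?thesis unfolding \<tau>_def[symmetric] by linarith
  qed
  moreover have "(\<lambda>n. decay_norm k h / (1 + t / real (Suc n)) ^ Suc n + C * M * t * e n) \<longlonglongrightarrow> decay_norm k h / exp t + C * M * t * 0"
    by (intro tendsto_intros elim LIMSEQ_Suc[OF tendsto_exp_limit_sequentially]) simp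
  ultimately have "decay_norm k (T t h) \<le> decay_norm k h / exp t + C * M * t * 0"
    by (intro LIMSEQ_le_const) auto
  then show "decay_norm k (T t h) \<le> exp (- t) * decay_norm k h" by (simp add: exp_minus field_simps)
  have "\<bar>first_moment (T t h) - first_moment (T 0 h)\<bar> \<le> M * t * e n" for n
  proof -
    define b where "b j = first_moment (T (real j * \<tau> n) h)" for j
    have b: "\<bar>b (Suc j) - b j\<bar> \<le> M * (\<tau> n * e n)" if j: "j < Suc n" for j
    proof -
      let ?h = "T (real (Suc j) * \<tau> n) h" and ?g = "T (real (Suc j) * \<tau> n) g"
      have hL: "?h \<in> L1 k" and gL: "(\<lambda>x. \<tau> n * ?g x) \<in> L1 k" by (intro L1_cmult L hg jt)+
      have zL: "(\<lambda>x. ?h x - \<tau> n * ?g x) \<in> L1 k" by (intro L1_diff hL gL)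
      have TL: "T (real j * \<tau> n) h \<in> L1 k" by (intro L hg jt)
      have k1: "k \<ge> 1" using k by simp
      have "first_moment (\<lambda>x. \<tau> n * ?g x) = \<tau> n * first_moment ?g"
        unfolding first_moment_def set_integral_mult_right[symmetric] by (simp add: mult.left_commute)
      then have "first_moment (\<lambda>x. \<tau> n * ?g x) = 0" 
        by (simp only: graph_first_moment[OF k1 orbit[OF jt]] mult_zero_right)
      moreover have "first_moment (\<lambda>x. ?h x - \<tau> n * ?g x) = first_moment ?h - first_moment (\<lambda>x. \<tau> n * ?g x)"
        by (rule first_moment_diff[OF hL gL k1])
      moreover have "first_moment (\<lambda>x. (?h x - \<tau> n * ?g x) - T (real j * \<tau> n) h x)
          = first_moment (\<lambda>x. ?h x - \<tau> n * ?g x) - first_moment (T (real j * \<tau> n) h)"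
        by (rule first_moment_diff[OF zL TL k1])
      moreover have "\<bar>first_moment (\<lambda>x. (?h x - \<tau> n * ?g x) - T (real j * \<tau> n) h x)\<bar>
          \<le> L1_norm k (\<lambda>x. (?h x - \<tau> n * ?g x) - T (real j * \<tau> n) h x)"
        by (rule first_moment_le(1)[OF L1_diff(1)[OF zL TL] k1])
      moreover note step[OF j]
      ultimately show ?thesis unfolding b_def by linarith
    qed
    have "\<bar>b j - b 0\<bar> \<le> real j * (M * (\<tau> n * e n))" if "j \<le> Suc n" for j
      using that
    proof (induction j)
      case (Suc j)
      then have "\<bar>b j - b 0\<bar> \<le> real j * (M * (\<tau> n * e n))" "\<bar>b (Suc j) - b j\<bar> \<le> M * (\<tau> n * e n)"
        using b[of j] by auto
      then have "\<bar>b (Suc j) - b 0\<bar> \<le> real j * (M * (\<tau> n * e n)) + M * (\<tau> n * e n)" by linarith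
      then show ?case by (simp add: algebra_simps)
    qed simp
    from this[of "Suc n"] have "\<bar>b (Suc n) - b 0\<bar> \<le> M * (real (Suc n) * \<tau> n) * e n" by (simp add: algebra_simps)
    then show ?thesis unfolding b_def Sn by simp
  qed
  moreover have "(\<lambda>n. M * t * e n) \<longlonglongrightarrow> M * t * 0" by (intro tendsto_intros elim)
  ultimately have "\<bar>first_moment (T t h) - first_moment (T 0 h)\<bar> \<le> M * t * 0" by (intro LIMSEQ_le_const) auto
  moreover have "\<bar>first_moment (T 0 h) - first_moment h\<bar> \<le> 0"
    using first_moment_le(1)[OF L1_diff(1)[OF L[of 0 h] hg(1)]] first_moment_diff[OF L[of 0 h] hg(1)]
      L1_eq_norm_0[OF C0_zero[OF T0 hg(1)], of k] hg k by simp
  ultimately show "first_moment (T t h) = first_moment h" by simp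
qed

lemma le_of_le_add_mult:
  fixes a b K :: real
  assumes K: "K \<ge> 0" and le: "\<And>e. e > 0 \<Longrightarrow> a \<le> b + K * e" shows "a \<le> b"
proof (rule field_le_epsilon)
  fix e :: real assume e: "e > 0"
  have "a \<le> b + K * (e / (K + 1))" using K e by (intro le) simp
  also have "K * (e / (K + 1)) \<le> e" using K e by (simp add: field_simps)
  finally show "a \<le> b + e" by simp
qed

lemma semigroup_decay:
  assumes k: "k \<ge> 2" and T: "L0_semigroup k T" and h: "h \<in> L1 k" and t: "t > 0"
  shows "decay_norm k (T t h) \<le> exp (- t) * decay_norm k h" "first_moment (T t h) = first_moment h"
proof -
  have T0: "C0_semigroup k T" using T by (auto simp: L0_semigroup_def)
  note L = C0_L1[OF T0]
  have k1: "k \<ge> 1" using k by simp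
  obtain C where C: "C > 0" "\<And>h. h \<in> L1 k \<Longrightarrow> decay_norm k h \<le> C * L1_norm k h"
    using decay_norm_equiv[OF k] by blast
  obtain M where M: "M \<ge> 0" "\<And>f. f \<in> L1 k \<Longrightarrow> L1_norm k (T t f) \<le> M * L1_norm k f"
    using C0_bound[OF T0, of t] t by auto
  have approx: "\<exists>\<phi>. (\<phi>, lin_op \<phi>) \<in> L0_graph k \<and> \<phi> \<in> L1 k \<and> L1_norm k (\<lambda>x. \<phi> x - h x) \<le> e
      \<and> L1_norm k (\<lambda>x. T t h x - T t \<phi> x) \<le> M * e" if e: "e > 0" for e
  proof -
    obtain \<phi> where \<phi>: "\<phi> \<in> test_functions" "L1_norm k (\<lambda>x. \<phi> x - h x) < e"
      using test_functions_dense[OF h] e unfolding test_closure_def by blast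
    have pL: "\<phi> \<in> L1 k" by (rule test_function_L1[OF \<phi>(1)])
    have "L1_norm k (\<lambda>x. T t h x - T t \<phi> x) = L1_norm k (T t (\<lambda>x. h x - \<phi> x))"
      using bounded_op_norm_lin[OF C0_bounded_op[OF T0, of t] h pL, of 1 "- 1"] t by simp
    also have "\<dots> \<le> M * L1_norm k (\<lambda>x. h x - \<phi> x)" by (intro M L1_diff h pL)
    also have "\<dots> \<le> M * e" using \<phi>(2) M(1) by (intro mult_left_mono) (auto simp: L1_norm_commute[of k h])
    finally show ?thesis using \<phi> pL test_function_in_graph[OF \<phi>(1)] by (intro exI[of _ \<phi>]) auto
  qed
  show "decay_norm k (T t h) \<le> exp (- t) * decay_norm k h"
  proof (rule le_of_le_add_mult)
    show "0 \<le> exp (- t) * C + C * M" using C(1) M(1) by simp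
    fix e :: real assume "e > 0"
    then obtain \<phi> where \<phi>: "(\<phi>, lin_op \<phi>) \<in> L0_graph k" "\<phi> \<in> L1 k" "L1_norm k (\<lambda>x. \<phi> x - h x) \<le> e"
      "L1_norm k (\<lambda>x. T t h x - T t \<phi> x) \<le> M * e" using approx by blast
    have TL: "T t h \<in> L1 k" "T t \<phi> \<in> L1 k" using t by (auto intro!: L h \<phi>)
    have "decay_norm k (T t h) \<le> decay_norm k (T t \<phi>) + C * L1_norm k (\<lambda>x. T t h x - T t \<phi> x)"
      using decay_norm_diff_le[OF k TL] C(2)[OF L1_diff(1)[OF TL]] by linarith
    also have "decay_norm k (T t \<phi>) \<le> exp (- t) * decay_norm k \<phi>"
      by (rule semigroup_domain_decay[OF k T \<phi>(1) t])
    also have "decay_norm k \<phi> \<le> decay_norm k h + C * L1_norm k (\<lambda>x. \<phi> x - h x)"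
      using decay_norm_diff_le[OF k \<phi>(2) h] C(2)[OF L1_diff(1)[OF \<phi>(2) h]] by linarith
    also have "C * L1_norm k (\<lambda>x. \<phi> x - h x) \<le> C * e" using C(1) \<phi>(3) by (intro mult_left_mono) auto
    also have "C * L1_norm k (\<lambda>x. T t h x - T t \<phi> x) \<le> C * (M * e)" using C(1) \<phi>(4) by (intro mult_left_mono) auto
    finally show "decay_norm k (T t h) \<le> exp (- t) * decay_norm k h + (exp (- t) * C + C * M) * e"
      by (simp add: algebra_simps)
  qed
  have "\<bar>first_moment (T t h) - first_moment h\<bar> \<le> 0"
  proof (rule le_of_le_add_mult)
    show "0 \<le> M + 1" using M(1) by simp
    fix e :: real assume "e > 0"
    then obtain \<phi> where \<phi>: "(\<phi>, lin_op \<phi>) \<in> L0_graph k" "\<phi> \<in> L1 k" "L1_norm k (\<lambda>x. \<phi> x - h x) \<le> e"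
      "L1_norm k (\<lambda>x. T t h x - T t \<phi> x) \<le> M * e" using approx by blast
    have TL: "T t h \<in> L1 k" "T t \<phi> \<in> L1 k" using t by (auto intro!: L h \<phi>)
    have "\<bar>first_moment (T t h) - first_moment (T t \<phi>)\<bar> \<le> M * e" "\<bar>first_moment \<phi> - first_moment h\<bar> \<le> e"
      using first_moment_le(1)[OF L1_diff(1)[OF TL] k1] first_moment_diff[OF TL k1]
        first_moment_le(1)[OF L1_diff(1)[OF \<phi>(2) h] k1] first_moment_diff[OF \<phi>(2) h k1] \<phi>(3,4) by auto
    moreover have "first_moment (T t \<phi>) = first_moment \<phi>" by (rule semigroup_domain_decay[OF k T \<phi>(1) t])
    ultimately show "\<bar>first_moment (T t h) - first_moment h\<bar> \<le> 0 + (M + 1) * e" by (simp add: algebra_simps)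
  qed
  then show "first_moment (T t h) = first_moment h" by simp
qed

theorem theorem6p5:
  fixes k :: real
  assumes "k > 2"
  shows "\<exists>C>0.
    (\<forall>T. L0_semigroup k T \<longrightarrow>
       (\<forall>h0\<in>L1 k. first_moment h0 = 0 \<longrightarrow>
          (\<forall>t\<ge>0. L1_norm k (T t h0) \<le> C * exp (- (1 / 2) * t) * L1_norm k h0))) \<and>
    (\<forall>h g. (h, g) \<in> L0_graph k \<longrightarrow> first_moment h = 0 \<longrightarrow>
       L1_norm k g \<ge> 1 / (2 * C) * L1_norm k h)"
proof -
  have k: "k \<ge> 2" using assms by simp
  obtain C where C: "C > 0" "\<And>h. h \<in> L1 k \<Longrightarrow> decay_norm k h \<le> C * L1_norm k h"
    using decay_norm_equiv[OF k] by blast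
  have semigroup: "L1_norm k (T t h0) \<le> C * exp (- (1 / 2) * t) * L1_norm k h0"
    if T: "L0_semigroup k T" and h0: "h0 \<in> L1 k" "first_moment h0 = 0" and t: "t \<ge> 0" for T h0 t
  proof (cases "t = 0")
    case True
    have T0: "C0_semigroup k T" using T by (simp add: L0_semigroup_def)
    have "L1_norm k (T 0 h0) = L1_norm k h0"
      by (intro L1_norm_cong C0_L1[OF T0] C0_zero[OF T0] h0) simp
    then show ?thesis
      using L1_norm_le_decay_norm[OF k h0] C(2)[OF h0(1)] True by simp
  next
    case False
    then have t: "t > 0" using t by simp
    have T0: "C0_semigroup k T" using T by (simp add: L0_semigroup_def)
    have "L1_norm k (T t h0) \<le> decay_norm k (T t h0)"
      using semigroup_decay(2)[OF k T h0(1) t] h0 t by (intro L1_norm_le_decay_norm k C0_L1[OF T0]) auto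
    also have "\<dots> \<le> exp (- t) * decay_norm k h0" by (rule semigroup_decay(1)[OF k T h0(1) t])
    also have "\<dots> \<le> exp (- (1 / 2) * t) * (C * L1_norm k h0)"
      using t C h0 decay_norm_nonneg[OF k h0(1)] by (intro mult_mono) auto
    finally show ?thesis by (simp add: mult_ac)
  qed
  have resolvent: "1 / (2 * C) * L1_norm k h \<le> L1_norm k g"
    if hg: "(h, g) \<in> L0_graph k" and m: "first_moment h = 0" for h g
  proof -
    have L: "h \<in> L1 k" "g \<in> L1 k" using hg by (auto simp: L0_graph_def)
    have "(1 + 1) * decay_norm k h \<le> decay_norm k (\<lambda>x. h x - 1 * g x)"
      by (rule graph_dissipative[OF k hg]) simp
    also have "\<dots> \<le> decay_norm k h + decay_norm k g"
      using decay_norm_lin[OF k L, of 1 "- 1"] by simp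
    finally have "decay_norm k h \<le> decay_norm k g" by simp
    then have "L1_norm k h \<le> C * L1_norm k g"
      using L1_norm_le_decay_norm[OF k L(1) m] C(2)[OF L(2)] by linarith
    moreover have "0 \<le> C * L1_norm k g" using C(1) L1_norm_nonneg by simp
    ultimately show ?thesis using C(1) by (simp add: field_simps)
  qed
  show ?thesis using C(1) semigroup resolvent by blast
qed

end
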